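(* Let $A$ be a formally smooth algebra and $f:A\to B$ a morphism of associative unital algebras. Then for any $n\ge1$ and $\lambda\in\Lambda_q(n)$ there is a short exact sequence $$0\to F_{n-1}D_\lambda(f)\hookrightarrow D_\lambda(f)\xrightarrow{\ \Sigma\ }D_{(1^n)}(f)\to0,$$ where $\Sigma(P)=P_{(1^n)}$ is the symbol map.
   Context: $k$ is the ground field, $\otimes=\otimes_k$; $[n]=\{1,\dots,n\}$ as an ordered set. $A$ is formally smooth if $\Omega^1_A=\ker(A\otimes A\xrightarrow{m}A)$ is a finitely generated projective module over $A\otimes A^{\mathrm{op}}$. $\Lambda_d(n)$: ordered partitions $\lambda=(\lambda_1,\dots,\lambda_d)$ of $n$ with $\lambda_i\ge0$, identified with the order-preserving maps $[n]\to[d]$ having $i$-th fibre of size $\lambda_i$; $|\lambda|=d$. $\lambda$ is degenerate if $n>0$ and some $\lambda_i=0$, or $n=0$ and $d>1$; $\Lambda_d^\circ(n)$ denotes the non-degenerate ones. For $\mu\in\Lambda_l(\lambda_i)$, $\mu\circ_i\lambda=(\lambda_1,\dots,\lambda_{i-1},\mu_1,\dots,\mu_l,\lambda_{i+1},\dots,\lambda_d)$. A non-degenerate refinement of $\lambda\in\Lambda_q(n)$ is a partition $\lambda'$ obtained by replacing each $\lambda_i$ by a non-degenerate partition of $\lambda_i$ (so zero parts are kept as they are). $D_\lambda(f)$, $\lambda\in\Lambda_q(n)$: the space of families $P=\{P_{\lambda'}\in\mathrm{Hom}_k(A^{\otimes d},B^{\otimes d})\}$ over non-degenerate refinements $\lambda'$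 of $\lambda$ ($d=|\lambda'|$) such that (i) for each $i$ with $\lambda'_i>0$, $$P_{\lambda'}(\dots,a_ia_i',\dots)=f(a_i)\cdot_iP_{\lambda'}(\dots,a_i',\dots)+P_{\lambda'}(\dots,a_i,\dots)\cdot_if(a'_i)+\sum_{\mu\in\Lambda^\circ_2(\lambda'_i)}m_B^{(i)}P_{\mu\circ_i\lambda'}(\dots,a_i,a_i',\dots),$$ where $\cdot_i$ is multiplication in the $i$-th tensor factor and $m_B^{(i)}$ multiplies factors $i,i+1$ (empty sums are $0$); (ii) for each $i$ with $\lambda'_i=0$, $P_{\lambda'}(a_1,\dots,a_d)$ is obtained from a multilinear expression in the other arguments, valued in $B^{\otimes(d-1)}$, by inserting $f(a_i)$ as the $i$-th factor. Zero parts thus carry no information: deleting them identifies $D_\lambda(f)$ with $D_{\lambda^+}(f)$, where $\lambda^+$ consists of the non-zero parts of $\lambda$. $(1^n)=(1,\dots,1)$ with $n$ parts; $D_{(1^n)}(f)$ consists of maps $A^{\otimes n}\to B^{\otimes n}$ which are derivations in each argument with respect to the corresponding tensor factor. The component $P_{(1^n)}$ is the component of $P$ at the finest non-degenerate refinement of $\lambda$ (after deleting zero parts). Degeneracy maps: for an order-preserving surjection $\sigma:[m]\to[n]$ and $\kappa\in\Lambda_q(n)$, $s(\sigma):D_\kappa(f)\to D_{\kappa\sigma}(f)$ is defined by $s(\sigma)(P)_{\lambda'}=P_{\kappa'}$ if $\lambda'=\kappa'\sigma$ for a refinement $\kappa'$ of $\kappa$, and $0$ otherwise. Order filtration: $F_{n-1}D_\lambda(f)=\sum\mathrm{Im}\big(s(\sigma):D_\kappa(f)\to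 D_\lambda(f)\big)$ over all order-preserving surjections $\sigma:[n]\to[n-1]$ and $\kappa\in\Lambda_q(n-1)$ with $\kappa\sigma=\lambda$. *)

theory Defs
  imports Complex_Main "HOL-Library.Function_Algebras"
begin

section \<open>Algebras over a field\<close>

text \<open>
  The sort \<open>{ring, monoid_mult}\<close> is that of associative unital rings; unlike \<open>ring_1\<close> it does
  not exclude the zero ring.
\<close>

locale k_algebra = vector_space scale
  for scale :: "'k::field \<Rightarrow> 'a::{ring,monoid_mult} \<Rightarrow> 'a" +
  assumes scale_mult_left: "scale c x * y = scale c (x * y)"
    and scale_mult_right: "x * scale c y = scale c (x * y)"

locale k_algebra_hom = A: k_algebra sA + B: k_algebra sB
  for sA :: "'k::field \<Rightarrow> 'a::{ring,monoid_mult} \<Rightarrow> 'a"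
    and sB :: "'k \<Rightarrow> 'b::{ring,monoid_mult} \<Rightarrow> 'b" +
  fixes f :: "'a \<Rightarrow> 'b"
  assumes hom_linear: "Vector_Spaces.linear sA sB f"
    and hom_mult: "f (x * y) = f x * f y"
    and hom_one: "f 1 = 1"

definition linear_on ::
  "('k \<Rightarrow> 'v::ab_group_add \<Rightarrow> 'v) \<Rightarrow> ('k \<Rightarrow> 'w::ab_group_add \<Rightarrow> 'w) \<Rightarrow> 'v set \<Rightarrow> 'w set \<Rightarrow>
    ('v \<Rightarrow> 'w) \<Rightarrow> bool"
  where "linear_on s t V W g \<longleftrightarrow>
    (\<forall>x\<in>V. g x \<in> W) \<and>
    (\<forall>x\<in>V. \<forall>y\<in>V. g (x + y) = g x + g y) \<and>
    (\<forall>c. \<forall>x\<in>V. g (s c x) = t c (g x))"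


section \<open>Tensor powers\<close>

text \<open>
  A \<open>d\<close>-linear map on \<open>V\<close> is a function on lists of which only the values on lists of length
  \<open>d\<close> matter.  The tensor power \<open>V\<^sup>\<otimes>\<^sup>d\<close> is realised inside the functionals on \<open>d\<close>-linear forms, a
  pure tensor \<open>x\<^sub>1 \<otimes> \<dots> \<otimes> x\<^sub>d\<close> being evaluation at \<open>[x\<^sub>1, \<dots>, x\<^sub>d]\<close>.  Over a field this has the
  universal property of the tensor power: see \<open>tensor_power_universal\<close> below.  The type does not
  depend on \<open>d\<close>, so that families indexed by partitions have a type.
\<close>

type_synonym ('k, 'v) tensor = "('v list \<Rightarrow> 'k) \<Rightarrow> 'k"

definition multilinear ::
  "('k::field \<Rightarrow> 'v::ab_group_add \<Rightarrow> 'v) \<Rightarrow> ('k \<Rightarrow> 'w::ab_group_add \<Rightarrow> 'w) \<Rightarrow> nat \<Rightarrow>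
    ('v list \<Rightarrow> 'w) \<Rightarrow> bool"
  where "multilinear s t d F \<longleftrightarrow>
    (\<forall>xs i. length xs = d \<and> i < d \<longrightarrow> Vector_Spaces.linear s t (\<lambda>x. F (xs[i := x])))"

definition tscale :: "'k::field \<Rightarrow> ('k, 'v) tensor \<Rightarrow> ('k, 'v) tensor"
  where "tscale c T = (\<lambda>\<phi>. c * T \<phi>)"

definition pure_tensor ::
  "('k::field \<Rightarrow> 'v::ab_group_add \<Rightarrow> 'v) \<Rightarrow> 'v list \<Rightarrow> ('k, 'v) tensor"
  where "pure_tensor s xs = (\<lambda>\<phi>. if multilinear s (*) (length xs) \<phi> then \<phi> xs else 0)"

definition tensor_power ::
  "('k::field \<Rightarrow> 'v::ab_group_add \<Rightarrow> 'v) \<Rightarrow> nat \<Rightarrow> ('k, 'v) tensor set"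
  where "tensor_power s d = module.span tscale {pure_tensor s xs | xs. length xs = d}"

lemma vector_space_tscale: "vector_space tscale"
  by unfold_locales (auto simp: tscale_def fun_eq_iff algebra_simps)

lemma vector_space_field_mult: "vector_space ((*) :: 'k::field \<Rightarrow> 'k \<Rightarrow> 'k)"
  by unfold_locales (auto simp: algebra_simps)

lemma sum_fun_apply: "(sum g S) x = (\<Sum>i\<in>S. g i x)"
  by (induction S rule: infinite_finite_induct) auto

lemma pure_tensor_in_tensor_power: "pure_tensor s xs \<in> tensor_power s (length xs)"
proof -
  interpret vector_space tscale by (rule vector_space_tscale)
  show ?thesis unfolding tensor_power_def by (rule span_base) auto
qed

lemma linear_compose_field:
  assumes "Vector_Spaces.linear s t F" "Vector_Spaces.linear t r G"
  shows "Vector_Spaces.linear s r (\<lambda>x. G (F x))"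
  using Vector_Spaces.linear_compose[OF assms] by (simp add: o_def)

lemma multilinear_pure_tensor:
  fixes s :: "'k::field \<Rightarrow> 'v::ab_group_add \<Rightarrow> 'v"
  assumes "vector_space s"
  shows "multilinear s tscale d (pure_tensor s)"
  unfolding multilinear_def
proof (intro allI impI)
  fix xs :: "'v list" and i assume xs: "length xs = d \<and> i < d"
  interpret A: vector_space s by fact
  interpret B: vector_space "tscale :: 'k \<Rightarrow> ('k, 'v) tensor \<Rightarrow> ('k, 'v) tensor"
    by (rule vector_space_tscale)
  have lin: "Vector_Spaces.linear s (*) (\<lambda>x. \<phi> (xs[i := x]))" if "multilinear s (*) d \<phi>" for \<phi>
    using that xs unfolding multilinear_def by blast
  have add: "\<phi> (xs[i := x + y]) = \<phi> (xs[i := x]) + \<phi> (xs[i := y])"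
    and sc: "\<phi> (xs[i := s c x]) = c * \<phi> (xs[i := x])"
    if "multilinear s (*) d \<phi>" for \<phi> x y c
  proof -
    interpret l: Vector_Spaces.linear s "(*)" "\<lambda>x. \<phi> (xs[i := x])" by (rule lin[OF that])
    show "\<phi> (xs[i := x + y]) = \<phi> (xs[i := x]) + \<phi> (xs[i := y])" by (rule l.add)
    show "\<phi> (xs[i := s c x]) = c * \<phi> (xs[i := x])" by (rule l.scale)
  qed
  show "Vector_Spaces.linear s tscale (\<lambda>x. pure_tensor s (xs[i := x]))"
    using xs by unfold_locales
      (auto simp: pure_tensor_def fun_eq_iff tscale_def add sc)
qed

lemma tensor_power_universal:
  fixes F :: "'v::ab_group_add list \<Rightarrow> 'w::ab_group_add"
  assumes s: "vector_space s" and t: "vector_space t" and F: "multilinear s t d F"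
  shows "\<exists>g. linear_on tscale t (tensor_power s d) UNIV g \<and>
           (\<forall>xs. length xs = d \<longrightarrow> g (pure_tensor s xs) = F xs) \<and>
           (\<forall>g'. linear_on tscale t (tensor_power s d) UNIV g' \<and>
                 (\<forall>xs. length xs = d \<longrightarrow> g' (pure_tensor s xs) = F xs) \<longrightarrow>
                 (\<forall>T\<in>tensor_power s d. g' T = g T))"
proof -
  interpret T: vector_space_pair tscale t
    by (intro vector_space_pair.intro vector_space_tscale t)
  interpret W: vector_space_pair t "(*)"
    by (intro vector_space_pair.intro vector_space_field_mult t)
  let ?S = "{pure_tensor s xs | xs. length xs = d}"
  obtain B where B: "B \<subseteq> ?S" "T.vs1.independent B" "?S \<subseteq> T.vs1.span B"
    using T.vs1.maximal_independent_subset[of ?S] by blast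
  have "\<forall>b\<in>B. \<exists>xs. length xs = d \<and> b = pure_tensor s xs" using B(1) by blast
  then obtain h where h: "length (h b) = d" "b = pure_tensor s (h b)" if "b \<in> B" for b
    by metis
  obtain g where g: "Vector_Spaces.linear tscale t g" "\<And>b. b \<in> B \<Longrightarrow> g b = F (h b)"
    using T.linear_independent_extend[OF B(2), of "\<lambda>b. F (h b)"] by blast
  interpret g: Vector_Spaces.linear tscale t g by (rule g(1))
  have gF: "g (pure_tensor s xs) = F xs" if xs: "length xs = d" for xs
  proof (rule ccontr)
    assume ne: "g (pure_tensor s xs) \<noteq> F xs"
    let ?v = "F xs - g (pure_tensor s xs)"
    have "T.vs2.independent {?v}" using ne by (simp add: T.vs2.dependent_single)
    then obtain l where l: "Vector_Spaces.linear t (*) l" "l ?v = 1"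
      using W.linear_independent_extend[of "{?v}" "\<lambda>_. 1"] by auto
    interpret l: Vector_Spaces.linear t "(*)" l by (rule l(1))
    have lF: "multilinear s (*) d (\<lambda>xs. l (F xs))"
      unfolding multilinear_def
    proof (intro allI impI)
      fix ys :: "'v list" and i assume "length ys = d \<and> i < d"
      with F have "Vector_Spaces.linear s t (\<lambda>x. F (ys[i := x]))"
        unfolding multilinear_def by simp
      then show "Vector_Spaces.linear s (*) (\<lambda>x. l (F (ys[i := x])))"
        by (rule linear_compose_field[OF _ l(1)])
    qed
    have "pure_tensor s xs \<in> T.vs1.span B" using xs B(3) by blast
    then obtain U r where U: "finite U" "U \<subseteq> B" "pure_tensor s xs = (\<Sum>a\<in>U. tscale (r a) a)"
      unfolding T.vs1.span_explicit by blast
    have "l (F xs) = pure_tensor s xs (\<lambda>xs. l (F xs))"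
      using lF xs by (simp add: pure_tensor_def)
    also have "\<dots> = (\<Sum>a\<in>U. r a * a (\<lambda>xs. l (F xs)))"
      unfolding U(3) by (simp add: sum_fun_apply tscale_def)
    also have "\<dots> = (\<Sum>a\<in>U. r a * l (g a))"
    proof (rule sum.cong)
      fix a assume "a \<in> U"
      then have a: "a \<in> B" using U by blast
      have "a (\<lambda>xs. l (F xs)) = pure_tensor s (h a) (\<lambda>xs. l (F xs))"
        using h(2)[OF a] by simp
      also have "\<dots> = l (F (h a))" using lF h(1)[OF a] by (simp add: pure_tensor_def)
      finally show "r a * a (\<lambda>xs. l (F xs)) = r a * l (g a)" using g(2)[OF a] by simp
    qed simp
    also have "\<dots> = l (g (pure_tensor s xs))"
      unfolding U(3) by (simp add: g.sum g.scale l.sum l.scale)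
    finally show False using l(2) by (simp add: l.diff)
  qed
  have "g' T = g T"
    if g': "linear_on tscale t (tensor_power s d) UNIV g'"
      "\<forall>xs. length xs = d \<longrightarrow> g' (pure_tensor s xs) = F xs" and T: "T \<in> tensor_power s d" for g' T
  proof -
    have "0 \<in> tensor_power s d"
      unfolding tensor_power_def by (rule T.vs1.span_zero)
    then have "g' (tscale 0 0) = t 0 (g' 0)"
      using g'(1) unfolding linear_on_def by blast
    then have z: "g' 0 = 0" by simp
    have "T \<in> T.vs1.span ?S" using T unfolding tensor_power_def .
    then have "T \<in> tensor_power s d \<and> g' T = g T"
    proof (induction rule: T.vs1.span_induct_alt)
      case base
      show ?case using \<open>0 \<in> tensor_power s d\<close> by (simp only: z g.zero simp_thms)
    next
      case (step c x y)
      then obtain xs where xs: "x = pure_tensor s xs" "length xs = d" by blast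
      have x: "x \<in> tensor_power s d" "g' x = g x"
        using xs g'(2) gF pure_tensor_in_tensor_power[of s xs] by auto
      then have cx: "tscale c x \<in> tensor_power s d"
        unfolding tensor_power_def by (intro T.vs1.span_scale)
      then have "tscale c x + y \<in> tensor_power s d"
        using step(2) unfolding tensor_power_def by (intro T.vs1.span_add) auto
      moreover have "g' (tscale c x + y) = t c (g' x) + g' y"
        using g'(1) x cx step(2) unfolding linear_on_def by metis
      moreover have "g (tscale c x + y) = t c (g x) + g y"
        by (simp only: g.add g.scale)
      ultimately show ?case using step(2) x by metis
    qed
    then show ?thesis by simp
  qed
  moreover have "linear_on tscale t (tensor_power s d) UNIV g"
    unfolding linear_on_def by (simp add: g.add g.scale)
  ultimately show ?thesis using gF by blast
qed

text \<open>
  The linear map \<open>V\<^sup>\<otimes>\<^sup>d \<rightarrow> V\<^sup>\<otimes>\<^sup>e\<close> which sends \<open>x\<^sub>1 \<otimes> \<dots> \<otimes> x\<^sub>d\<close> to the pure tensor on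
  \<open>g [x\<^sub>1, \<dots>, x\<^sub>d]\<close>, for \<open>g\<close> multilinear in the sense of \<open>tensor_map_pure\<close>.
\<close>

definition tensor_map ::
  "('k::field \<Rightarrow> 'v::ab_group_add \<Rightarrow> 'v) \<Rightarrow> nat \<Rightarrow> ('v list \<Rightarrow> 'v list) \<Rightarrow>
    ('k, 'v) tensor \<Rightarrow> ('k, 'v) tensor"
  where "tensor_map s e g T = (\<lambda>\<phi>. if multilinear s (*) e \<phi> then T (\<lambda>xs. \<phi> (g xs)) else 0)"

lemma tensor_map_pure:
  assumes "\<And>\<phi> :: 'v::ab_group_add list \<Rightarrow> 'k::field.
      multilinear s (*) e \<phi> \<Longrightarrow> multilinear s (*) (length xs) (\<lambda>xs. \<phi> (g xs))"
    and "length (g xs) = e"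
  shows "tensor_map s e g (pure_tensor s xs) = pure_tensor s (g xs)"
  using assms by (auto simp: tensor_map_def pure_tensor_def fun_eq_iff)

text \<open>Factors are numbered from \<open>0\<close>; in each case \<open>d\<close> is the exponent of the target.\<close>

definition lmult ::
  "('k::field \<Rightarrow> 'a::{ring,monoid_mult} \<Rightarrow> 'a) \<Rightarrow> nat \<Rightarrow> nat \<Rightarrow> 'a \<Rightarrow>
    ('k, 'a) tensor \<Rightarrow> ('k, 'a) tensor"
  where "lmult s d i b = tensor_map s d (\<lambda>xs. xs[i := b * xs ! i])"

definition rmult ::
  "('k::field \<Rightarrow> 'a::{ring,monoid_mult} \<Rightarrow> 'a) \<Rightarrow> nat \<Rightarrow> nat \<Rightarrow> 'a \<Rightarrow>
    ('k, 'a) tensor \<Rightarrow> ('k, 'a) tensor"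
  where "rmult s d i b = tensor_map s d (\<lambda>xs. xs[i := xs ! i * b])"

definition merge ::
  "('k::field \<Rightarrow> 'a::{ring,monoid_mult} \<Rightarrow> 'a) \<Rightarrow> nat \<Rightarrow> nat \<Rightarrow>
    ('k, 'a) tensor \<Rightarrow> ('k, 'a) tensor"
  where "merge s d i =
    tensor_map s d (\<lambda>xs. take i xs @ [xs ! i * xs ! Suc i] @ drop (Suc (Suc i)) xs)"

definition insert_factor ::
  "('k::field \<Rightarrow> 'a::{ring,monoid_mult} \<Rightarrow> 'a) \<Rightarrow> nat \<Rightarrow> nat \<Rightarrow> 'a \<Rightarrow>
    ('k, 'a) tensor \<Rightarrow> ('k, 'a) tensor"
  where "insert_factor s d i b = tensor_map s d (\<lambda>xs. take i xs @ [b] @ drop i xs)"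

lemma list_update_via_nth:
  assumes "length (g xs') = d" "length (g xs) = d"
    and "\<And>l. l < d \<Longrightarrow> g xs' ! l = (if l = m then y else g xs ! l)"
  shows "g xs' = (g xs)[m := y]"
  by (rule nth_equalityI) (use assms in \<open>auto simp: nth_list_update\<close>)

context k_algebra
begin

lemma linear_mult_left: "Vector_Spaces.linear scale scale (\<lambda>x. b * x)"
  by unfold_locales (auto simp: algebra_simps scale_mult_right)

lemma linear_mult_right: "Vector_Spaces.linear scale scale (\<lambda>x. x * b)"
  by unfold_locales (auto simp: algebra_simps scale_mult_left)

lemma multilinear_comp:
  assumes \<phi>: "multilinear scale (*) e \<phi>"
    and g: "\<And>xs i. length xs = d \<Longrightarrow> i < d \<Longrightarrow>
      \<exists>ys j h. length ys = e \<and> j < e \<and> Vector_Spaces.linear scale scale h \<and>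
        (\<forall>x. g (xs[i := x]) = ys[j := h x])"
  shows "multilinear scale (*) d (\<lambda>xs. \<phi> (g xs))"
  unfolding multilinear_def
proof (intro allI impI)
  fix xs :: "'a list" and i assume "length xs = d \<and> i < d"
  with g obtain ys j h where *: "length ys = e" "j < e" "Vector_Spaces.linear scale scale h"
    "\<And>x. g (xs[i := x]) = ys[j := h x]" by blast
  have "Vector_Spaces.linear scale (*) (\<lambda>y. \<phi> (ys[j := y]))"
    using \<phi> * unfolding multilinear_def by blast
  from linear_compose_field[OF *(3) this] show "Vector_Spaces.linear scale (*) (\<lambda>x. \<phi> (g (xs[i := x])))"
    by (simp add: *(4))
qed

lemma lmult_pure:
  assumes "length xs = d" "i < d"
  shows "lmult scale d i b (pure_tensor scale xs) = pure_tensor scale (xs[i := b * xs ! i])"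
  unfolding lmult_def
proof (rule tensor_map_pure[OF multilinear_comp])
  fix ys :: "'a list" and j assume ys: "length ys = length xs" "j < length xs"
  show "\<exists>zs m h. length zs = d \<and> m < d \<and> Vector_Spaces.linear scale scale h \<and>
      (\<forall>x. (ys[j := x])[i := b * ys[j := x] ! i] = zs[m := h x])"
  proof (cases "j = i")
    case True
    then show ?thesis using assms ys
      by (intro exI[of _ ys] exI[of _ i] exI[of _ "\<lambda>x. b * x"]) (auto simp: linear_mult_left)
  next
    case False
    then show ?thesis using assms ys
      by (intro exI[of _ "ys[i := b * ys ! i]"] exI[of _ j] exI[of _ "\<lambda>x. x"])
        (auto simp: linear_ident list_update_swap)
  qed
qed (use assms in auto)

lemma rmult_pure:
  assumes "length xs = d" "i < d"
  shows "rmult scale d i b (pure_tensor scale xs) = pure_tensor scale (xs[i := xs ! i * b])"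
  unfolding rmult_def
proof (rule tensor_map_pure[OF multilinear_comp])
  fix ys :: "'a list" and j assume ys: "length ys = length xs" "j < length xs"
  show "\<exists>zs m h. length zs = d \<and> m < d \<and> Vector_Spaces.linear scale scale h \<and>
      (\<forall>x. (ys[j := x])[i := ys[j := x] ! i * b] = zs[m := h x])"
  proof (cases "j = i")
    case True
    then show ?thesis using assms ys
      by (intro exI[of _ ys] exI[of _ i] exI[of _ "\<lambda>x. x * b"]) (auto simp: linear_mult_right)
  next
    case False
    then show ?thesis using assms ys
      by (intro exI[of _ "ys[i := ys ! i * b]"] exI[of _ j] exI[of _ "\<lambda>x. x"])
        (auto simp: linear_ident list_update_swap)
  qed
qed (use assms in auto)

lemma merge_pure:
  assumes "length xs = Suc d" "i < d"
  shows "merge scale d i (pure_tensor scale xs) =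
    pure_tensor scale (take i xs @ [xs ! i * xs ! Suc i] @ drop (Suc (Suc i)) xs)"
proof -
  define g where
    "g xs = take i xs @ [xs ! i * xs ! Suc i] @ drop (Suc (Suc i)) xs" for xs :: "'a list"
  have len: "length (g zs) = d" if "length zs = Suc d" for zs
    using that assms by (simp add: g_def)
  have nth: "g zs ! m =
      (if m < i then zs ! m else if m = i then zs ! i * zs ! Suc i else zs ! Suc m)"
    if "length zs = Suc d" "m < d" for zs m
    using that assms by (auto simp: g_def nth_append nth_Cons')
  have "merge scale d i (pure_tensor scale xs) = pure_tensor scale (g xs)"
    unfolding merge_def g_def[symmetric]
  proof (rule tensor_map_pure[OF multilinear_comp])
    fix ys :: "'a list" and j assume ys: "length ys = length xs" "j < length xs"
    then have ys': "length ys = Suc d" "j < Suc d" using assms by auto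
    have upd: "g (ys[j := x]) = (g ys)[m := h x]"
      if "\<And>l. l < d \<Longrightarrow> g (ys[j := x]) ! l = (if l = m then h x else g ys ! l)" for m h x
      by (rule list_update_via_nth[of _ _ d]) (use that len ys' in auto)
    consider "j < i" | "j = i" | "j = Suc i" | "Suc i < j" by linarith
    then have "\<exists>m h. m < d \<and> Vector_Spaces.linear scale scale h \<and>
        (\<forall>x. g (ys[j := x]) = (g ys)[m := h x])"
    proof cases
      case 1
      then have "g (ys[j := x]) = (g ys)[j := x]" for x
        by (intro upd) (use assms ys' in \<open>auto simp: nth nth_list_update\<close>)
      then show ?thesis using 1 assms by (intro exI[of _ j] exI[of _ "\<lambda>x. x"]) (auto simp: linear_ident)
    next
      case 2
      then have "g (ys[j := x]) = (g ys)[i := x * ys ! Suc i]" for x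
        by (intro upd) (use assms ys' in \<open>auto simp: nth nth_list_update\<close>)
      then show ?thesis using assms
        by (intro exI[of _ i] exI[of _ "\<lambda>x. x * ys ! Suc i"]) (auto simp: linear_mult_right)
    next
      case 3
      then have "g (ys[j := x]) = (g ys)[i := ys ! i * x]" for x
        by (intro upd) (use assms ys' in \<open>auto simp: nth nth_list_update\<close>)
      then show ?thesis using assms
        by (intro exI[of _ i] exI[of _ "\<lambda>x. ys ! i * x"]) (auto simp: linear_mult_left)
    next
      case 4
      then have "g (ys[j := x]) = (g ys)[j - 1 := x]" for x
        by (intro upd) (use assms ys' in \<open>auto simp: nth nth_list_update\<close>)
      then show ?thesis using 4 assms ys'
        by (intro exI[of _ "j - 1"] exI[of _ "\<lambda>x. x"]) (auto simp: linear_ident)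
    qed
    then show "\<exists>zs m h. length zs = d \<and> m < d \<and> Vector_Spaces.linear scale scale h \<and>
        (\<forall>x. g (ys[j := x]) = zs[m := h x])"
      using len[OF ys'(1)] by blast
  qed (use assms len in auto)
  then show ?thesis by (simp add: g_def)
qed

lemma insert_factor_pure:
  assumes "Suc (length xs) = d" "i < d"
  shows "insert_factor scale d i b (pure_tensor scale xs) =
    pure_tensor scale (take i xs @ [b] @ drop i xs)"
proof -
  define g where "g xs = take i xs @ [b] @ drop i xs" for xs :: "'a list"
  have len: "length (g zs) = d" if "length zs = length xs" for zs
    using that assms by (simp add: g_def)
  have nth: "g zs ! m = (if m < i then zs ! m else if m = i then b else zs ! (m - 1))"
    if "length zs = length xs" "m < d" for zs m
    using that assms by (auto simp: g_def nth_append nth_Cons')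
  have "insert_factor scale d i b (pure_tensor scale xs) = pure_tensor scale (g xs)"
    unfolding insert_factor_def g_def[symmetric]
  proof (rule tensor_map_pure[OF multilinear_comp])
    fix ys :: "'a list" and j assume ys: "length ys = length xs" "j < length xs"
    have "g (ys[j := x]) = (g ys)[(if j < i then j else Suc j) := x]" for x
      by (rule list_update_via_nth[of _ _ d])
        (use assms ys len in \<open>auto simp: nth nth_list_update\<close>)
    then show "\<exists>zs m h. length zs = d \<and> m < d \<and> Vector_Spaces.linear scale scale h \<and>
        (\<forall>x. g (ys[j := x]) = zs[m := h x])"
      using len[OF ys(1)] ys assms linear_ident
      by (intro exI[of _ "g ys"] exI[of _ "if j < i then j else Suc j"] exI[of _ "\<lambda>x. x"]) auto
  qed (use assms len in auto)
  then show ?thesis by (simp add: g_def)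
qed

end


section \<open>Formal smoothness\<close>

text \<open>The multiplication \<open>(a \<otimes> b) (x \<otimes> y) = a x \<otimes> y b\<close> of \<open>A \<otimes> A\<^sup>o\<^sup>p\<close>.\<close>

definition env_mult ::
  "('k::field \<Rightarrow> 'a::{ring,monoid_mult} \<Rightarrow> 'a) \<Rightarrow>
    ('k, 'a) tensor \<Rightarrow> ('k, 'a) tensor \<Rightarrow> ('k, 'a) tensor"
  where "env_mult s S T = (\<lambda>\<phi>. if multilinear s (*) 2 \<phi>
    then S (\<lambda>as. T (\<lambda>xs. \<phi> [as ! 0 * xs ! 0, xs ! 1 * as ! 1])) else 0)"

context k_algebra
begin

lemma env_mult_pure:
  "env_mult scale (pure_tensor scale [a, b]) (pure_tensor scale [x, y]) =
    pure_tensor scale [a * x, y * b]"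
proof -
  have two: "\<exists>u v. us = [u, v]" if "length us = 2" for us :: "'a list"
    using that by (metis One_nat_def Suc_1 length_0_conv length_Suc_conv)
  have 1: "multilinear scale (*) 2 (\<lambda>xs. \<phi> [a * xs ! 0, xs ! 1 * b])"
    if "multilinear scale (*) 2 \<phi>" for \<phi> :: "'a list \<Rightarrow> 'k" and a b
  proof (rule multilinear_comp[OF that])
    fix xs :: "'a list" and i assume *: "length xs = 2" "i < (2::nat)"
    then consider "i = 0" | "i = 1" by linarith
    then show "\<exists>ys j h. length ys = 2 \<and> j < 2 \<and> Vector_Spaces.linear scale scale h \<and>
        (\<forall>x. [a * xs[i := x] ! 0, xs[i := x] ! 1 * b] = ys[j := h x])"
    proof cases
      case 1
      then show ?thesis using two[OF *(1)]
        by (intro exI[of _ "[a * xs ! 0, xs ! 1 * b]"] exI[of _ 0] exI[of _ "\<lambda>x. a * x"])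
          (auto simp: linear_mult_left)
    next
      case 2
      then show ?thesis using two[OF *(1)]
        by (intro exI[of _ "[a * xs ! 0, xs ! 1 * b]"] exI[of _ 1] exI[of _ "\<lambda>x. x * b"])
          (auto simp: linear_mult_right)
    qed
  qed
  have 2: "multilinear scale (*) 2 (\<lambda>as. \<phi> [as ! 0 * x, y * as ! 1])"
    if "multilinear scale (*) 2 \<phi>" for \<phi> :: "'a list \<Rightarrow> 'k"
  proof (rule multilinear_comp[OF that])
    fix xs :: "'a list" and i assume *: "length xs = 2" "i < (2::nat)"
    then consider "i = 0" | "i = 1" by linarith
    then show "\<exists>ys j h. length ys = 2 \<and> j < 2 \<and> Vector_Spaces.linear scale scale h \<and>
        (\<forall>u. [xs[i := u] ! 0 * x, y * xs[i := u] ! 1] = ys[j := h u])"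
    proof cases
      case 1
      then show ?thesis using two[OF *(1)]
        by (intro exI[of _ "[xs ! 0 * x, y * xs ! 1]"] exI[of _ 0] exI[of _ "\<lambda>u. u * x"])
          (auto simp: linear_mult_right)
    next
      case 2
      then show ?thesis using two[OF *(1)]
        by (intro exI[of _ "[xs ! 0 * x, y * xs ! 1]"] exI[of _ 1] exI[of _ "\<lambda>u. y * u"])
          (auto simp: linear_mult_left)
    qed
  qed
  show ?thesis
    using 1 2 by (auto simp: env_mult_def pure_tensor_def fun_eq_iff numeral_2_eq_2)
qed

end

text \<open>The target of the multiplication is \<open>A\<^sup>\<otimes>\<^sup>1\<close>, i.e. \<open>A\<close>.\<close>

definition Omega1 ::
  "('k::field \<Rightarrow> 'a::{ring,monoid_mult} \<Rightarrow> 'a) \<Rightarrow> ('k, 'a) tensor set"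
  where "Omega1 s = {T \<in> tensor_power s 2. merge s 1 0 T = 0}"

text \<open>
  For a ring with carrier \<open>R\<close> and multiplication \<open>mul\<close>, acting on a module with carrier \<open>M\<close> by
  \<open>act\<close>.  The free module on the generators \<open>X\<close> consists of the finitely supported functions
  \<open>X \<rightarrow> R\<close>; since every module \<open>M\<close> is a quotient of the free module on its own elements, it is
  enough to split off \<open>M\<close> from free modules on generators of the type of \<open>M\<close>.
\<close>

definition module_map_on ::
  "'r set \<Rightarrow> ('r \<Rightarrow> 'm::ab_group_add \<Rightarrow> 'm) \<Rightarrow> ('r \<Rightarrow> 'n::ab_group_add \<Rightarrow> 'n) \<Rightarrow>
    'm set \<Rightarrow> 'n set \<Rightarrow> ('m \<Rightarrow> 'n) \<Rightarrow> bool"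
  where "module_map_on R act act' M N g \<longleftrightarrow>
    (\<forall>x\<in>M. g x \<in> N) \<and>
    (\<forall>x\<in>M. \<forall>y\<in>M. g (x + y) = g x + g y) \<and>
    (\<forall>r\<in>R. \<forall>x\<in>M. g (act r x) = act' r (g x))"

definition finitely_generated ::
  "'r set \<Rightarrow> ('r \<Rightarrow> 'm::ab_group_add \<Rightarrow> 'm) \<Rightarrow> 'm set \<Rightarrow> bool"
  where "finitely_generated R act M \<longleftrightarrow>
    (\<exists>G. finite G \<and> G \<subseteq> M \<and> (\<forall>x\<in>M. \<exists>r. (\<forall>g\<in>G. r g \<in> R) \<and> x = (\<Sum>g\<in>G. act (r g) g)))"

definition free_module :: "'r::ab_group_add set \<Rightarrow> 'x set \<Rightarrow> ('x \<Rightarrow> 'r) set"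
  where "free_module R X = {v. finite {x. v x \<noteq> 0} \<and> {x. v x \<noteq> 0} \<subseteq> X \<and> (\<forall>x. v x \<in> R)}"

definition projective ::
  "'r::ab_group_add set \<Rightarrow> ('r \<Rightarrow> 'r \<Rightarrow> 'r) \<Rightarrow> ('r \<Rightarrow> 'm::ab_group_add \<Rightarrow> 'm) \<Rightarrow> 'm set \<Rightarrow> bool"
  where "projective R mul act M \<longleftrightarrow>
    (\<exists>(X :: 'm set) i p.
      module_map_on R act (\<lambda>r v x. mul r (v x)) M (free_module R X) i \<and>
      module_map_on R (\<lambda>r v x. mul r (v x)) act (free_module R X) M p \<and>
      (\<forall>m\<in>M. p (i m) = m))"

definition formally_smooth :: "('k::field \<Rightarrow> 'a::{ring,monoid_mult} \<Rightarrow> 'a) \<Rightarrow> bool"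
  where "formally_smooth s \<longleftrightarrow>
    finitely_generated (tensor_power s 2) (env_mult s) (Omega1 s) \<and>
    projective (tensor_power s 2) (env_mult s) (env_mult s) (Omega1 s)"


section \<open>Ordered partitions\<close>

definition ordered_partitions :: "nat \<Rightarrow> nat \<Rightarrow> nat list set"
  where "ordered_partitions d n = {p. length p = d \<and> sum_list p = n}"

definition degenerate :: "nat list \<Rightarrow> bool"
  where "degenerate p \<longleftrightarrow> (sum_list p > 0 \<and> 0 \<in> set p) \<or> (sum_list p = 0 \<and> length p > 1)"

definition nondeg_partitions :: "nat \<Rightarrow> nat \<Rightarrow> nat list set"
  where "nondeg_partitions d n = {p \<in> ordered_partitions d n. \<not> degenerate p}"

definition refine_at :: "nat list \<Rightarrow> nat \<Rightarrow> nat list \<Rightarrow> nat list"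
  where "refine_at \<mu> i p = take i p @ \<mu> @ drop (Suc i) p"

text \<open>
  The requirement \<open>\<mu> \<noteq> []\<close> only concerns parts equal to \<open>0\<close>: these are replaced by \<open>[0]\<close>, not
  deleted.
\<close>

definition refinements :: "nat list \<Rightarrow> nat list set"
  where "refinements p = {concat \<mu>s | \<mu>s.
    list_all2 (\<lambda>\<mu> n. \<mu> \<noteq> [] \<and> \<mu> \<in> nondeg_partitions (length \<mu>) n) \<mu>s p}"

text \<open>The order-preserving map \<open>{1..n} \<rightarrow> {1..d}\<close> whose \<open>i\<close>-th fibre has size \<open>p ! (i - 1)\<close>.\<close>

definition map_of_partition :: "nat list \<Rightarrow> nat \<Rightarrow> nat"
  where "map_of_partition p x = (LEAST i. x \<le> sum_list (take i p))"

text \<open>The partition corresponding to a map \<open>{1..m} \<rightarrow> {1..d}\<close>.\<close>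

definition partition_of_map :: "nat \<Rightarrow> nat \<Rightarrow> (nat \<Rightarrow> nat) \<Rightarrow> nat list"
  where "partition_of_map m d h = map (\<lambda>i. card {x \<in> {1..m}. h x = i}) [1..<Suc d]"

lemma partition_of_map_of_partition:
  "partition_of_map (sum_list p) (length p) (map_of_partition p) = p"
proof (rule nth_equalityI)
  show "length (partition_of_map (sum_list p) (length p) (map_of_partition p)) = length p"
    by (simp add: partition_of_map_def del: upt_Suc)
  fix i assume "i < length (partition_of_map (sum_list p) (length p) (map_of_partition p))"
  then have i: "i < length p" by (simp add: partition_of_map_def del: upt_Suc)
  let ?S = "\<lambda>i. sum_list (take i p)"
  have mono: "?S a \<le> ?S b" if "a \<le> b" for a b
  proof -
    have "take b p = take a p @ take (b - a) (drop a p)"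
      using that by (metis le_add_diff_inverse take_add)
    then show ?thesis by simp
  qed
  have le: "?S a \<le> sum_list p" for a
    by (metis append_take_drop_id le_add1 sum_list_append)
  have eq: "map_of_partition p x = Suc i \<longleftrightarrow> ?S i < x \<and> x \<le> ?S (Suc i)"
    if "x \<le> sum_list p" for x
  proof
    assume *: "map_of_partition p x = Suc i"
    have "x \<le> ?S (length p)" using that by simp
    then have "x \<le> ?S (map_of_partition p x)"
      unfolding map_of_partition_def by (rule LeastI)
    moreover have "\<not> x \<le> ?S i"
      using * not_less_Least[of i "\<lambda>i. x \<le> ?S i"] unfolding map_of_partition_def by simp
    ultimately show "?S i < x \<and> x \<le> ?S (Suc i)" using * by simp
  next
    assume *: "?S i < x \<and> x \<le> ?S (Suc i)"
    show "map_of_partition p x = Suc i" unfolding map_of_partition_def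
    proof (rule Least_equality)
      fix j assume "x \<le> ?S j"
      then show "Suc i \<le> j" using * mono[of j i] by (meson leD le_less_trans not_less_eq_eq order.strict_trans2)
    qed (use * in simp)
  qed
  have "{x \<in> {1..sum_list p}. map_of_partition p x = Suc i} = {?S i<..?S (Suc i)}"
  proof (rule set_eqI)
    fix x
    show "x \<in> {x \<in> {1..sum_list p}. map_of_partition p x = Suc i} \<longleftrightarrow>
        x \<in> {?S i<..?S (Suc i)}"
      using eq[of x] le[of "Suc i"] by fastforce
  qed
  then show "partition_of_map (sum_list p) (length p) (map_of_partition p) ! i = p ! i"
    using i by (simp add: partition_of_map_def take_Suc_conv_app_nth del: upt_Suc)
qed

definition ordered_surjection :: "nat \<Rightarrow> nat \<Rightarrow> (nat \<Rightarrow> nat) \<Rightarrow> bool"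
  where "ordered_surjection m n \<sigma> \<longleftrightarrow> mono_on {1..m} \<sigma> \<and> \<sigma> ` {1..m} = {1..n}"

text \<open>The composition \<open>\<kappa>\<sigma>\<close> for \<open>\<sigma> : {1..m} \<rightarrow> {1..n}\<close> and a partition \<open>\<kappa>\<close> of \<open>n\<close>.\<close>

definition pullback :: "nat \<Rightarrow> nat list \<Rightarrow> (nat \<Rightarrow> nat) \<Rightarrow> nat list"
  where "pullback m \<kappa> \<sigma> = partition_of_map m (length \<kappa>) (\<lambda>x. map_of_partition \<kappa> (\<sigma> x))"


section \<open>The spaces \<open>D\<^sub>\<lambda>(f)\<close>\<close>

text \<open>Linear maps \<open>A\<^sup>\<otimes>\<^sup>d \<rightarrow> B\<^sup>\<otimes>\<^sup>e\<close>, extended by \<open>0\<close> to the whole type.\<close>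

definition tensor_hom ::
  "('k::field \<Rightarrow> 'a::{ring,monoid_mult} \<Rightarrow> 'a) \<Rightarrow> ('k \<Rightarrow> 'b::{ring,monoid_mult} \<Rightarrow> 'b) \<Rightarrow>
    nat \<Rightarrow> nat \<Rightarrow> (('k, 'a) tensor \<Rightarrow> ('k, 'b) tensor) set"
  where "tensor_hom sA sB d e = {P.
    linear_on tscale tscale (tensor_power sA d) (tensor_power sB e) P \<and>
    (\<forall>T. T \<notin> tensor_power sA d \<longrightarrow> P T = 0)}"

type_synonym ('k, 'a, 'b) family = "nat list \<Rightarrow> ('k, 'a) tensor \<Rightarrow> ('k, 'b) tensor"

definition fscale :: "'k::field \<Rightarrow> ('k, 'a, 'b) family \<Rightarrow> ('k, 'a, 'b) family"
  where "fscale c P = (\<lambda>p T. tscale c (P p T))"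

lemma vector_space_fscale: "vector_space fscale"
  by unfold_locales (auto simp: fscale_def tscale_def fun_eq_iff algebra_simps)

text \<open>The members of \<open>D\<^sub>p(f)\<close> are extended by \<open>0\<close> to lists which are not refinements of \<open>p\<close>.\<close>

definition D_space ::
  "('k::field \<Rightarrow> 'a::{ring,monoid_mult} \<Rightarrow> 'a) \<Rightarrow> ('k \<Rightarrow> 'b::{ring,monoid_mult} \<Rightarrow> 'b) \<Rightarrow>
    ('a \<Rightarrow> 'b) \<Rightarrow> nat list \<Rightarrow> ('k, 'a, 'b) family set"
  where "D_space sA sB f p = {P.
    (\<forall>p'. p' \<notin> refinements p \<longrightarrow> P p' = 0) \<and>
    (\<forall>p'\<in>refinements p. P p' \<in> tensor_hom sA sB (length p') (length p')) \<and>
    (\<forall>p'\<in>refinements p. \<forall>i<length p'. p' ! i > 0 \<longrightarrow>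
      (\<forall>as x y. length as = length p' \<longrightarrow>
        P p' (pure_tensor sA (as[i := x * y])) =
          lmult sB (length p') i (f x) (P p' (pure_tensor sA (as[i := y]))) +
          rmult sB (length p') i (f y) (P p' (pure_tensor sA (as[i := x]))) +
          (\<Sum>\<mu>\<in>nondeg_partitions 2 (p' ! i).
            merge sB (length p') i
              (P (refine_at \<mu> i p') (pure_tensor sA (take i as @ [x, y] @ drop (Suc i) as)))))) \<and>
    (\<forall>p'\<in>refinements p. \<forall>i<length p'. p' ! i = 0 \<longrightarrow>
      (\<exists>Q\<in>tensor_hom sA sB (length p' - 1) (length p' - 1).
        \<forall>as. length as = length p' \<longrightarrow>
          P p' (pure_tensor sA as) =
            insert_factor sB (length p') i (f (as ! i))
              (Q (pure_tensor sA (take i as @ drop (Suc i) as)))))}"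


section \<open>Degeneracy maps and order filtration\<close>

text \<open>The map \<open>s(\<sigma>)\<close> on \<open>D\<^sub>\<kappa>(f)\<close>, for a surjection \<open>\<sigma>\<close> defined on \<open>{1..m}\<close>.\<close>

definition degeneracy ::
  "nat \<Rightarrow> nat list \<Rightarrow> (nat \<Rightarrow> nat) \<Rightarrow> ('k::field, 'a, 'b) family \<Rightarrow> ('k, 'a, 'b) family"
  where "degeneracy m \<kappa> \<sigma> P = (\<lambda>p'.
    if \<exists>\<kappa>'\<in>refinements \<kappa>. p' = pullback m \<kappa>' \<sigma>
    then P (THE \<kappa>'. \<kappa>' \<in> refinements \<kappa> \<and> p' = pullback m \<kappa>' \<sigma>) else 0)"

text \<open>\<open>F\<^sub>n\<^sub>-\<^sub>1 D\<^sub>p(f)\<close> for a partition \<open>p\<close> of \<open>n\<close>.\<close>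

definition order_filtration ::
  "('k::field \<Rightarrow> 'a::{ring,monoid_mult} \<Rightarrow> 'a) \<Rightarrow> ('k \<Rightarrow> 'b::{ring,monoid_mult} \<Rightarrow> 'b) \<Rightarrow>
    ('a \<Rightarrow> 'b) \<Rightarrow> nat \<Rightarrow> nat list \<Rightarrow> ('k, 'a, 'b) family set"
  where "order_filtration sA sB f n p = module.span fscale
    (\<Union>{degeneracy n \<kappa> \<sigma> ` D_space sA sB f \<kappa> | \<kappa> \<sigma>.
      ordered_surjection n (n - 1) \<sigma> \<and> \<kappa> \<in> ordered_partitions (length p) (n - 1) \<and> pullback n \<kappa> \<sigma> = p})"


section \<open>The symbol map\<close>

definition finest_refinement :: "nat list \<Rightarrow> nat list"
  where "finest_refinement p = concat (map (\<lambda>n. if n = 0 then [0] else replicate n 1) p)"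

text \<open>
  \<open>nonzero_args p as\<close> are the entries of \<open>as\<close> at the non-zero parts of \<open>p\<close>, and
  \<open>fill_zero_parts p cs bs\<close> has the entries of \<open>cs\<close> at the zero parts of \<open>p\<close> and successively
  those of \<open>bs\<close> at the other parts.
\<close>

definition nonzero_args :: "nat list \<Rightarrow> 'a list \<Rightarrow> 'a list"
  where "nonzero_args p as = map snd (filter (\<lambda>(n, a). n \<noteq> 0) (zip p as))"

fun fill_zero_parts :: "nat list \<Rightarrow> 'b list \<Rightarrow> 'b list \<Rightarrow> 'b list" where
  "fill_zero_parts (n # p) (c # cs) bs =
    (if n = 0 then c # fill_zero_parts p cs bs else hd bs # fill_zero_parts p cs (tl bs))"
| "fill_zero_parts _ _ _ = []"

text \<open>
  The map \<open>Q\<close> obtained by deleting the zero parts from the component \<open>T\<close> at \<open>p\<close> of an element of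
  some \<open>D_space\<close>: \<open>T(a\<^sub>1, \<dots>, a\<^sub>d)\<close> arises by inserting the factors \<open>f(a\<^sub>i)\<close> at the zero parts into
  \<open>Q\<close> of the remaining arguments.  As \<open>f 1 = 1\<close>, this determines \<open>Q\<close>; existence is the last
  condition in the definition of \<open>D_space\<close>, applied to the zero parts one after another.
\<close>

definition delete_zero_parts ::
  "('k::field \<Rightarrow> 'a::{ring,monoid_mult} \<Rightarrow> 'a) \<Rightarrow> ('k \<Rightarrow> 'b::{ring,monoid_mult} \<Rightarrow> 'b) \<Rightarrow>
    ('a \<Rightarrow> 'b) \<Rightarrow> nat list \<Rightarrow> (('k, 'a) tensor \<Rightarrow> ('k, 'b) tensor) \<Rightarrow>
    ('k, 'a) tensor \<Rightarrow> ('k, 'b) tensor"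
  where "delete_zero_parts sA sB f p T = (THE Q.
    Q \<in> tensor_hom sA sB (length (filter (\<lambda>n. n \<noteq> 0) p)) (length (filter (\<lambda>n. n \<noteq> 0) p)) \<and>
    (\<forall>as. length as = length p \<longrightarrow>
      T (pure_tensor sA as) =
        tensor_map sB (length p) (fill_zero_parts p (map f as))
          (Q (pure_tensor sA (nonzero_args p as)))))"

text \<open>The only refinement of \<open>(1\<^sup>n)\<close> is \<open>(1\<^sup>n)\<close>, so elements of \<open>D\<^bsub>(1\<^sup>n)\<^esub>(f)\<close> have one component.\<close>

definition symbol_map ::
  "('k::field \<Rightarrow> 'a::{ring,monoid_mult} \<Rightarrow> 'a) \<Rightarrow> ('k \<Rightarrow> 'b::{ring,monoid_mult} \<Rightarrow> 'b) \<Rightarrow>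
    ('a \<Rightarrow> 'b) \<Rightarrow> nat list \<Rightarrow> ('k, 'a, 'b) family \<Rightarrow> ('k, 'a, 'b) family"
  where "symbol_map sA sB f p P = (\<lambda>p'.
    if p' = replicate (sum_list p) 1
    then delete_zero_parts sA sB f (finest_refinement p) (P (finest_refinement p)) else 0)"


section \<open>Short exact sequences\<close>

text \<open>\<open>0 \<rightarrow> U \<rightarrow> V \<rightarrow> W \<rightarrow> 0\<close> with maps \<open>i\<close> and \<open>q\<close>, for subspaces of ambient vector spaces.\<close>

definition short_exact_sequence ::
  "('k::field \<Rightarrow> 'u::ab_group_add \<Rightarrow> 'u) \<Rightarrow> ('k \<Rightarrow> 'v::ab_group_add \<Rightarrow> 'v) \<Rightarrow>
    ('k \<Rightarrow> 'w::ab_group_add \<Rightarrow> 'w) \<Rightarrow>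
    'u set \<Rightarrow> ('u \<Rightarrow> 'v) \<Rightarrow> 'v set \<Rightarrow> ('v \<Rightarrow> 'w) \<Rightarrow> 'w set \<Rightarrow> bool"
  where "short_exact_sequence sU sV sW U i V q W \<longleftrightarrow>
    module.subspace sU U \<and> module.subspace sV V \<and> module.subspace sW W \<and>
    linear_on sU sV U V i \<and> linear_on sV sW V W q \<and>
    inj_on i U \<and> i ` U = {v \<in> V. q v = 0} \<and> q ` V = W"

end

theory Submission
  imports Defs
begin

text \<open>
  The idea of the proof.

  \<^emph>\<open>Lifting.\<close>  As \<open>\<Omega>\<^sup>1\<close> is projective, the bimodule map \<open>\<Omega>\<^sup>1 \<otimes> A \<rightarrow> \<Omega>\<^sup>1\<close> has a section.  The image of
  \<open>d a\<close> under it is a tensor \<open>\<Theta> a = \<Sum> w \<otimes> t \<otimes> v\<close> such that \<open>\<Theta>\<close> is a derivation and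
  \<open>\<Sum> w D(t) v = D(a)\<close> for all derivations \<open>D\<close> (\<open>formally_smooth_splitting_derivation\<close>,
  \<open>contract_splitting_derivation\<close>).  A map \<open>G\<close> which is a derivation in each argument is the finest
  component of a family: if an argument \<open>a\<close> has a part \<open>n \<ge> 2\<close>, put
  \<open>P\<^sub>n(a) = \<Sum> f w \<cdot> m\<^sub>B P\<^bsub>1,n-1\<^esub>(t, v)\<close>, with the other arguments and parts as they are.  Then
  \<open>P\<^sub>n(x y)\<close> has the terms \<open>f x \<cdot> P\<^sub>n(y)\<close> and \<open>\<Sum> f w \<cdot> m\<^sub>B P\<^bsub>1,n-1\<^esub>(t, v y)\<close>, where \<open>\<Theta> x = \<Sum> w \<otimes> t \<otimes> v\<close>.
  The Leibniz rule in the argument \<open>v y\<close> splits the latter into three.  One is \<open>P\<^sub>n(x) \<cdot> f y\<close>; one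
  has \<open>f v\<close> to the right of the first factor and is \<open>m\<^sub>B P\<^bsub>1,n-1\<^esub>(x, y)\<close>, because \<open>P\<^bsub>1,n-1\<^esub>\<close> is a
  derivation in the first argument; the third is the sum of the \<open>m\<^sub>B P\<^bsub>k+1,n-1-k\<^esub>(x, y)\<close> with
  \<open>1 \<le> k < n - 1\<close>.  Together they are the Leibniz rule at \<open>n\<close> (\<open>jet_component_lift\<close>).  So the symbol
  map is surjective.

  \<^emph>\<open>The kernel.\<close>  A refinement of a partition pulled back along a surjection \<open>[n] \<rightarrow> [n - 1]\<close> has at most
  \<open>n - 1\<close> non-zero parts, but the finest refinement has \<open>n\<close>; so degeneracies have no finest component
  (\<open>order_filtration_finest\<close>).  Conversely let \<open>P\<close> have no finest component, and let \<open>r\<close> be a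
  refinement with \<open>P\<^sub>r \<noteq> 0\<close> and as many parts as possible.  The sums in the Leibniz rules at \<open>r\<close>
  involve refinements with more parts, so they vanish and \<open>P\<^sub>r\<close> is a derivation in each argument at a
  positive part (\<open>top_component\<close>).  A part \<open>k \<ge> 2\<close> of \<open>r\<close> can be lowered by one, and \<open>r\<close> is the
  pullback of the result along a surjection which identifies two neighbours.  Going on in this way
  until all parts are at most \<open>1\<close>, and lifting \<open>P\<^sub>r\<close> there, one gets a family in the image of a
  degeneracy map which agrees with \<open>P\<close> at \<open>r\<close> and vanishes at all other refinements with at least as
  many parts (\<open>exists_with_top_component\<close>).  Subtracting such families for all \<open>r\<close> of the maximal length
  lowers this length, and by induction \<open>P\<close> lies in the order filtration (\<open>order_filtrationI\<close>).

  \<^emph>\<open>Zero parts.\<close>  A linear functional with value \<open>1\<close> at the unit of \<open>B\<close> undoes the insertion of a unit.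
  With it, the condition that an argument enters by insertion becomes an equation
  (\<open>inserts_at_zeros\<close>), and deleting the zero parts from the finest component is well defined,
  injective, and has every multiderivation in its image (\<open>zero_part_deletion_unique\<close>,
  \<open>symbol_map_eq_zero_iff\<close>, \<open>jet_component_fill\<close>).
\<close>

section \<open>Multilinear maps and linear maps on tensor powers\<close>

abbreviation tensor_linear :: "(('k::field, 'v) tensor \<Rightarrow> ('k, 'w) tensor) \<Rightarrow> bool"
  where "tensor_linear \<equiv> Vector_Spaces.linear tscale tscale"

lemma linear_intro:
  assumes "vector_space s" "vector_space t"
    and "\<And>x y. g (x + y) = g x + g y" "\<And>c x. g (s c x) = t c (g x)"
  shows "Vector_Spaces.linear s t g"
  using assms by (simp add: Vector_Spaces.linear_iff)

lemma linear_addD: "Vector_Spaces.linear s t g \<Longrightarrow> g (x + y) = g x + g y"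
  and linear_scaleD: "Vector_Spaces.linear s t g \<Longrightarrow> g (s c x) = t c (g x)"
  and linear_spacesD: "Vector_Spaces.linear s t g \<Longrightarrow> vector_space s"
    "Vector_Spaces.linear s t g \<Longrightarrow> vector_space t"
  by (auto simp: Vector_Spaces.linear_iff)

lemma linear_zeroD: "Vector_Spaces.linear s t g \<Longrightarrow> g 0 = 0"
  using linear_addD[of s t g 0 0] by simp

lemma linear_diffD: "Vector_Spaces.linear s t g \<Longrightarrow> g (x - y) = g x - g y"
  using linear_addD[of s t g "x - y" y] by (simp add: algebra_simps)

lemma linear_sumD: "Vector_Spaces.linear s t g \<Longrightarrow> g (sum h S) = (\<Sum>i\<in>S. g (h i))"
  by (induction S rule: infinite_finite_induct) (auto simp: linear_zeroD linear_addD)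

lemma linear_plus:
  assumes "Vector_Spaces.linear s t g" "Vector_Spaces.linear s t h"
  shows "Vector_Spaces.linear s t (\<lambda>x. g x + h x)"
proof -
  interpret vector_space t using assms by (auto dest: linear_spacesD)
  show ?thesis using assms by (auto simp: Vector_Spaces.linear_iff scale_right_distrib)
qed

lemma linear_const_zero:
  assumes "vector_space s" "vector_space t"
  shows "Vector_Spaces.linear s t (\<lambda>x. 0)"
proof -
  interpret vector_space t by fact
  show ?thesis using assms by (intro linear_intro) auto
qed

lemma multilinear_append_iff:
  "multilinear s t d F \<longleftrightarrow>
    (\<forall>xs ys. Suc (length xs + length ys) = d \<longrightarrow> Vector_Spaces.linear s t (\<lambda>x. F (xs @ x # ys)))"
proof
  assume F: "multilinear s t d F"
  show "\<forall>xs ys. Suc (length xs + length ys) = d \<longrightarrow> Vector_Spaces.linear s t (\<lambda>x. F (xs @ x # ys))"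
  proof (intro allI impI)
    fix xs ys :: "'b list" assume "Suc (length xs + length ys) = d"
    then show "Vector_Spaces.linear s t (\<lambda>x. F (xs @ x # ys))"
      using F[unfolded multilinear_def, rule_format, of "xs @ undefined # ys" "length xs"] by simp
  qed
next
  assume *: "\<forall>xs ys. Suc (length xs + length ys) = d \<longrightarrow>
    Vector_Spaces.linear s t (\<lambda>x. F (xs @ x # ys))"
  show "multilinear s t d F" unfolding multilinear_def
  proof (intro allI impI)
    fix xs :: "'b list" and i assume "length xs = d \<and> i < d"
    then show "Vector_Spaces.linear s t (\<lambda>x. F (xs[i := x]))"
      using *[rule_format, of "take i xs" "drop (Suc i) xs"] by (simp add: upd_conv_take_nth_drop)
  qed
qed

lemma multilinearD:
  assumes "multilinear s t d F" "Suc (length xs + length ys) = d"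
  shows "Vector_Spaces.linear s t (\<lambda>x. F (xs @ x # ys))"
  using assms by (simp add: multilinear_append_iff)

lemma multilinearI:
  assumes "\<And>xs ys. Suc (length xs + length ys) = d \<Longrightarrow>
    Vector_Spaces.linear s t (\<lambda>x. F (xs @ x # ys))"
  shows "multilinear s t d F"
  using assms by (simp add: multilinear_append_iff)

lemma multilinear_cong:
  assumes "\<And>xs. length xs = d \<Longrightarrow> F xs = G xs"
  shows "multilinear s t d F \<longleftrightarrow> multilinear s t d G"
  unfolding multilinear_def using assms by simp

lemma multilinear_add:
  "multilinear s t d F \<Longrightarrow> multilinear s t d G \<Longrightarrow> multilinear s t d (\<lambda>xs. F xs + G xs)"
  unfolding multilinear_append_iff by (simp add: linear_plus)

lemma multilinear_compose_linear:
  assumes "multilinear s t d F" "Vector_Spaces.linear t r L"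
  shows "multilinear s r d (\<lambda>xs. L (F xs))"
  using assms(1) by (auto simp: multilinear_def intro: linear_compose_field[OF _ assms(2)])

lemma multilinear_apply:
  fixes F :: "'v::ab_group_add list \<Rightarrow> ('k::field, 'w) tensor"
  assumes "multilinear s tscale d F"
  shows "multilinear s (*) d (\<lambda>xs. F xs \<phi>)"
  by (rule multilinear_compose_linear[OF assms])
    (auto simp: Vector_Spaces.linear_iff vector_space_tscale vector_space_field_mult tscale_def)

lemma tensor_power_zero: "0 \<in> tensor_power s d"
  and tensor_power_add:
    "S \<in> tensor_power s d \<Longrightarrow> T \<in> tensor_power s d \<Longrightarrow> S + T \<in> tensor_power s d"
  and tensor_power_scale: "T \<in> tensor_power s d \<Longrightarrow> tscale c T \<in> tensor_power s d"
  and tensor_power_pure: "length xs = d \<Longrightarrow> pure_tensor s xs \<in> tensor_power s d"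
proof -
  interpret vector_space "tscale :: 'k::field \<Rightarrow> ('k, 'v) tensor \<Rightarrow> ('k, 'v) tensor" for dummy :: 'v
    by (rule vector_space_tscale)
  show "0 \<in> tensor_power s d"
    and "S \<in> tensor_power s d \<Longrightarrow> T \<in> tensor_power s d \<Longrightarrow> S + T \<in> tensor_power s d"
    and "T \<in> tensor_power s d \<Longrightarrow> tscale c T \<in> tensor_power s d"
    unfolding tensor_power_def by (auto intro: span_zero span_add span_scale)
  show "length xs = d \<Longrightarrow> pure_tensor s xs \<in> tensor_power s d"
    using pure_tensor_in_tensor_power[of s xs] by simp
qed

lemma tensor_power_sum:
  "(\<And>i. i \<in> I \<Longrightarrow> T i \<in> tensor_power s d) \<Longrightarrow> (\<Sum>i\<in>I. T i) \<in> tensor_power s d"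
  by (induction I rule: infinite_finite_induct) (auto simp: tensor_power_zero tensor_power_add)

lemma tensor_power_diff:
  fixes T :: "('k::field, 'v::ab_group_add) tensor"
  assumes "S \<in> tensor_power s d" "T \<in> tensor_power s d"
  shows "S - T \<in> tensor_power s d"
proof -
  have "S - T = S + tscale (- 1) T" by (auto simp: tscale_def fun_eq_iff)
  also have "\<dots> \<in> tensor_power s d" by (intro tensor_power_add tensor_power_scale assms)
  finally show ?thesis .
qed

lemma tensor_power_induct [consumes 1, case_names zero step]:
  assumes "T \<in> tensor_power s d" "Q 0"
    and "\<And>c xs T. length xs = d \<Longrightarrow> T \<in> tensor_power s d \<Longrightarrow> Q T \<Longrightarrow>
      Q (tscale c (pure_tensor s xs) + T)"
  shows "Q T"
proof -
  interpret V: vector_space "tscale :: 'b \<Rightarrow> ('b, 'a) tensor \<Rightarrow> ('b, 'a) tensor"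
    by (rule vector_space_tscale)
  have "T \<in> V.span {pure_tensor s xs | xs. length xs = d}"
    using assms(1) by (simp add: tensor_power_def)
  then have "T \<in> tensor_power s d \<and> Q T"
  proof (induction rule: V.span_induct_alt)
    case base
    show ?case using assms(2) tensor_power_zero by blast
  next
    case (step c x y)
    then obtain xs where xs: "x = pure_tensor s xs" "length xs = d" by blast
    show ?case unfolding xs(1)
      using step(2) assms(3)[OF xs(2)]
        tensor_power_add[OF tensor_power_scale[OF tensor_power_pure[OF xs(2)]]] by blast
  qed
  then show ?thesis ..
qed

lemma linear_eq_on_tensor_power:
  assumes "T \<in> tensor_power s d" "Vector_Spaces.linear tscale t L" "Vector_Spaces.linear tscale t M"
    and "\<And>xs. length xs = d \<Longrightarrow> L (pure_tensor s xs) = M (pure_tensor s xs)"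
  shows "L T = M T"
  using assms(1)
  by (induction rule: tensor_power_induct)
    (simp_all only: linear_zeroD[OF assms(2)] linear_zeroD[OF assms(3)] linear_addD[OF assms(2)]
      linear_addD[OF assms(3)] linear_scaleD[OF assms(2)] linear_scaleD[OF assms(3)] assms(4))

lemma linear_image_tensor_power:
  assumes "T \<in> tensor_power s d" "tensor_linear L"
    and "\<And>xs. length xs = d \<Longrightarrow> L (pure_tensor s xs) \<in> tensor_power r e"
  shows "L T \<in> tensor_power r e"
  using assms(1)
proof (induction rule: tensor_power_induct)
  case zero
  show ?case by (simp only: linear_zeroD[OF assms(2)] tensor_power_zero)
next
  case (step c xs T)
  show ?case
    by (simp only: linear_addD[OF assms(2)] linear_scaleD[OF assms(2)])
      (intro tensor_power_add tensor_power_scale assms step)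
qed

text \<open>
  Forms are total functions on lists, so the form at which a tensor is evaluated may be changed on
  lists of the wrong length.
\<close>

lemma tensor_power_apply_cong:
  assumes "T \<in> tensor_power s d" "\<And>xs. length xs = d \<Longrightarrow> \<phi> xs = \<psi> xs"
  shows "T \<phi> = T \<psi>"
  using assms(1)
proof (induction rule: tensor_power_induct)
  case (step c xs T)
  have "multilinear s (*) d \<phi> \<longleftrightarrow> multilinear s (*) d \<psi>"
    by (rule multilinear_cong) (rule assms(2))
  then show ?case using step assms(2) by (simp add: pure_tensor_def tscale_def)
qed simp

lemma tensor_power_apply_zero:
  assumes "T \<in> tensor_power s d" shows "T (\<lambda>_. 0) = 0"
  using assms by (induction rule: tensor_power_induct) (simp_all add: pure_tensor_def tscale_def)

lemma tensor_linear_tensor_map: "tensor_linear (tensor_map s e g)"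
  by (rule linear_intro) (auto simp: vector_space_tscale tensor_map_def tscale_def fun_eq_iff)

lemma tensor_linear_lmult: "tensor_linear (lmult s d i b)"
  and tensor_linear_rmult: "tensor_linear (rmult s d i b)"
  and tensor_linear_merge: "tensor_linear (merge s d i)"
  and tensor_linear_insert_factor: "tensor_linear (insert_factor s d i b)"
  by (simp_all only: lmult_def rmult_def merge_def insert_factor_def tensor_linear_tensor_map)


section \<open>Contraction\<close>

text \<open>
  The value at \<open>\<theta>\<close> of the linear map on a tensor power which corresponds to the multilinear map
  \<open>F\<close>.  As a tensor is a functional, it can be written down without choosing an expression of
  \<open>\<theta>\<close> by pure tensors.
\<close>

definition contract ::
  "('k, 'v) tensor \<Rightarrow> ('v list \<Rightarrow> ('k, 'w) tensor) \<Rightarrow> ('k, 'w) tensor"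
  where "contract \<theta> F = (\<lambda>\<phi>. \<theta> (\<lambda>xs. F xs \<phi>))"

lemma contract_pure:
  assumes "multilinear s tscale (length xs) F"
  shows "contract (pure_tensor s xs) F = F xs"
  using multilinear_apply[OF assms] by (simp add: contract_def pure_tensor_def)

lemma contract_zero_left: "contract 0 F = 0"
  and contract_add_left: "contract (\<theta> + \<theta>') F = contract \<theta> F + contract \<theta>' F"
  and contract_diff_left:
    "contract (\<theta> - \<theta>') F = contract \<theta> F - contract \<theta>' (F :: _ \<Rightarrow> ('k::field, _) tensor)"
  and contract_scale_left: "contract (tscale c \<theta>) F = tscale c (contract \<theta> F)"
  by (auto simp: contract_def fun_eq_iff tscale_def)

lemma linear_contract: "tensor_linear (\<lambda>\<theta>. contract \<theta> F)"
  by (rule linear_intro) (auto simp: vector_space_tscale contract_add_left contract_scale_left)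

lemma contract_linear:
  assumes "\<theta> \<in> tensor_power s d" "multilinear s tscale d F" "tensor_linear L"
  shows "L (contract \<theta> F) = contract \<theta> (\<lambda>xs. L (F xs))"
proof (rule linear_eq_on_tensor_power[OF assms(1)])
  show "tensor_linear (\<lambda>\<theta>. L (contract \<theta> F))"
    by (rule linear_compose_field[OF linear_contract assms(3)])
  show "L (contract (pure_tensor s xs) F) = contract (pure_tensor s xs) (\<lambda>xs. L (F xs))"
    if "length xs = d" for xs
    using contract_pure[of s xs F] contract_pure[of s xs "\<lambda>xs. L (F xs)"] that assms
    by (simp add: multilinear_compose_linear)
qed (rule linear_contract)

lemma contract_cong:
  assumes "\<theta> \<in> tensor_power s d" "\<And>xs. length xs = d \<Longrightarrow> F xs = G xs"
  shows "contract \<theta> F = contract \<theta> G"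
  unfolding contract_def
  by (rule ext, rule tensor_power_apply_cong[OF assms(1)]) (simp add: assms(2))

lemma contract_add_right:
  assumes "\<theta> \<in> tensor_power s d" "multilinear s tscale d F" "multilinear s tscale d G"
  shows "contract \<theta> (\<lambda>xs. F xs + G xs) = contract \<theta> F + contract \<theta> G"
proof (rule linear_eq_on_tensor_power[OF assms(1) linear_contract])
  show "tensor_linear (\<lambda>\<theta>. contract \<theta> F + contract \<theta> G)"
    by (intro linear_plus linear_contract)
  have "multilinear s tscale d (\<lambda>xs. F xs + G xs)" by (rule multilinear_add[OF assms(2,3)])
  then show "contract (pure_tensor s xs) (\<lambda>xs. F xs + G xs) =
      contract (pure_tensor s xs) F + contract (pure_tensor s xs) G" if "length xs = d" for xs
    using that assms by (simp only: contract_pure)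
qed

lemma contract_sum_right:
  fixes F :: "'i \<Rightarrow> 'v::ab_group_add list \<Rightarrow> ('k::field, 'w) tensor"
  assumes "\<theta> \<in> tensor_power s d" "\<And>i. i \<in> I \<Longrightarrow> multilinear s tscale d (F i)" "finite I"
    "vector_space s"
  shows "contract \<theta> (\<lambda>xs. \<Sum>i\<in>I. F i xs) = (\<Sum>i\<in>I. contract \<theta> (F i)) \<and>
    multilinear s tscale d (\<lambda>xs. \<Sum>i\<in>I. F i xs)"
  using assms(3,2)
proof (induction I)
  case empty
  have "contract \<theta> (\<lambda>xs. 0) = 0"
    using tensor_power_apply_zero[OF assms(1)] by (simp add: contract_def fun_eq_iff)
  moreover have "multilinear s (tscale :: _ \<Rightarrow> ('k, 'w) tensor \<Rightarrow> _) d (\<lambda>xs. 0)"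
    by (intro multilinearI linear_const_zero vector_space_tscale assms(4))
  ultimately show ?case by (simp only: sum.empty simp_thms)
next
  case (insert i I)
  then have "multilinear s tscale d (\<lambda>xs. F i xs + (\<Sum>i\<in>I. F i xs))"
    by (intro multilinear_add) auto
  with insert contract_add_right[OF assms(1), of "F i" "\<lambda>xs. \<Sum>i\<in>I. F i xs"] show ?case
    by (simp only: sum.insert insert_iff simp_thms)
qed

lemma contract_scale_right:
  assumes "\<theta> \<in> tensor_power s d" "multilinear s tscale d F"
  shows "contract \<theta> (\<lambda>xs. tscale c (F xs)) = tscale c (contract \<theta> F)"
  by (rule contract_linear[OF assms, symmetric], rule linear_intro)
    (auto simp: vector_space_tscale tscale_def algebra_simps fun_eq_iff)

lemma contract_in_tensor_power:
  assumes "\<theta> \<in> tensor_power s d" "multilinear s tscale d F"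
    and "\<And>xs. length xs = d \<Longrightarrow> F xs \<in> tensor_power r e"
  shows "contract \<theta> F \<in> tensor_power r e"
  by (rule linear_image_tensor_power[OF assms(1) linear_contract])
    (use assms in \<open>simp add: contract_pure\<close>)

lemma contract_tensor_map:
  assumes "multilinear s tscale e F"
  shows "contract (tensor_map s e g \<theta>) F = contract \<theta> (\<lambda>xs. F (g xs))"
  using multilinear_apply[OF assms] by (simp add: contract_def tensor_map_def)

text \<open>
  Contraction with a fixed tensor uses up some of the arguments of a multilinear map; it remains
  multilinear in the others.
\<close>

lemma linear_contract_parameter:
  assumes "\<theta> \<in> tensor_power s d" "vector_space r"
    and "\<And>x. multilinear s tscale d (F x)"
    and "\<And>xs. length xs = d \<Longrightarrow> Vector_Spaces.linear r tscale (\<lambda>x. F x xs)"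
  shows "Vector_Spaces.linear r tscale (\<lambda>x. contract \<theta> (F x))"
proof (rule linear_intro[OF assms(2) vector_space_tscale])
  fix x y
  have "contract \<theta> (F (x + y)) = contract \<theta> (\<lambda>xs. F x xs + F y xs)"
    by (rule contract_cong[OF assms(1)]) (rule linear_addD[OF assms(4)])
  also have "\<dots> = contract \<theta> (F x) + contract \<theta> (F y)"
    by (rule contract_add_right[OF assms(1) assms(3) assms(3)])
  finally show "contract \<theta> (F (x + y)) = contract \<theta> (F x) + contract \<theta> (F y)" .
next
  fix c x
  have "contract \<theta> (F (r c x)) = contract \<theta> (\<lambda>xs. tscale c (F x xs))"
    by (rule contract_cong[OF assms(1)]) (rule linear_scaleD[OF assms(4)])
  also have "\<dots> = tscale c (contract \<theta> (F x))"
    by (rule contract_scale_right[OF assms(1) assms(3)])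
  finally show "contract \<theta> (F (r c x)) = tscale c (contract \<theta> (F x))" .
qed

text \<open>
  The universal property of the tensor power.  The elements of \<open>tensor_hom\<close> vanish outside of the
  tensor power, so the linear map obtained by contraction has to be cut off.
\<close>

lemma tensor_hom_of_multilinear:
  fixes F :: "'a::{ring,monoid_mult} list \<Rightarrow> ('k::field, 'b::{ring,monoid_mult}) tensor"
  assumes "vector_space sA" "multilinear sA tscale d F"
    and "\<And>xs. length xs = d \<Longrightarrow> F xs \<in> tensor_power sB e"
  shows "\<exists>P\<in>tensor_hom sA sB d e. \<forall>xs. length xs = d \<longrightarrow> P (pure_tensor sA xs) = F xs"
proof
  let ?P = "\<lambda>T. if T \<in> tensor_power sA d then contract T F else 0"
  show "?P \<in> tensor_hom sA sB d e"
    unfolding tensor_hom_def linear_on_def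
    using contract_in_tensor_power[OF _ assms(2,3)]
    by (simp add: tensor_power_add tensor_power_scale contract_add_left contract_scale_left)
  show "\<forall>xs. length xs = d \<longrightarrow> ?P (pure_tensor sA xs) = F xs"
    using assms(2) by (auto simp: tensor_power_pure contract_pure)
qed

lemma tensor_hom_additive:
  assumes "P \<in> tensor_hom sA sB d e" "S \<in> tensor_power sA d" "T \<in> tensor_power sA d"
  shows "P (S + T) = P S + P T"
  using assms unfolding tensor_hom_def linear_on_def by blast

lemma tensor_hom_homogeneous:
  assumes "P \<in> tensor_hom sA sB d e" "T \<in> tensor_power sA d"
  shows "P (tscale c T) = tscale c (P T)"
  using assms unfolding tensor_hom_def linear_on_def by blast

lemma tensor_hom_value:
  assumes "P \<in> tensor_hom sA sB d e" "T \<in> tensor_power sA d"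
  shows "P T \<in> tensor_power sB e"
  using assms unfolding tensor_hom_def linear_on_def by blast

lemma tensor_hom_ext:
  assumes P: "P \<in> tensor_hom sA sB d e" and Q: "Q \<in> tensor_hom sA sB d e"
    and eq: "\<And>xs. length xs = d \<Longrightarrow> P (pure_tensor sA xs) = Q (pure_tensor sA xs)"
  shows "P = Q"
proof
  fix T
  have z: "P 0 = 0" "Q 0 = 0"
    using tensor_hom_homogeneous[OF P tensor_power_zero, of 0]
      tensor_hom_homogeneous[OF Q tensor_power_zero, of 0]
    by (simp_all add: tscale_def) (simp_all add: zero_fun_def)
  show "P T = Q T"
  proof (cases "T \<in> tensor_power sA d")
    case True
    then show ?thesis
    proof (induction rule: tensor_power_induct)
      case (step c xs T)
      then show ?case
        by (simp only: tensor_hom_additive[OF P] tensor_hom_additive[OF Q] tensor_power_scale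
            tensor_power_pure tensor_hom_homogeneous[OF P] tensor_hom_homogeneous[OF Q] eq)
    qed (simp only: z)
  next
    case False
    then show ?thesis using P Q unfolding tensor_hom_def by auto
  qed
qed

lemma multilinear_tensor_hom:
  fixes sA :: "'k::field \<Rightarrow> 'a::{ring,monoid_mult} \<Rightarrow> 'a"
  assumes P: "P \<in> tensor_hom sA sB d e" and s: "vector_space sA"
  shows "multilinear sA tscale d (\<lambda>xs. P (pure_tensor sA xs))"
proof (rule multilinearI, rule linear_intro[OF s vector_space_tscale])
  fix xs ys :: "'a list" and x y :: 'a and c :: 'k
  assume len: "Suc (length xs + length ys) = d"
  have lin: "Vector_Spaces.linear sA tscale (\<lambda>x. pure_tensor sA (xs @ x # ys))"
    by (rule multilinearD[OF multilinear_pure_tensor[OF s] len])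
  have "pure_tensor sA (xs @ x # ys) \<in> tensor_power sA d" for x
    using len by (intro tensor_power_pure) simp
  note * = this[of x] this[of y]
  show "P (pure_tensor sA (xs @ (x + y) # ys)) =
      P (pure_tensor sA (xs @ x # ys)) + P (pure_tensor sA (xs @ y # ys))"
    unfolding linear_addD[OF lin] by (rule tensor_hom_additive[OF P *])
  show "P (pure_tensor sA (xs @ sA c x # ys)) = tscale c (P (pure_tensor sA (xs @ x # ys)))"
    unfolding linear_scaleD[OF lin] by (rule tensor_hom_homogeneous[OF P *(1)])
qed

lemma zero_in_tensor_hom: "0 \<in> tensor_hom sA sB d e"
  unfolding tensor_hom_def linear_on_def by (simp add: tensor_power_zero tscale_def fun_eq_iff)

lemma add_in_tensor_hom:
  assumes "P \<in> tensor_hom sA sB d e" "Q \<in> tensor_hom sA sB d e"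
  shows "P + Q \<in> tensor_hom sA sB d e"
  using assms unfolding tensor_hom_def linear_on_def
  by (auto simp: tensor_power_add) (auto simp: tscale_def fun_eq_iff algebra_simps)

lemma scale_in_tensor_hom:
  assumes "P \<in> tensor_hom sA sB d e"
  shows "(\<lambda>T. tscale c (P T)) \<in> tensor_hom sA sB d e"
  using assms unfolding tensor_hom_def linear_on_def
  by (auto simp: tensor_power_scale) (auto simp: tscale_def fun_eq_iff algebra_simps)


section \<open>Refinements of partitions\<close>

lemma append_Cons_eq_append_iff:
  "xs @ m # ys = u @ v \<longleftrightarrow>
    (\<exists>u'. u = xs @ m # u' \<and> ys = u' @ v) \<or> (\<exists>xs'. xs = u @ xs' \<and> v = xs' @ m # ys)"
  by (auto simp: append_eq_append_conv2 Cons_eq_append_conv)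

text \<open>The refinements of a single part; those of a partition are obtained from them by recursion.\<close>

definition part_refinements :: "nat \<Rightarrow> nat list set"
  where "part_refinements k = (if k = 0 then {[0]} else {\<mu>. sum_list \<mu> = k \<and> 0 \<notin> set \<mu>})"

lemma part_refinements_iff:
  "\<mu> \<in> part_refinements k \<longleftrightarrow> \<mu> \<noteq> [] \<and> \<mu> \<in> nondeg_partitions (length \<mu>) k"
proof (cases "k = 0")
  case True
  then show ?thesis
    by (cases \<mu>) (auto simp: part_refinements_def nondeg_partitions_def ordered_partitions_def
        degenerate_def)
next
  case False
  then have "sum_list \<mu> = k \<Longrightarrow> \<mu> \<noteq> [] \<and> 0 < sum_list \<mu> \<and> sum_list \<mu> \<noteq> 0" by auto
  then show ?thesis
    unfolding part_refinements_def nondeg_partitions_def ordered_partitions_def degenerate_def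
    using False by (cases "sum_list \<mu> = k") (simp_all del: sum_list_eq_0_iff)
qed

lemma refinements_Nil [simp]: "refinements [] = {[]}"
  by (auto simp: refinements_def)

lemma refinements_Cons:
  "r \<in> refinements (k # p) \<longleftrightarrow>
    (\<exists>u v. r = u @ v \<and> u \<in> part_refinements k \<and> v \<in> refinements p)"
proof
  assume "r \<in> refinements (k # p)"
  then show "\<exists>u v. r = u @ v \<and> u \<in> part_refinements k \<and> v \<in> refinements p"
    unfolding refinements_def part_refinements_iff[symmetric]
    by (clarsimp simp: list_all2_Cons2) blast
next
  assume "\<exists>u v. r = u @ v \<and> u \<in> part_refinements k \<and> v \<in> refinements p"
  then obtain u \<mu>s where "r = u @ concat \<mu>s" "u \<in> part_refinements k"
    "list_all2 (\<lambda>\<mu> n. \<mu> \<in> part_refinements n) \<mu>s p"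
    unfolding refinements_def part_refinements_iff[symmetric] by blast
  then show "r \<in> refinements (k # p)"
    unfolding refinements_def part_refinements_iff[symmetric]
    by (intro CollectI exI[of _ "u # \<mu>s"]) simp
qed

lemma sum_list_part_refinement: "\<mu> \<in> part_refinements k \<Longrightarrow> sum_list \<mu> = k"
  by (auto simp: part_refinements_def split: if_splits)

lemma sum_list_refinement: "r \<in> refinements p \<Longrightarrow> sum_list r = sum_list p"
  by (induction p arbitrary: r) (auto simp: refinements_Cons sum_list_part_refinement)

lemma part_refinement_split:
  assumes "u @ (a + b) # v \<in> part_refinements k" "a > 0" "b > 0"
  shows "u @ a # b # v \<in> part_refinements k"
  using assms by (cases u; cases v) (auto simp: part_refinements_def split: if_splits)

lemma refinement_split:
  assumes "r1 @ (a + b) # r2 \<in> refinements p" "a > 0" "b > 0"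
  shows "r1 @ a # b # r2 \<in> refinements p"
  using assms(1)
proof (induction p arbitrary: r1)
  case (Cons k p)
  then obtain u v where uv: "r1 @ (a + b) # r2 = u @ v" "u \<in> part_refinements k" "v \<in> refinements p"
    by (auto simp: refinements_Cons)
  then consider u' where "u = r1 @ (a + b) # u'" "r2 = u' @ v"
    | r' where "r1 = u @ r'" "v = r' @ (a + b) # r2"
    by (auto simp: append_Cons_eq_append_iff)
  then show ?case
  proof cases
    case 1
    then have "r1 @ a # b # u' \<in> part_refinements k"
      using part_refinement_split uv(2) assms(2,3) by blast
    then show ?thesis unfolding refinements_Cons using 1 uv(3)
      by (intro exI[of _ "r1 @ a # b # u'"] exI[of _ v]) simp
  next
    case 2
    then show ?thesis unfolding refinements_Cons using Cons.IH[of r'] uv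
      by (intro exI[of _ u] exI[of _ "r' @ a # b # r2"]) simp
  qed
qed simp

lemma length_part_refinement_le: "\<mu> \<in> part_refinements k \<Longrightarrow> length \<mu> \<le> Suc k"
proof -
  have "0 \<notin> set \<mu> \<Longrightarrow> length \<mu> \<le> sum_list \<mu>" for \<mu> :: "nat list" by (induction \<mu>) auto
  then show "\<mu> \<in> part_refinements k \<Longrightarrow> length \<mu> \<le> Suc k"
    by (fastforce simp: part_refinements_def split: if_splits)
qed

lemma finite_refinements: "finite (refinements p)"
proof (induction p)
  case (Cons k p)
  have "part_refinements k \<subseteq> {xs. set xs \<subseteq> {..k} \<and> length xs \<le> Suc k}"
    using length_part_refinement_le sum_list_part_refinement member_le_sum_list by fastforce
  then have "finite (part_refinements k)"
    using finite_lists_length_le finite_subset by blast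
  moreover have "refinements (k # p) = (\<lambda>(u, v). u @ v) ` (part_refinements k \<times> refinements p)"
    unfolding set_eq_iff refinements_Cons by (simp add: image_iff) blast
  ultimately show ?case using Cons.IH by simp
qed simp

lemma finest_refinement_append: "finest_refinement (p @ q) = finest_refinement p @ finest_refinement q"
  by (simp add: finest_refinement_def)

lemma finest_refinement_Cons:
  "finest_refinement (k # p) = (if k = 0 then [0] else replicate k 1) @ finest_refinement p"
  by (simp add: finest_refinement_def)

lemma finest_refinement_Nil [simp]: "finest_refinement [] = []"
  by (simp add: finest_refinement_def)

lemma finest_refinement_split:
  assumes "a > 0" "b > 0"
  shows "finest_refinement (p @ a # b # q) = finest_refinement (p @ (a + b) # q)"
  using assms by (simp add: finest_refinement_append finest_refinement_Cons replicate_add)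

lemma finest_refinement_part:
  assumes "\<mu> \<in> part_refinements k"
  shows "finest_refinement \<mu> = (if k = 0 then [0] else replicate k 1)"
proof (cases "k = 0")
  case True
  with assms show ?thesis by (simp add: part_refinements_def finest_refinement_Cons)
next
  case False
  have "0 \<notin> set \<mu> \<Longrightarrow> finest_refinement \<mu> = replicate (sum_list \<mu>) 1" for \<mu>
    by (induction \<mu>) (auto simp: finest_refinement_Cons replicate_add)
  with False assms show ?thesis by (auto simp: part_refinements_def)
qed

lemma finest_refinement_of_refinement:
  "r \<in> refinements p \<Longrightarrow> finest_refinement r = finest_refinement p"
  by (induction p arbitrary: r)
    (auto simp: refinements_Cons finest_refinement_append finest_refinement_Cons
      finest_refinement_part)

lemma finest_refinement_in_refinements: "finest_refinement p \<in> refinements p"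
proof (induction p)
  case (Cons k p)
  have "(if k = 0 then [0] else replicate k 1) \<in> part_refinements k"
    by (auto simp: part_refinements_def sum_list_replicate)
  then show ?case using Cons.IH unfolding refinements_Cons finest_refinement_Cons by blast
qed simp

lemma finest_refinement_idem: "(\<forall>k\<in>set p. k \<le> 1) \<Longrightarrow> finest_refinement p = p"
  by (induction p) (auto simp: finest_refinement_Cons le_Suc_eq)

lemma finest_refinement_le: "k \<in> set (finest_refinement p) \<Longrightarrow> k \<le> 1"
  by (induction p) (auto simp: finest_refinement_Cons split: if_splits)

lemma big_part_or_finest:
  assumes "r \<in> refinements p"
  shows "r = finest_refinement p \<or> (\<exists>r1 k r2. r = r1 @ k # r2 \<and> k \<ge> 2)"
proof (cases "\<exists>k\<in>set r. k \<ge> 2")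
  case True
  then show ?thesis by (metis in_set_conv_decomp)
next
  case False
  then have "\<forall>k\<in>set r. k \<le> 1" by auto
  then show ?thesis
    using finest_refinement_idem finest_refinement_of_refinement[OF assms] by metis
qed

lemma refinements_ones: "refinements (replicate n 1) = {replicate n 1}"
proof -
  have "u \<in> part_refinements 1 \<longleftrightarrow> u = [1]" for u
  proof
    assume u: "u \<in> part_refinements 1"
    then have "u \<noteq> []" "sum_list u = 1" "0 \<notin> set u"
      by (auto simp: part_refinements_def)
    then obtain a u' where u': "u = a # u'" "a + sum_list u' = 1" "a \<noteq> 0" "0 \<notin> set u'"
      by (cases u) auto
    then have "sum_list u' = 0" by linarith
    with u' have "u' = []" by (cases u') auto
    with u' show "u = [1]" by simp
  qed (simp add: part_refinements_def)
  then have "refinements (1 # p) = (#) 1 ` refinements p" for p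
    unfolding set_eq_iff refinements_Cons by (simp add: image_iff) blast
  then show ?thesis by (induction n) simp_all
qed

lemma length_filter_finest: "length (filter (\<lambda>n. n \<noteq> 0) (finest_refinement p)) = sum_list p"
  by (induction p) (auto simp: finest_refinement_Cons)


section \<open>Pulling back partitions\<close>

text \<open>
  For a surjection with fibres of sizes \<open>ws\<close>, the parts of the pulled back partition are the sums
  of the weights \<open>ws\<close> over the blocks of the given partition.
\<close>

fun block_sums :: "nat list \<Rightarrow> nat list \<Rightarrow> nat list" where
  "block_sums ws [] = []"
| "block_sums ws (k # p) = sum_list (take k ws) # block_sums (drop k ws) p"

lemma length_block_sums [simp]: "length (block_sums ws p) = length p"
  by (induction ws p rule: block_sums.induct) auto

lemma block_sums_append:
  "block_sums ws (p @ q) = block_sums ws p @ block_sums (drop (sum_list p) ws) q"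
  by (induction ws p rule: block_sums.induct) (auto simp: add.commute)

lemma sum_list_block_sums: "sum_list (block_sums ws p) = sum_list (take (sum_list p) ws)"
  by (induction ws p rule: block_sums.induct) (auto simp: take_add)

text \<open>
  The fibres of a surjection are not empty, so all weights are positive and their partial sums are
  strictly increasing.  Therefore pullback is injective and preserves the zero parts.
\<close>

lemma sum_list_take_less:
  fixes ws :: "nat list"
  assumes "\<forall>w\<in>set ws. 0 < w" "k < l" "l \<le> length ws"
  shows "sum_list (take k ws) < sum_list (take l ws)"
proof -
  have "take l ws = take k ws @ take (l - k) (drop k ws)"
    using assms(2) by (metis le_add_diff_inverse less_imp_le take_add)
  moreover have "take (l - k) (drop k ws) = ws ! k # take (l - k - 1) (drop (Suc k) ws)"
    using assms(2,3) by (subst Cons_nth_drop_Suc[symmetric]) (auto simp: take_Cons')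
  moreover have "0 < ws ! k" using assms by auto
  ultimately show ?thesis by simp
qed

lemma drop_positive: "\<forall>w\<in>set ws. (0::nat) < w \<Longrightarrow> \<forall>w\<in>set (drop k ws). 0 < w"
  using in_set_dropD by metis

lemma sum_list_take_eq_iff:
  fixes ws :: "nat list"
  assumes "\<forall>w\<in>set ws. 0 < w" "k \<le> length ws" "l \<le> length ws"
  shows "sum_list (take k ws) = sum_list (take l ws) \<longleftrightarrow> k = l"
  using sum_list_take_less[OF assms(1), of k l] sum_list_take_less[OF assms(1), of l k] assms(2,3)
  by (metis less_irrefl linorder_neqE_nat)

lemma sum_list_take_eq_0_iff:
  fixes ws :: "nat list"
  assumes "\<forall>w\<in>set ws. 0 < w" "k \<le> length ws"
  shows "sum_list (take k ws) = 0 \<longleftrightarrow> k = 0"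
  using sum_list_take_eq_iff[OF assms, of 0] by simp

lemma block_sums_inject:
  assumes "\<forall>w\<in>set ws. 0 < w" "sum_list p \<le> length ws" "sum_list q \<le> length ws"
    "block_sums ws p = block_sums ws q"
  shows "p = q"
  using assms
proof (induction ws p arbitrary: q rule: block_sums.induct)
  case (1 ws)
  then show ?case by (cases q) auto
next
  case (2 ws k p)
  then obtain l q' where q: "q = l # q'" by (cases q) auto
  have "k = l" using 2 sum_list_take_eq_iff[of ws k l] by (simp add: q)
  have "\<forall>w\<in>set (drop k ws). 0 < w" using 2(2) by (rule drop_positive)
  then have "p = q'" using 2(3-5) \<open>k = l\<close> by (intro 2(1)) (simp_all add: q)
  with \<open>k = l\<close> show ?case by (simp add: q)
qed

lemma block_sums_eq_appendD:
  assumes "block_sums ws p = u @ v"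
  obtains p1 p2 where "p = p1 @ p2" "block_sums ws p1 = u" "block_sums (drop (sum_list p1) ws) p2 = v"
proof
  have len: "length p = length u + length v" using assms length_block_sums[of ws p] by simp
  show "p = take (length u) p @ drop (length u) p" by simp
  then have "block_sums ws (take (length u) p) @
      block_sums (drop (sum_list (take (length u) p)) ws) (drop (length u) p) = u @ v"
    using assms block_sums_append by metis
  then show "block_sums ws (take (length u) p) = u"
    "block_sums (drop (sum_list (take (length u) p)) ws) (drop (length u) p) = v"
    using len by (auto simp: append_eq_append_conv)
qed

lemma block_sums_eq_ConsD:
  assumes "block_sums ws p = x # v"
  obtains k p' where "p = k # p'" "x = sum_list (take k ws)" "block_sums (drop k ws) p' = v"
  using assms by (cases p) auto

lemma zero_in_block_sums:
  assumes "\<forall>w\<in>set ws. 0 < w" "sum_list p \<le> length ws"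
  shows "0 \<in> set (block_sums ws p) \<longleftrightarrow> 0 \<in> set p"
  using assms
proof (induction ws p rule: block_sums.induct)
  case (2 ws k p)
  have "0 \<in> set (block_sums (drop k ws) p) \<longleftrightarrow> 0 \<in> set p"
    by (rule 2(1)[OF drop_positive[OF 2(2)]]) (use 2(3) in simp)
  moreover have "sum_list (take k ws) = 0 \<longleftrightarrow> k = 0"
    using sum_list_take_eq_0_iff[OF 2(2), of k] 2(3) by simp
  ultimately show ?case by (metis block_sums.simps(2) list.set_intros(1) list.set_intros(2) set_ConsD)
qed simp

text \<open>
  The number of non-zero parts is an invariant of pullback.  It tells the finest refinement from
  the refinements which are pulled back.
\<close>

lemma length_filter_block_sums:
  assumes "\<forall>w\<in>set ws. 0 < w" "sum_list p \<le> length ws"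
  shows "length (filter (\<lambda>n. n \<noteq> 0) (block_sums ws p)) = length (filter (\<lambda>n. n \<noteq> 0) p)"
  using assms
proof (induction ws p rule: block_sums.induct)
  case (2 ws k p)
  have "sum_list (take k ws) = 0 \<longleftrightarrow> k = 0"
    using sum_list_take_eq_0_iff[OF 2(2), of k] 2(3) by simp
  moreover have "length (filter (\<lambda>n. n \<noteq> 0) (block_sums (drop k ws) p)) =
      length (filter (\<lambda>n. n \<noteq> 0) p)"
    by (rule 2(1)[OF drop_positive[OF 2(2)]]) (use 2(3) in simp)
  ultimately show ?case by (auto simp del: sum_list_eq_0_iff)
qed simp

lemma part_refinements_block_sums:
  assumes ws: "\<forall>w\<in>set ws. 0 < w" and "k \<le> length ws" "sum_list r \<le> length ws"
  shows "block_sums ws r \<in> part_refinements (sum_list (take k ws)) \<longleftrightarrow> r \<in> part_refinements k"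
proof (cases "k = 0")
  case True
  show ?thesis
  proof (cases r)
    case (Cons a r')
    then show ?thesis
      using True sum_list_take_eq_0_iff[OF ws, of a] assms(3)
      by (auto simp: part_refinements_def length_0_conv[symmetric] simp del: length_0_conv)
  qed (simp add: True part_refinements_def)
next
  case False
  then have "sum_list (take k ws) \<noteq> 0" using sum_list_take_eq_0_iff[OF ws assms(2)] by blast
  then show ?thesis
    using False sum_list_take_eq_iff[OF ws assms(3,2)] zero_in_block_sums[OF ws assms(3)]
    by (simp add: part_refinements_def sum_list_block_sums del: sum_list_eq_0_iff)
qed

lemma refinements_block_sums:
  assumes "\<forall>w\<in>set ws. 0 < w" "sum_list p \<le> length ws" "sum_list r = sum_list p"
  shows "block_sums ws r \<in> refinements (block_sums ws p) \<longleftrightarrow> r \<in> refinements p"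
  using assms
proof (induction ws p arbitrary: r rule: block_sums.induct)
  case (1 ws)
  then show ?case by (auto simp: length_0_conv[symmetric] simp del: length_0_conv)
next
  case (2 ws k p)
  have k: "k \<le> length ws" using 2 by simp
  have ws': "\<forall>w\<in>set (drop k ws). 0 < w" using 2(2) by (rule drop_positive)
  have IH: "block_sums (drop k ws) r' \<in> refinements (block_sums (drop k ws) p) \<longleftrightarrow>
      r' \<in> refinements p" if "sum_list r' = sum_list p" for r'
    using that 2(3) by (intro 2(1)[OF ws']) auto
  show ?case
  proof
    assume "block_sums ws r \<in> refinements (block_sums ws (k # p))"
    then obtain u v where uv: "block_sums ws r = u @ v"
      "u \<in> part_refinements (sum_list (take k ws))" "v \<in> refinements (block_sums (drop k ws) p)"
      by (auto simp: refinements_Cons)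
    from uv(1) obtain r1 r2 where r: "r = r1 @ r2" "block_sums ws r1 = u"
      "block_sums (drop (sum_list r1) ws) r2 = v" by (rule block_sums_eq_appendD)
    have r1: "sum_list r1 \<le> length ws" using r(1) 2(3,4) by simp
    have "sum_list (take (sum_list r1) ws) = sum_list (take k ws)"
      using sum_list_part_refinement[OF uv(2)] by (simp add: r(2)[symmetric] sum_list_block_sums)
    then have k1: "sum_list r1 = k" using sum_list_take_eq_iff[OF 2(2) r1 k] by simp
    then have "r2 \<in> refinements p" using IH[of r2] 2(4) r uv(3) by simp
    moreover have "r1 \<in> part_refinements k"
      using part_refinements_block_sums[OF 2(2) k r1] uv(2) r(2) by simp
    ultimately show "r \<in> refinements (k # p)" unfolding refinements_Cons using r(1) by blast
  next
    assume "r \<in> refinements (k # p)"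
    then obtain r1 r2 where r: "r = r1 @ r2" "r1 \<in> part_refinements k" "r2 \<in> refinements p"
      by (auto simp: refinements_Cons)
    have k1: "sum_list r1 = k" using r(2) by (rule sum_list_part_refinement)
    have "block_sums ws r1 \<in> part_refinements (sum_list (take k ws))"
      using part_refinements_block_sums[OF 2(2) k, of r1] r(2) k1 k by simp
    moreover have "block_sums (drop k ws) r2 \<in> refinements (block_sums (drop k ws) p)"
      using IH[of r2] sum_list_refinement[OF r(3)] r(3) by simp
    ultimately show "block_sums ws r \<in> refinements (block_sums ws (k # p))"
      by (auto simp: refinements_Cons r(1) block_sums_append k1)
  qed
qed

lemma nth_block_sums:
  "i < length p \<Longrightarrow>
    block_sums ws p ! i = sum_list (take (p ! i) (drop (sum_list (take i p)) ws))"
proof (induction ws p arbitrary: i rule: block_sums.induct)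
  case (2 ws k p)
  then show ?case by (cases i) (auto simp: add.commute)
qed simp

lemma map_of_partition_eq_Suc_iff:
  assumes "x \<le> sum_list p" "i < length p"
  shows "map_of_partition p x = Suc i \<longleftrightarrow>
    sum_list (take i p) < x \<and> x \<le> sum_list (take (Suc i) p)"
proof
  have mono: "sum_list (take a p) \<le> sum_list (take b p)" if "a \<le> b" for a b
  proof -
    have "take b p = take a p @ take (b - a) (drop a p)"
      using that by (metis le_add_diff_inverse take_add)
    then show ?thesis by simp
  qed
  {
    assume *: "map_of_partition p x = Suc i"
    have "x \<le> sum_list (take (length p) p)" using assms(1) by simp
    then have "x \<le> sum_list (take (map_of_partition p x) p)"
      unfolding map_of_partition_def by (rule LeastI)
    moreover have "\<not> x \<le> sum_list (take i p)"
      using * not_less_Least[of i "\<lambda>i. x \<le> sum_list (take i p)"]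
      unfolding map_of_partition_def by simp
    ultimately show "sum_list (take i p) < x \<and> x \<le> sum_list (take (Suc i) p)" using * by simp
  next
    assume *: "sum_list (take i p) < x \<and> x \<le> sum_list (take (Suc i) p)"
    show "map_of_partition p x = Suc i" unfolding map_of_partition_def
    proof (rule Least_equality)
      fix j assume "x \<le> sum_list (take j p)"
      then show "Suc i \<le> j" using * mono[of j i] by linarith
    qed (use * in simp)
  }
qed

definition fibre_sizes :: "nat \<Rightarrow> nat \<Rightarrow> (nat \<Rightarrow> nat) \<Rightarrow> nat list"
  where "fibre_sizes m n \<sigma> = map (\<lambda>y. card {x \<in> {1..m}. \<sigma> x = y}) [1..<Suc n]"

lemma length_fibre_sizes [simp]: "length (fibre_sizes m n \<sigma>) = n"
  by (simp add: fibre_sizes_def del: upt_Suc)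

lemma fibre_sizes_positive:
  assumes "ordered_surjection m n \<sigma>"
  shows "\<forall>w\<in>set (fibre_sizes m n \<sigma>). 0 < w"
proof -
  have "{x \<in> {1..m}. \<sigma> x = y} \<noteq> {}" if "y \<in> {1..n}" for y
  proof -
    have "y \<in> \<sigma> ` {1..m}" using assms that by (simp add: ordered_surjection_def)
    then show ?thesis by auto
  qed
  then show ?thesis by (auto simp: fibre_sizes_def card_gt_0_iff simp del: upt_Suc)
qed

lemma pullback_eq_block_sums:
  assumes "ordered_surjection m n \<sigma>" "sum_list \<kappa> = n"
  shows "pullback m \<kappa> \<sigma> = block_sums (fibre_sizes m n \<sigma>) \<kappa>"
proof (rule nth_equalityI)
  show "length (pullback m \<kappa> \<sigma>) = length (block_sums (fibre_sizes m n \<sigma>) \<kappa>)"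
    by (simp add: pullback_def partition_of_map_def del: upt_Suc)
  fix i assume "i < length (pullback m \<kappa> \<sigma>)"
  then have i: "i < length \<kappa>" by (simp add: pullback_def partition_of_map_def del: upt_Suc)
  define S where "S = sum_list (take i \<kappa>)"
  have Suc_S: "sum_list (take (Suc i) \<kappa>) = S + \<kappa> ! i"
    using i by (simp add: take_Suc_conv_app_nth S_def)
  have "sum_list (take (Suc i) \<kappa>) + sum_list (drop (Suc i) \<kappa>) = n"
    using assms(2) by (metis append_take_drop_id sum_list_append)
  then have n: "S + \<kappa> ! i \<le> n" using Suc_S by simp
  have range: "\<sigma> x \<le> sum_list \<kappa>" if "x \<in> {1..m}" for x
    using assms that unfolding ordered_surjection_def by fastforce
  have "pullback m \<kappa> \<sigma> ! i = card {x \<in> {1..m}. map_of_partition \<kappa> (\<sigma> x) = Suc i}"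
    using i by (simp add: pullback_def partition_of_map_def del: upt_Suc)
  also have "{x \<in> {1..m}. map_of_partition \<kappa> (\<sigma> x) = Suc i} =
      (\<Union>y\<in>{S<..S + \<kappa> ! i}. {x \<in> {1..m}. \<sigma> x = y})"
    using map_of_partition_eq_Suc_iff[OF range i] by (auto simp: Suc_S S_def[symmetric])
  also have "card \<dots> = (\<Sum>y\<in>{S<..S + \<kappa> ! i}. card {x \<in> {1..m}. \<sigma> x = y})"
    by (rule card_UN_disjoint) auto
  also have "\<dots> = sum_list (map (\<lambda>y. card {x \<in> {1..m}. \<sigma> x = y}) [Suc S..<Suc (S + \<kappa> ! i)])"
    by (subst sum_set_upt_conv_sum_list_nat[symmetric]) (rule sum.cong, auto simp del: upt_Suc)
  also have "[Suc S..<Suc (S + \<kappa> ! i)] = take (\<kappa> ! i) (drop S [1..<Suc n])"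
    using n by (simp add: take_upt drop_upt del: upt_Suc)
  also have "sum_list (map (\<lambda>y. card {x \<in> {1..m}. \<sigma> x = y}) \<dots>) =
      block_sums (fibre_sizes m n \<sigma>) \<kappa> ! i"
    using i by (simp add: nth_block_sums fibre_sizes_def take_map drop_map S_def del: upt_Suc)
  finally show "pullback m \<kappa> \<sigma> ! i = block_sums (fibre_sizes m n \<sigma>) \<kappa> ! i" .
qed

text \<open>
  The weights of the surjection \<open>{1..a + b + 2} \<rightarrow> {1..a + b + 1}\<close> which only identifies \<open>a + 1\<close>
  and \<open>a + 2\<close>.
\<close>

definition double_weight :: "nat \<Rightarrow> nat \<Rightarrow> nat list"
  where "double_weight a b = replicate a 1 @ 2 # replicate b 1"

lemma length_double_weight [simp]: "length (double_weight a b) = Suc (a + b)"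
  by (simp add: double_weight_def)

lemma double_weight_realised:
  "\<exists>\<sigma>. ordered_surjection (Suc (Suc (a + b))) (Suc (a + b)) \<sigma> \<and>
    fibre_sizes (Suc (Suc (a + b))) (Suc (a + b)) \<sigma> = double_weight a b"
proof (intro exI conjI)
  let ?\<sigma> = "\<lambda>x. if x \<le> Suc a then x else x - 1" and ?m = "Suc (Suc (a + b))"
  have "y \<in> ?\<sigma> ` {1..?m}" if "y \<in> {1..Suc (a + b)}" for y
    using that by (cases "y \<le> Suc a") (auto intro: image_eqI[of _ _ y] image_eqI[of _ _ "Suc y"])
  then have "{1..Suc (a + b)} \<subseteq> ?\<sigma> ` {1..?m}" by blast
  moreover have "?\<sigma> ` {1..?m} \<subseteq> {1..Suc (a + b)}" by auto
  ultimately have "?\<sigma> ` {1..?m} = {1..Suc (a + b)}" by blast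
  moreover have "mono_on {1..?m} ?\<sigma>" by (rule mono_onI) auto
  ultimately show "ordered_surjection ?m (Suc (a + b)) ?\<sigma>"
    unfolding ordered_surjection_def by blast
  show "fibre_sizes ?m (Suc (a + b)) ?\<sigma> = double_weight a b"
  proof (rule nth_equalityI)
    fix i assume "i < length (fibre_sizes ?m (Suc (a + b)) ?\<sigma>)"
    then have i: "i < Suc (a + b)" by simp
    have "{x \<in> {1..?m}. ?\<sigma> x = Suc i} =
        (if i < a then {Suc i} else if i = a then {Suc i, Suc (Suc i)} else {Suc (Suc i)})"
      using i by auto
    then have "card {x \<in> {1..?m}. ?\<sigma> x = Suc i} = (if i = a then 2 else 1)"
      by (simp only: split: if_split) simp
    moreover have "double_weight a b ! i = (if i = a then 2 else 1)"
      using i by (auto simp: double_weight_def nth_append nth_Cons')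
    ultimately show "fibre_sizes ?m (Suc (a + b)) ?\<sigma> ! i = double_weight a b ! i"
      using i by (simp add: fibre_sizes_def del: upt_Suc)
  qed simp
qed

lemma block_sums_ones_append:
  "sum_list p \<le> n \<Longrightarrow> block_sums (replicate n 1 @ ws) p = p"
proof (induction p arbitrary: n)
  case (Cons k p)
  then show ?case by (simp add: sum_list_replicate min_def)
qed simp

text \<open>The doubled weight lies in the block of \<open>k\<close>, so that this part grows by one.\<close>

lemma block_sums_double_weight:
  assumes "sum_list p1 \<le> a" "a < sum_list p1 + k" "sum_list p1 + k + sum_list p2 = Suc (a + b)"
  shows "block_sums (double_weight a b) (p1 @ k # p2) = p1 @ Suc k # p2"
proof -
  define c where "c = a - sum_list p1"
  have a: "a = sum_list p1 + c" "c < k" using assms by (auto simp: c_def)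
  have 1: "block_sums (double_weight a b) p1 = p1"
    unfolding double_weight_def using assms(1) by (rule block_sums_ones_append)
  have 2: "drop (sum_list p1) (double_weight a b) = replicate c 1 @ 2 # replicate b 1"
    by (simp add: double_weight_def a)
  have 3: "take k (replicate c 1 @ 2 # replicate b 1) =
      replicate c 1 @ 2 # replicate (k - Suc c) (1::nat)"
  proof -
    have "k - Suc c \<le> b" using a(2) assms(3) by (simp add: a(1))
    then show ?thesis using a(2) by (simp add: take_Cons' min_def)
  qed
  have 4: "drop k (replicate c 1 @ 2 # replicate b 1) = replicate (Suc (b + c) - k) (1::nat)"
    using a(2) by (simp add: drop_Cons')
  have 5: "block_sums (replicate (Suc (b + c) - k) 1) p2 = p2"
    by (rule block_sums_ones_append[where ws = "[]", unfolded append_Nil2]) (use assms(3) a in simp)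
  show ?thesis using a(2)
    by (simp only: block_sums_append 1 2 3 4 5 block_sums.simps)
      (simp add: sum_list_replicate)
qed

text \<open>
  A refinement with a part \<open>k \<ge> 2\<close> comes from a partition of a number which is smaller by one:
  lower by one this part, and the part of \<open>p\<close> in which it lies.
\<close>

lemma refinement_lower_part:
  assumes "r1 @ k # r2 \<in> refinements p" "k \<ge> 2"
  shows "\<exists>p1 l p2. p = p1 @ l # p2 \<and> sum_list p1 \<le> sum_list r1 \<and>
    sum_list r1 + k \<le> sum_list p1 + l \<and> r1 @ (k - 1) # r2 \<in> refinements (p1 @ (l - 1) # p2)"
  using assms(1)
proof (induction p arbitrary: r1)
  case (Cons l p)
  then obtain u v where uv: "r1 @ k # r2 = u @ v" "u \<in> part_refinements l" "v \<in> refinements p"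
    by (auto simp: refinements_Cons)
  then consider u' where "u = r1 @ k # u'" "r2 = u' @ v" | r' where "r1 = u @ r'" "v = r' @ k # r2"
    by (auto simp: append_Cons_eq_append_iff)
  then show ?case
  proof cases
    case 1
    have "l \<noteq> 0"
    proof
      assume "l = 0"
      with 1 uv(2) assms(2) show False by (cases r1) (auto simp: part_refinements_def)
    qed
    with 1 have "r1 @ (k - 1) # u' \<in> part_refinements (l - 1)"
      using uv(2) assms(2) by (auto simp: part_refinements_def)
    then have "r1 @ (k - 1) # r2 \<in> refinements ((l - 1) # p)"
      unfolding refinements_Cons using 1 uv(3) by (intro exI[of _ "r1 @ (k - 1) # u'"] exI[of _ v]) simp
    moreover have "sum_list r1 + k \<le> l" using sum_list_part_refinement[OF uv(2)] 1 by simp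
    ultimately show ?thesis by (intro exI[of _ "[]"] exI[of _ l] exI[of _ p]) simp
  next
    case 2
    with Cons.IH[of r'] uv(3) obtain p1 m p2 where *: "p = p1 @ m # p2"
      "sum_list p1 \<le> sum_list r'" "sum_list r' + k \<le> sum_list p1 + m"
      "r' @ (k - 1) # r2 \<in> refinements (p1 @ (m - 1) # p2)" by auto
    have "r1 @ (k - 1) # r2 \<in> refinements (l # p1 @ (m - 1) # p2)"
      unfolding refinements_Cons using * 2 uv(2)
      by (intro exI[of _ u] exI[of _ "r' @ (k - 1) # r2"]) simp
    then show ?thesis using * 2 sum_list_part_refinement[OF uv(2)]
      by (intro exI[of _ "l # p1"] exI[of _ m] exI[of _ p2]) simp
  qed
qed simp


section \<open>The splitting provided by formal smoothness\<close>

lemma multilinear_1_iff: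
  "multilinear s t 1 F \<longleftrightarrow> Vector_Spaces.linear s t (\<lambda>x. F [x])"
  by (auto simp: multilinear_append_iff)

lemma multilinear_2_iff:
  "multilinear s t 2 F \<longleftrightarrow> (\<forall>b. Vector_Spaces.linear s t (\<lambda>x. F [x, b])) \<and>
    (\<forall>a. Vector_Spaces.linear s t (\<lambda>x. F [a, x]))"
proof
  assume F: "multilinear s t 2 F"
  show "(\<forall>b. Vector_Spaces.linear s t (\<lambda>x. F [x, b])) \<and>
    (\<forall>a. Vector_Spaces.linear s t (\<lambda>x. F [a, x]))"
    using multilinearD[OF F, of "[]" "[_]"] multilinearD[OF F, of "[_]" "[]"] by simp
next
  assume *: "(\<forall>b. Vector_Spaces.linear s t (\<lambda>x. F [x, b])) \<and>
    (\<forall>a. Vector_Spaces.linear s t (\<lambda>x. F [a, x]))"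
  show "multilinear s t 2 F"
  proof (rule multilinearI)
    fix xs ys :: "'b list" assume "Suc (length xs + length ys) = 2"
    then consider b where "xs = []" "ys = [b]" | a where "xs = [a]" "ys = []"
      by (cases xs; cases ys) auto
    then show "Vector_Spaces.linear s t (\<lambda>x. F (xs @ x # ys))" by cases (use * in auto)
  qed
qed

lemma multilinear_3_iff:
  "multilinear s t 3 F \<longleftrightarrow> (\<forall>b c. Vector_Spaces.linear s t (\<lambda>x. F [x, b, c])) \<and>
    (\<forall>a c. Vector_Spaces.linear s t (\<lambda>x. F [a, x, c])) \<and>
    (\<forall>a b. Vector_Spaces.linear s t (\<lambda>x. F [a, b, x]))"
proof
  assume F: "multilinear s t 3 F"
  show "(\<forall>b c. Vector_Spaces.linear s t (\<lambda>x. F [x, b, c])) \<and>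
    (\<forall>a c. Vector_Spaces.linear s t (\<lambda>x. F [a, x, c])) \<and>
    (\<forall>a b. Vector_Spaces.linear s t (\<lambda>x. F [a, b, x]))"
    using multilinearD[OF F, of "[]" "[_, _]"] multilinearD[OF F, of "[_]" "[_]"]
      multilinearD[OF F, of "[_, _]" "[]"] by simp
next
  assume *: "(\<forall>b c. Vector_Spaces.linear s t (\<lambda>x. F [x, b, c])) \<and>
    (\<forall>a c. Vector_Spaces.linear s t (\<lambda>x. F [a, x, c])) \<and>
    (\<forall>a b. Vector_Spaces.linear s t (\<lambda>x. F [a, b, x]))"
  show "multilinear s t 3 F"
  proof (rule multilinearI)
    fix xs ys :: "'b list" assume l: "Suc (length xs + length ys) = 3"
    then consider "length xs = 0" "length ys = 2" | "length xs = 1" "length ys = 1"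
      | "length xs = 2" "length ys = 0" by linarith
    then show "Vector_Spaces.linear s t (\<lambda>x. F (xs @ x # ys))"
      by cases (use * in \<open>auto simp: length_Suc_conv numeral_2_eq_2\<close>)
  qed
qed

lemma length_2_iff: "length xs = 2 \<longleftrightarrow> (\<exists>a b. xs = [a, b])"
  by (auto simp: length_Suc_conv numeral_2_eq_2)

lemma length_3_iff: "length xs = 3 \<longleftrightarrow> (\<exists>a b c. xs = [a, b, c])"
  by (auto simp: length_Suc_conv numeral_3_eq_3)

lemma multilinear_contract:
  assumes "vector_space s" "\<xi> \<in> tensor_power r e"
    and "\<And>us. length us = d \<Longrightarrow> multilinear r tscale e (F us)"
    and "\<And>ss. length ss = e \<Longrightarrow> multilinear s tscale d (\<lambda>us. F us ss)"
  shows "multilinear s tscale d (\<lambda>us. contract \<xi> (F us))"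
proof (rule multilinearI)
  fix xs ys :: "'b list" assume l: "Suc (length xs + length ys) = d"
  show "Vector_Spaces.linear s tscale (\<lambda>x. contract \<xi> (F (xs @ x # ys)))"
  proof (rule linear_contract_parameter[OF assms(2,1)])
    show "multilinear r tscale e (F (xs @ x # ys))" for x using l by (intro assms(3)) simp
    show "Vector_Spaces.linear s tscale (\<lambda>x. F (xs @ x # ys) ss)" if "length ss = e" for ss
      by (rule multilinearD[OF assms(4)[OF that] l])
  qed
qed

lemma contract_linear_twice:
  assumes "vector_space s" "\<alpha> \<in> tensor_power s d" "\<xi> \<in> tensor_power r e" "tensor_linear L"
    and "\<And>us. length us = d \<Longrightarrow> multilinear r tscale e (F us)"
    and "\<And>ss. length ss = e \<Longrightarrow> multilinear s tscale d (\<lambda>us. F us ss)"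
  shows "L (contract \<alpha> (\<lambda>us. contract \<xi> (F us))) = contract \<alpha> (\<lambda>us. contract \<xi> (\<lambda>ss. L (F us ss)))"
proof -
  have "L (contract \<alpha> (\<lambda>us. contract \<xi> (F us))) = contract \<alpha> (\<lambda>us. L (contract \<xi> (F us)))"
    by (rule contract_linear[OF assms(2) multilinear_contract[OF assms(1,3,5,6)] assms(4)])
  also have "\<dots> = contract \<alpha> (\<lambda>us. contract \<xi> (\<lambda>ss. L (F us ss)))"
    by (intro contract_cong[OF assms(2)] contract_linear[OF assms(3) _ assms(4)] assms(5))
  finally show ?thesis .
qed

context k_algebra
begin

lemma linear_pure_tensor:
  "Vector_Spaces.linear scale tscale (\<lambda>x. pure_tensor scale (xs @ x # ys))"
  by (rule multilinearD[OF multilinear_pure_tensor[OF vector_space_axioms] refl])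

lemma linear_pure_entry:
  assumes "Vector_Spaces.linear scale scale h"
  shows "Vector_Spaces.linear scale tscale (\<lambda>x. pure_tensor scale (h x # ys))"
    "Vector_Spaces.linear scale tscale (\<lambda>x. pure_tensor scale (a # h x # ys))"
    "Vector_Spaces.linear scale tscale (\<lambda>x. pure_tensor scale (a # b # h x # ys))"
  using linear_compose_field[OF assms linear_pure_tensor, of "[]" ys]
    linear_compose_field[OF assms linear_pure_tensor, of "[a]" ys]
    linear_compose_field[OF assms linear_pure_tensor, of "[a, b]" ys] by simp_all

lemmas linear_entries = linear_pure_entry[OF linear_ident]
  linear_pure_entry[OF linear_mult_left] linear_pure_entry[OF linear_mult_right]

lemma env_mult_eq_contract:
  assumes "\<alpha> \<in> tensor_power scale 2" "\<xi> \<in> tensor_power scale 2"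
  shows "env_mult scale \<alpha> \<xi> =
    contract \<alpha> (\<lambda>us. contract \<xi> (\<lambda>ss. pure_tensor scale [us ! 0 * ss ! 0, ss ! 1 * us ! 1]))"
  using tensor_power_apply_zero[OF assms(1)] tensor_power_apply_zero[OF assms(2)]
  by (auto simp: env_mult_def contract_def pure_tensor_def fun_eq_iff numeral_2_eq_2)

lemma env_mult_in:
  assumes "\<alpha> \<in> tensor_power scale 2" "\<xi> \<in> tensor_power scale 2"
  shows "env_mult scale \<alpha> \<xi> \<in> tensor_power scale 2"
  unfolding env_mult_eq_contract[OF assms]
  by (intro contract_in_tensor_power[OF assms(1)] contract_in_tensor_power[OF assms(2)]
      multilinear_contract[OF vector_space_axioms assms(2)])
    (auto simp: multilinear_2_iff linear_entries mult.assoc intro!: tensor_power_pure)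

lemma env_mult_pure_left:
  assumes "\<xi> \<in> tensor_power scale 2"
  shows "env_mult scale (pure_tensor scale [a, b]) \<xi> =
    contract \<xi> (\<lambda>ss. pure_tensor scale [a * ss ! 0, ss ! 1 * b])"
proof -
  have ab: "pure_tensor scale [a, b] \<in> tensor_power scale 2" by (rule tensor_power_pure) simp
  show ?thesis
    unfolding env_mult_eq_contract[OF ab assms]
    using multilinear_contract[OF vector_space_axioms assms, of 2
        "\<lambda>us ss. pure_tensor scale [us ! 0 * ss ! 0, ss ! 1 * us ! 1]"]
    by (subst contract_pure) (simp_all add: multilinear_2_iff linear_entries flip: numeral_2_eq_2)
qed

lemma env_mult_one_right:
  assumes "\<alpha> \<in> tensor_power scale 2"
  shows "env_mult scale \<alpha> (pure_tensor scale [1, 1]) = \<alpha>"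
proof -
  have one: "pure_tensor scale [1, 1] \<in> tensor_power scale 2" by (rule tensor_power_pure) simp
  have "env_mult scale \<alpha> (pure_tensor scale [1, 1]) =
      contract \<alpha> (\<lambda>us. pure_tensor scale [us ! 0, us ! 1])"
    unfolding env_mult_eq_contract[OF assms one]
    by (rule contract_cong[OF assms], subst contract_pure)
      (auto simp: multilinear_2_iff linear_entries simp flip: numeral_2_eq_2)
  also have "\<dots> = \<alpha>"
    by (rule linear_eq_on_tensor_power[OF assms linear_contract],
        rule linear_intro[OF vector_space_tscale vector_space_tscale refl refl], subst contract_pure)
      (auto simp: length_2_iff multilinear_2_iff linear_entries simp flip: numeral_2_eq_2)
  finally show ?thesis .
qed

text \<open>
  The map \<open>(u \<otimes> v) \<otimes> (s \<otimes> t) \<mapsto> u s \<otimes> t \<otimes> v\<close>.  The product of the last two factors on the right is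
  the action of \<open>A \<otimes> A\<^sup>o\<^sup>p\<close> on \<open>A \<otimes> A\<close>, which is thus lifted to \<open>A \<otimes> A \<otimes> A\<close>.
\<close>

definition sandwich :: "('k, 'a) tensor \<Rightarrow> ('k, 'a) tensor \<Rightarrow> ('k, 'a) tensor"
  where "sandwich \<alpha> \<xi> =
    contract \<alpha> (\<lambda>us. contract \<xi> (\<lambda>ss. pure_tensor scale [us ! 0 * ss ! 0, ss ! 1, us ! 1]))"

lemma sandwich_multilinear:
  "length us = 2 \<Longrightarrow>
    multilinear scale tscale 2 (\<lambda>ss. pure_tensor scale [us ! 0 * ss ! 0, ss ! 1, us ! 1])"
  "length ss = 2 \<Longrightarrow>
    multilinear scale tscale 2 (\<lambda>us. pure_tensor scale [us ! 0 * ss ! 0, ss ! 1, us ! 1])"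
  by (simp_all add: multilinear_2_iff linear_entries)

lemma sandwich_in:
  assumes "\<alpha> \<in> tensor_power scale 2" "\<xi> \<in> tensor_power scale 2"
  shows "sandwich \<alpha> \<xi> \<in> tensor_power scale 3"
  unfolding sandwich_def
  by (intro contract_in_tensor_power[OF assms(1)] contract_in_tensor_power[OF assms(2)]
      multilinear_contract[OF vector_space_axioms assms(2)] sandwich_multilinear tensor_power_pure)
    simp_all

lemma sandwich_linear:
  assumes "\<alpha> \<in> tensor_power scale 2" "\<xi> \<in> tensor_power scale 2" "tensor_linear L"
  shows "L (sandwich \<alpha> \<xi>) =
    contract \<alpha> (\<lambda>us. contract \<xi> (\<lambda>ss. L (pure_tensor scale [us ! 0 * ss ! 0, ss ! 1, us ! 1])))"
  unfolding sandwich_def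
  by (intro contract_linear_twice[OF vector_space_axioms assms] sandwich_multilinear)

lemma sandwich_env_mult:
  assumes "\<alpha> \<in> tensor_power scale 2" "\<xi> \<in> tensor_power scale 2"
  shows "sandwich (env_mult scale (pure_tensor scale [a, b]) \<alpha>) \<xi> =
    contract \<alpha> (\<lambda>us. contract \<xi> (\<lambda>ss. pure_tensor scale [a * us ! 0 * ss ! 0, ss ! 1, us ! 1 * b]))"
proof -
  let ?L = "\<lambda>\<theta>. sandwich \<theta> \<xi>"
  have "tensor_linear ?L" unfolding sandwich_def by (rule linear_contract)
  then have "?L (env_mult scale (pure_tensor scale [a, b]) \<alpha>) =
      contract \<alpha> (\<lambda>us. ?L (pure_tensor scale [a * us ! 0, us ! 1 * b]))"
    unfolding env_mult_pure_left[OF assms(1)]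
    by (intro contract_linear[OF assms(1)]) (simp_all add: multilinear_2_iff linear_entries)
  moreover have "?L (pure_tensor scale [u, v]) =
      contract \<xi> (\<lambda>ss. pure_tensor scale [u * ss ! 0, ss ! 1, v])" for u v
    unfolding sandwich_def
    using multilinear_contract[OF vector_space_axioms assms(2) sandwich_multilinear]
    by (subst contract_pure) (simp_all flip: numeral_2_eq_2)
  ultimately show ?thesis by simp
qed

lemma lmult_sandwich:
  assumes "\<alpha> \<in> tensor_power scale 2" "\<xi> \<in> tensor_power scale 2"
  shows "lmult scale 3 0 a (sandwich \<alpha> \<xi>) =
    sandwich (env_mult scale (pure_tensor scale [a, 1]) \<alpha>) \<xi>"
  unfolding sandwich_env_mult[OF assms] sandwich_linear[OF assms tensor_linear_lmult]
  by (simp add: lmult_pure mult.assoc)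

lemma rmult_sandwich:
  assumes "\<alpha> \<in> tensor_power scale 2" "\<xi> \<in> tensor_power scale 2"
  shows "rmult scale 3 2 b (sandwich \<alpha> \<xi>) =
    sandwich (env_mult scale (pure_tensor scale [1, b]) \<alpha>) \<xi>"
  unfolding sandwich_env_mult[OF assms] sandwich_linear[OF assms tensor_linear_rmult]
  by (simp add: rmult_pure numeral_2_eq_2)

lemma merge_right_sandwich:
  assumes "\<alpha> \<in> tensor_power scale 2" "\<xi> \<in> tensor_power scale 2"
  shows "merge scale 2 1 (sandwich \<alpha> \<xi>) = env_mult scale \<alpha> \<xi>"
  unfolding env_mult_eq_contract[OF assms] sandwich_linear[OF assms tensor_linear_merge]
  by (simp add: merge_pure)

lemma merge_left_sandwich:
  assumes "\<alpha> \<in> tensor_power scale 2" "\<xi> \<in> tensor_power scale 2" "merge scale 1 0 \<xi> = 0"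
  shows "merge scale 2 0 (sandwich \<alpha> \<xi>) = 0"
proof -
  have "contract \<xi> (\<lambda>ss. merge scale 2 0 (pure_tensor scale [u * ss ! 0, ss ! 1, v])) = 0" for u v
  proof -
    have "contract \<xi> (\<lambda>ss. merge scale 2 0 (pure_tensor scale [u * ss ! 0, ss ! 1, v])) =
        contract \<xi> (\<lambda>ss. pure_tensor scale [u * (ss ! 0 * ss ! 1), v])"
      by (simp add: merge_pure mult.assoc)
    also have "\<dots> = contract (merge scale 1 0 \<xi>) (\<lambda>ms. pure_tensor scale [u * ms ! 0, v])"
      unfolding merge_def
      by (subst contract_tensor_map) (simp_all add: multilinear_1_iff[simplified] linear_entries)
    finally show ?thesis by (simp only: assms(3) contract_zero_left)
  qed
  then have "merge scale 2 0 (sandwich \<alpha> \<xi>) = contract \<alpha> (\<lambda>us. 0)"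
    unfolding sandwich_linear[OF assms(1,2) tensor_linear_merge] by presburger
  also have "\<dots> = 0" using tensor_power_apply_zero[OF assms(1)] by (simp add: contract_def fun_eq_iff)
  finally show ?thesis .
qed

lemma sandwich_zero: "sandwich 0 \<xi> = 0"
  and sandwich_add: "sandwich (\<alpha> + \<beta>) \<xi> = sandwich \<alpha> \<xi> + sandwich \<beta> \<xi>"
  and sandwich_scale: "sandwich (tscale c \<alpha>) \<xi> = tscale c (sandwich \<alpha> \<xi>)"
  by (simp_all only: sandwich_def contract_zero_left contract_add_left contract_scale_left)

text \<open>
  A section of the bimodule map \<open>\<Omega>\<^sup>1 \<otimes> A \<rightarrow> \<Omega>\<^sup>1\<close>, \<open>\<omega> \<otimes> v \<mapsto> \<omega> v\<close>, takes the universal derivation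
  \<open>d a = 1 \<otimes> a - a \<otimes> 1\<close> to a derivation into \<open>\<Omega>\<^sup>1 \<otimes> A\<close>, which is the kernel of the product of the
  first two factors on \<open>A \<otimes> A \<otimes> A\<close>.  The last two conditions say that \<open>\<Theta> a = \<Sum> w \<otimes> t \<otimes> v\<close> with
  \<open>\<Sum> w \<otimes> t v = d a\<close> and \<open>\<Sum> w t \<otimes> v = 0\<close>, hence \<open>\<Sum> w d t v = d a\<close>.
\<close>

definition splitting_derivation :: "('a \<Rightarrow> ('k, 'a) tensor) \<Rightarrow> bool"
  where "splitting_derivation \<Theta> \<longleftrightarrow>
    (\<forall>a. \<Theta> a \<in> tensor_power scale 3) \<and>
    Vector_Spaces.linear scale tscale \<Theta> \<and>
    (\<forall>x y. \<Theta> (x * y) = lmult scale 3 0 x (\<Theta> y) + rmult scale 3 2 y (\<Theta> x)) \<and>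
    (\<forall>a. merge scale 2 1 (\<Theta> a) = pure_tensor scale [1, a] - pure_tensor scale [a, 1]) \<and>
    (\<forall>a. merge scale 2 0 (\<Theta> a) = 0)"

lemma free_module_zero: "0 \<in> free_module (tensor_power scale 2) X"
  and free_module_add: "v \<in> free_module (tensor_power scale 2) X \<Longrightarrow>
    w \<in> free_module (tensor_power scale 2) X \<Longrightarrow> v + w \<in> free_module (tensor_power scale 2) X"
proof -
  show "0 \<in> free_module (tensor_power scale 2) X"
    by (simp add: free_module_def tensor_power_zero)
  assume v: "v \<in> free_module (tensor_power scale 2) X"
    and w: "w \<in> free_module (tensor_power scale 2) X"
  have "{x. (v + w) x \<noteq> 0} \<subseteq> {x. v x \<noteq> 0} \<union> {x. w x \<noteq> 0}" by auto
  moreover have "finite ({x. v x \<noteq> 0} \<union> {x. w x \<noteq> 0})"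
    using v w by (simp add: free_module_def)
  moreover have "(v + w) x \<in> tensor_power scale 2" for x
    unfolding plus_fun_apply[of v w] using v w
    by (intro tensor_power_add) (simp_all add: free_module_def)
  ultimately show "v + w \<in> free_module (tensor_power scale 2) X"
    using v w unfolding free_module_def by (auto dest: finite_subset)
qed

text \<open>
  A projective module has a dual basis: \<open>d a = \<Sum>\<^sub>x v\<^sub>x(a) g\<^sub>x\<close> with \<open>g\<^sub>x \<in> \<Omega>\<^sup>1\<close> and coordinates
  \<open>v\<^sub>x(a) \<in> A \<otimes> A\<^sup>o\<^sup>p\<close>, which are derivations of \<open>a\<close> as \<open>d\<close> is one.  Replacing each product by
  \<open>sandwich\<close> lifts this expression.
\<close>

theorem formally_smooth_splitting_derivation:
  assumes "formally_smooth scale"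
  shows "\<exists>\<Theta>. splitting_derivation \<Theta>"
proof -
  let ?R = "tensor_power scale 2" and ?mul = "env_mult scale"
  from assms obtain X i p where
    i: "module_map_on ?R ?mul (\<lambda>r v x. ?mul r (v x)) (Omega1 scale)
      (free_module ?R (X :: ('k, 'a) tensor set)) i" and
    p: "module_map_on ?R (\<lambda>r v x. ?mul r (v x)) ?mul (free_module ?R X) (Omega1 scale) p" and
    pi: "\<forall>m\<in>Omega1 scale. p (i m) = m"
    unfolding formally_smooth_def projective_def by blast
  define d where "d a = pure_tensor scale [1, a] - pure_tensor scale [a, 1]" for a
  have pure2: "pure_tensor scale [a, b] \<in> ?R" for a b by (rule tensor_power_pure) simp
  have dR: "d a \<in> ?R" for a unfolding d_def by (intro tensor_power_diff pure2)
  have d\<Omega>: "d a \<in> Omega1 scale" for a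
  proof -
    have "merge scale 1 0 (d a) = 0"
      unfolding d_def linear_diffD[OF tensor_linear_merge] by (simp add: merge_pure)
    then show ?thesis using dR[of a] by (simp add: Omega1_def)
  qed
  have d_add: "d (a + b) = d a + d b" for a b
    unfolding d_def linear_addD[OF linear_entries(1)] linear_addD[OF linear_entries(2)] by simp
  have d_scale: "d (scale c a) = tscale c (d a)" for c a
    unfolding d_def linear_scaleD[OF linear_entries(1)] linear_scaleD[OF linear_entries(2)]
    by (simp add: tscale_def fun_eq_iff algebra_simps)
  have mul_diff: "?mul (pure_tensor scale [a, b]) (S - T) =
      ?mul (pure_tensor scale [a, b]) S - ?mul (pure_tensor scale [a, b]) T"
    if "S \<in> ?R" "T \<in> ?R" for a b S T
    using that by (simp only: env_mult_pure_left tensor_power_diff contract_diff_left)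
  have d_mult: "d (a * b) = ?mul (pure_tensor scale [a, 1]) (d b) + ?mul (pure_tensor scale [1, b]) (d a)"
    for a b
    unfolding d_def by (simp add: mul_diff pure2 env_mult_pure)
  have mul_scalar: "?mul (pure_tensor scale [scale c 1, 1]) T = tscale c T" if "T \<in> ?R" for c T
  proof -
    have "pure_tensor scale [scale c 1, 1] = tscale c (pure_tensor scale [1, 1])"
      by (rule linear_scaleD[OF linear_entries(1)])
    then have "?mul (pure_tensor scale [scale c 1, 1]) T = tscale c (?mul (pure_tensor scale [1, 1]) T)"
      using that by (simp only: env_mult_eq_contract tensor_power_scale pure2 contract_scale_left)
    also have "?mul (pure_tensor scale [1, 1]) T = contract T (\<lambda>us. pure_tensor scale [us ! 0, us ! 1])"
      using that by (simp add: env_mult_pure_left)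
    also have "\<dots> = ?mul T (pure_tensor scale [1, 1])"
      unfolding env_mult_eq_contract[OF that pure2]
      by (rule contract_cong[OF that], subst contract_pure)
        (auto simp: multilinear_2_iff linear_entries simp flip: numeral_2_eq_2)
    finally show ?thesis by (simp only: env_mult_one_right[OF that])
  qed
  have mul_zero: "?mul r 0 = 0" if "r \<in> ?R" for r
    using tensor_power_apply_zero[OF that]
    by (simp only: env_mult_eq_contract[OF that tensor_power_zero] contract_zero_left)
      (simp add: contract_def fun_eq_iff)

  \<comment> \<open>the dual basis: \<open>v\<close> are the coordinates in the free module, \<open>g\<close> the images of its basis \<open>e\<close>\<close>
  define v where "v a = i (d a)" for a
  define e where "e x = (\<lambda>y. if y = x then pure_tensor scale [1, 1] else 0)" for x :: "('k, 'a) tensor"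
  define g where "g x = p (e x)" for x
  have vF: "v a \<in> free_module ?R X" for a
    using i d\<Omega>[of a] unfolding v_def module_map_on_def by blast
  have vR: "v a x \<in> ?R" for a x using vF[of a] by (simp add: free_module_def)
  have v_fin: "finite {x. v a x \<noteq> 0}" and v_supp: "{x. v a x \<noteq> 0} \<subseteq> X" for a
    using vF[of a] by (auto simp: free_module_def)
  have eF: "e x \<in> free_module ?R X" if "x \<in> X" for x
    using that pure2 tensor_power_zero by (auto simp: free_module_def e_def)
  have g\<Omega>: "g x \<in> Omega1 scale" if "x \<in> X" for x
    using p eF[OF that] unfolding g_def module_map_on_def by blast
  have gR: "g x \<in> ?R" and g0: "merge scale 1 0 (g x) = 0" if "x \<in> X" for x
    using g\<Omega>[OF that] by (auto simp: Omega1_def)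
  have i_add: "i (S + T) = i S + i T" if "S \<in> Omega1 scale" "T \<in> Omega1 scale" for S T
    using i that unfolding module_map_on_def by blast
  have i_mul: "i (?mul r S) = (\<lambda>x. ?mul r (i S x))" if "r \<in> ?R" "S \<in> Omega1 scale" for r S
    using i that unfolding module_map_on_def by blast
  have \<Omega>_mul: "?mul r S \<in> Omega1 scale" if "S = d a" "r = pure_tensor scale [x, 1] \<or> r = pure_tensor scale [1, x]"
    for r S a x
  proof -
    have "merge scale 1 0 (?mul r S) = 0"
      using that by (auto simp: d_def mul_diff pure2 env_mult_pure linear_diffD[OF tensor_linear_merge]
          merge_pure mult.assoc)
    moreover have "?mul r S \<in> ?R" using that dR pure2 by (auto intro: env_mult_in)
    ultimately show ?thesis by (simp add: Omega1_def)
  qed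
  have v_add: "v (a + b) x = v a x + v b x" for a b x
    unfolding v_def d_add i_add[OF d\<Omega> d\<Omega>] by simp
  have v_scale: "v (scale c a) x = tscale c (v a x)" for c a x
  proof -
    have "v (scale c a) = (\<lambda>x. ?mul (pure_tensor scale [scale c 1, 1]) (v a x))"
      unfolding v_def d_scale mul_scalar[OF dR, symmetric] by (rule i_mul[OF pure2 d\<Omega>])
    then show ?thesis by (simp only: mul_scalar[OF vR])
  qed
  have v_mult: "v (a * b) x = ?mul (pure_tensor scale [a, 1]) (v b x) +
      ?mul (pure_tensor scale [1, b]) (v a x)" for a b x
    unfolding v_def d_mult
    by (subst i_add) (auto intro: \<Omega>_mul simp: i_mul[OF pure2 d\<Omega>])

  define \<Theta> where "\<Theta> a = (\<Sum>x | v a x \<noteq> 0. sandwich (v a x) (g x))" for a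
  have \<Theta>_sum: "\<Theta> a = (\<Sum>x\<in>S. sandwich (v a x) (g x))"
    if "finite S" "{x. v a x \<noteq> 0} \<subseteq> S" for a S
    unfolding \<Theta>_def by (rule sum.mono_neutral_left[OF that]) (simp add: sandwich_zero)
  have in3: "\<Theta> a \<in> tensor_power scale 3" for a
    unfolding \<Theta>_def using v_supp by (intro tensor_power_sum sandwich_in vR gR) blast
  have lin: "Vector_Spaces.linear scale tscale \<Theta>"
  proof (rule linear_intro[OF vector_space_axioms vector_space_tscale])
    fix a b
    let ?S = "{x. v a x \<noteq> 0} \<union> {x. v b x \<noteq> 0} \<union> {x. v (a + b) x \<noteq> 0}"
    have fin: "finite ?S" using v_fin by simp
    have "\<Theta> (a + b) = (\<Sum>x\<in>?S. sandwich (v (a + b) x) (g x))" by (rule \<Theta>_sum[OF fin]) blast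
    also have "\<dots> = (\<Sum>x\<in>?S. sandwich (v a x) (g x)) + (\<Sum>x\<in>?S. sandwich (v b x) (g x))"
      unfolding v_add sandwich_add by (rule sum.distrib)
    also have "\<dots> = \<Theta> a + \<Theta> b"
      by (subst (1 2) \<Theta>_sum[OF fin]) auto
    finally show "\<Theta> (a + b) = \<Theta> a + \<Theta> b" .
  next
    fix c a
    let ?S = "{x. v a x \<noteq> 0} \<union> {x. v (scale c a) x \<noteq> 0}"
    have fin: "finite ?S" using v_fin by simp
    have "\<Theta> (scale c a) = (\<Sum>x\<in>?S. sandwich (v (scale c a) x) (g x))" by (rule \<Theta>_sum[OF fin]) blast
    also have "\<dots> = (\<Sum>x\<in>?S. tscale c (sandwich (v a x) (g x)))"
      unfolding v_scale sandwich_scale ..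
    also have "\<dots> = tscale c (\<Sum>x\<in>?S. sandwich (v a x) (g x))"
      by (simp add: tscale_def fun_eq_iff sum_fun_apply sum_distrib_left)
    also have "\<dots> = tscale c (\<Theta> a)" using \<Theta>_sum[OF fin, of a] by simp
    finally show "\<Theta> (scale c a) = tscale c (\<Theta> a)" .
  qed
  have mult: "\<Theta> (a * b) = lmult scale 3 0 a (\<Theta> b) + rmult scale 3 2 b (\<Theta> a)" for a b
  proof -
    let ?S = "{x. v a x \<noteq> 0} \<union> {x. v b x \<noteq> 0} \<union> {x. v (a * b) x \<noteq> 0}"
    have fin: "finite ?S" using v_fin by simp
    have S: "x \<in> X" if "x \<in> ?S" for x using that v_supp by blast
    have "\<Theta> (a * b) = (\<Sum>x\<in>?S. sandwich (v (a * b) x) (g x))" by (rule \<Theta>_sum[OF fin]) blast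
    also have "\<dots> = (\<Sum>x\<in>?S. lmult scale 3 0 a (sandwich (v b x) (g x)) +
        rmult scale 3 2 b (sandwich (v a x) (g x)))"
      by (rule sum.cong[OF refl]) (simp only: v_mult sandwich_add lmult_sandwich[OF vR gR[OF S]]
          rmult_sandwich[OF vR gR[OF S]])
    also have "\<dots> = lmult scale 3 0 a (\<Sum>x\<in>?S. sandwich (v b x) (g x)) +
        rmult scale 3 2 b (\<Sum>x\<in>?S. sandwich (v a x) (g x))"
      by (simp only: sum.distrib linear_sumD[OF tensor_linear_lmult] linear_sumD[OF tensor_linear_rmult])
    also have "\<dots> = lmult scale 3 0 a (\<Theta> b) + rmult scale 3 2 b (\<Theta> a)"
      by (subst (1 2) \<Theta>_sum[OF fin]) auto
    finally show ?thesis .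
  qed
  have right: "merge scale 2 1 (\<Theta> a) = d a" for a
  proof -
    let ?S = "{x. v a x \<noteq> 0}"
    let ?h = "\<lambda>x y. ?mul (v a x) (e x y)"
    have h: "?h x y = (if y = x then v a x else 0)" for x y
      by (simp add: e_def env_mult_one_right[OF vR] mul_zero[OF vR])
    have hF: "?h x \<in> free_module ?R X" if "x \<in> ?S" for x
      using that v_supp[of a] vR[of a] tensor_power_zero by (auto simp: h free_module_def)
    have "p (\<Sum>x\<in>T. ?h x) = (\<Sum>x\<in>T. ?mul (v a x) (g x)) \<and> (\<Sum>x\<in>T. ?h x) \<in> free_module ?R X"
      if "finite T" "T \<subseteq> ?S" for T
      using that
    proof (induction T)
      case empty
      have "p (0 + 0) = p 0 + p 0" using p free_module_zero unfolding module_map_on_def by blast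
      then have "p 0 = 0" by simp
      then show ?case by (simp only: sum.empty free_module_zero simp_thms)
    next
      case (insert x T)
      then have x: "x \<in> ?S" and IH: "p (\<Sum>x\<in>T. ?h x) = (\<Sum>x\<in>T. ?mul (v a x) (g x))"
        "(\<Sum>x\<in>T. ?h x) \<in> free_module ?R X" by auto
      have "x \<in> X" using x v_supp by blast
      then have "p (?h x) = ?mul (v a x) (g x)"
        using p vR eF unfolding module_map_on_def g_def by blast
      moreover have "p (?h x + (\<Sum>x\<in>T. ?h x)) = p (?h x) + p (\<Sum>x\<in>T. ?h x)"
        using p hF[OF x] IH(2) unfolding module_map_on_def by blast
      ultimately show ?case
        using insert(1,2) free_module_add[OF hF[OF x] IH(2)] by (simp only: sum.insert IH simp_thms)
    qed
    from this[OF v_fin subset_refl] have "p (\<Sum>x\<in>?S. ?h x) = (\<Sum>x\<in>?S. ?mul (v a x) (g x))" ..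
    moreover have "(\<Sum>x\<in>?S. ?h x) = v a"
    proof
      fix y
      have "(\<Sum>x\<in>?S. ?h x) y = (\<Sum>x\<in>?S. if y = x then v a x else 0)"
        unfolding sum_fun_apply[of "\<lambda>x. ?h x" ?S y] by (simp only: h)
      also have "\<dots> = v a y" using v_fin[of a] by simp
      finally show "(\<Sum>x\<in>?S. ?h x) y = v a y" .
    qed
    moreover have "p (v a) = d a" unfolding v_def using pi d\<Omega> by blast
    moreover have "merge scale 2 1 (\<Theta> a) = (\<Sum>x\<in>?S. ?mul (v a x) (g x))"
      unfolding \<Theta>_def linear_sumD[OF tensor_linear_merge]
      using v_supp by (intro sum.cong refl merge_right_sandwich vR gR) blast
    ultimately show ?thesis by simp
  qed
  have left: "merge scale 2 0 (\<Theta> a) = 0" for a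
    unfolding \<Theta>_def linear_sumD[OF tensor_linear_merge]
    using v_supp by (intro sum.neutral ballI merge_left_sandwich vR gR g0) blast+
  have "splitting_derivation \<Theta>"
    unfolding splitting_derivation_def using in3 lin mult right left unfolding d_def by blast
  then show ?thesis by blast
qed

end


section \<open>Operations on tensor powers of an algebra\<close>

lemma tensor_linear_tscale: "tensor_linear (tscale c)"
  by (rule linear_intro[OF vector_space_tscale vector_space_tscale])
    (auto simp: tscale_def algebra_simps fun_eq_iff)

lemma linear_parameter:
  assumes "T \<in> tensor_power s d" "vector_space r"
    and "\<And>c. tensor_linear (L c)"
    and "\<And>xs. length xs = d \<Longrightarrow> Vector_Spaces.linear r tscale (\<lambda>c. L c (pure_tensor s xs))"
  shows "Vector_Spaces.linear r tscale (\<lambda>c. L c T)"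
  using assms(1)
proof (induction rule: tensor_power_induct)
  case zero
  show ?case by (simp only: linear_zeroD[OF assms(3)] linear_const_zero assms(2) vector_space_tscale)
next
  case (step c xs T)
  have "Vector_Spaces.linear r tscale (\<lambda>x. tscale c (L x (pure_tensor s xs)))"
    by (rule linear_compose_field[OF assms(4)[OF step(1)] tensor_linear_tscale])
  then show ?case
    unfolding linear_addD[OF assms(3)] linear_scaleD[OF assms(3)]
    by (rule linear_plus) (rule step)
qed

lemma split_at: "i < length xs \<Longrightarrow> \<exists>u x v. xs = u @ x # v \<and> length u = i"
  by (metis id_take_nth_drop length_take min.absorb4)

lemma split_at_2:
  assumes "Suc i < length xs"
  shows "\<exists>u x y v. xs = u @ x # y # v \<and> length u = i"
proof -
  obtain u x v where 1: "xs = u @ x # v" "length u = i" using split_at[of i xs] assms by auto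
  with assms obtain y v' where "v = y # v'" by (cases v) auto
  with 1 show ?thesis by blast
qed

lemma multilinear_insert_entry:
  fixes F :: "'v::ab_group_add list \<Rightarrow> 'w::ab_group_add"
  assumes "multilinear s t (Suc d) F" "i \<le> d"
  shows "multilinear s t d (\<lambda>xs. F (take i xs @ c # drop i xs))"
proof (rule multilinearI)
  fix xs ys :: "'v list" assume len: "Suc (length xs + length ys) = d"
  show "Vector_Spaces.linear s t (\<lambda>x. F (take i (xs @ x # ys) @ c # drop i (xs @ x # ys)))"
  proof (cases "i \<le> length xs")
    case True
    then have "take i (xs @ x # ys) @ c # drop i (xs @ x # ys) =
        (take i xs @ c # drop i xs) @ x # ys" for x by simp
    moreover have "Vector_Spaces.linear s t (\<lambda>x. F ((take i xs @ c # drop i xs) @ x # ys))"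
      using True len by (intro multilinearD[OF assms(1)]) simp
    ultimately show ?thesis by simp
  next
    case False
    define k where "k = i - Suc (length xs)"
    have i: "i = Suc (length xs) + k" using False by (simp add: k_def)
    have "take i (xs @ x # ys) @ c # drop i (xs @ x # ys) =
        xs @ x # (take k ys @ c # drop k ys)" for x by (simp add: i)
    moreover have "Vector_Spaces.linear s t (\<lambda>x. F (xs @ x # (take k ys @ c # drop k ys)))"
      using False len assms(2) by (intro multilinearD[OF assms(1)]) (simp add: i)
    ultimately show ?thesis by simp
  qed
qed

context k_algebra
begin

lemma lmult_pure_append:
  assumes "Suc (length xs + length ys) = d" "i = length xs"
  shows "lmult scale d i b (pure_tensor scale (xs @ x # ys)) = pure_tensor scale (xs @ (b * x) # ys)"
  using assms by (simp add: lmult_pure)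

lemma rmult_pure_append:
  assumes "Suc (length xs + length ys) = d" "i = length xs"
  shows "rmult scale d i b (pure_tensor scale (xs @ x # ys)) = pure_tensor scale (xs @ (x * b) # ys)"
  using assms by (simp add: rmult_pure)

lemma merge_pure_append:
  assumes "Suc (length xs + length ys) = d" "i = length xs"
  shows "merge scale d i (pure_tensor scale (xs @ x # y # ys)) = pure_tensor scale (xs @ (x * y) # ys)"
  using assms by (simp add: merge_pure nth_append)

lemma insert_factor_pure_append:
  assumes "Suc (length xs + length ys) = d" "i = length xs"
  shows "insert_factor scale d i b (pure_tensor scale (xs @ ys)) = pure_tensor scale (xs @ b # ys)"
  using assms by (simp add: insert_factor_pure)

text \<open>
  A linear functional with value \<open>1\<close> at the unit, if the algebra is not zero.  It serves to undo
  the insertion of a unit; in the zero algebra all tensors of positive degree vanish.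
\<close>

definition unit_functional :: "'a \<Rightarrow> 'k"
  where "unit_functional =
    (SOME l. Vector_Spaces.linear scale (*) l \<and> ((1::'a) \<noteq> 0 \<longrightarrow> l 1 = 1))"

lemma unit_functional:
  "Vector_Spaces.linear scale (*) unit_functional \<and> ((1::'a) \<noteq> 0 \<longrightarrow> unit_functional 1 = 1)"
proof -
  have "\<exists>l. Vector_Spaces.linear scale (*) l \<and> ((1::'a) \<noteq> 0 \<longrightarrow> l 1 = 1)"
  proof (cases "(1::'a) = 0")
    case True
    then show ?thesis
      using linear_const_zero[OF vector_space_axioms vector_space_field_mult] by blast
  next
    case False
    interpret V: vector_space_pair scale "(*)"
      by (intro vector_space_pair.intro vector_space_axioms vector_space_field_mult)
    have "independent {1::'a}" using False by (simp add: dependent_single)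
    then show ?thesis using V.linear_independent_extend[of "{1}" "\<lambda>_. 1"] by auto
  qed
  from someI_ex[OF this] show ?thesis unfolding unit_functional_def .
qed

lemma linear_unit_functional: "Vector_Spaces.linear scale (*) unit_functional"
  using unit_functional by blast

lemma scale_unit_functional_one: "scale (unit_functional 1) c = c"
proof (cases "(1::'a) = 0")
  case True
  then have "c = 0" by (metis mult_1 mult_zero_left)
  then show ?thesis by simp
next
  case False
  then show ?thesis using unit_functional by simp
qed

text \<open>
  The multiplications by an element and the replacement of a factor, defined next, have this form;
  so it is enough to study how these maps commute with the others.
\<close>

definition factor_map :: "nat \<Rightarrow> nat \<Rightarrow> ('a \<Rightarrow> 'a) \<Rightarrow> ('k, 'a) tensor \<Rightarrow> ('k, 'a) tensor"
  where "factor_map d i h = tensor_map scale d (\<lambda>xs. xs[i := h (xs ! i)])"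

text \<open>
  Apply \<open>unit_functional\<close> to the factor \<open>i\<close> and put \<open>c\<close> in its place.  A tensor is the insertion of
  \<open>c\<close> at \<open>i\<close> into something iff it arises in this way from a tensor with \<open>1\<close> at \<open>i\<close>; thus
  the existential condition on zero parts becomes an equation.
\<close>

definition replace_factor :: "nat \<Rightarrow> nat \<Rightarrow> 'a \<Rightarrow> ('k, 'a) tensor \<Rightarrow> ('k, 'a) tensor"
  where "replace_factor d i c = factor_map d i (\<lambda>x. scale (unit_functional x) c)"

lemma lmult_eq_factor_map: "lmult scale d i b = factor_map d i (\<lambda>x. b * x)"
  and rmult_eq_factor_map: "rmult scale d i b = factor_map d i (\<lambda>x. x * b)"
  by (simp_all only: lmult_def rmult_def factor_map_def)

lemma linear_replacement: "Vector_Spaces.linear scale scale (\<lambda>x. scale (unit_functional x) c)"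
  using linear_unit_functional
  by (intro linear_intro vector_space_axioms)
    (simp_all add: linear_addD linear_scaleD scale_left_distrib)

lemma tensor_linear_factor_map: "tensor_linear (factor_map d i h)"
  and tensor_linear_replace_factor: "tensor_linear (replace_factor d i c)"
  by (simp_all only: factor_map_def replace_factor_def tensor_linear_tensor_map)

lemma multilinear_factor:
  assumes "multilinear scale (*) d \<phi>" "Vector_Spaces.linear scale scale h"
  shows "multilinear scale (*) d (\<lambda>xs. \<phi> (xs[i := h (xs ! i)]))"
proof (rule multilinearI)
  fix xs ys :: "'a list" assume len: "Suc (length xs + length ys) = d"
  consider "i < length xs" | "i = length xs" | k where "i = Suc (length xs + k)"
    by (metis less_imp_Suc_add linorder_neqE_nat)
  then show "Vector_Spaces.linear scale (*) (\<lambda>x. \<phi> ((xs @ x # ys)[i := h ((xs @ x # ys) ! i)]))"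
  proof cases
    case 1
    then show ?thesis using multilinearD[OF assms(1), of "xs[i := h (xs ! i)]" ys] len
      by (simp add: nth_append list_update_append)
  next
    case 2
    then show ?thesis using linear_compose_field[OF assms(2) multilinearD[OF assms(1) len]]
      by (simp add: nth_append list_update_append)
  next
    case 3
    then show ?thesis using multilinearD[OF assms(1), of xs "ys[k := h (ys ! k)]"] len
      by (simp add: nth_append list_update_append)
  qed
qed

lemma factor_map_pure_append:
  assumes "Suc (length xs + length ys) = d" "i = length xs" "Vector_Spaces.linear scale scale h"
  shows "factor_map d i h (pure_tensor scale (xs @ x # ys)) = pure_tensor scale (xs @ h x # ys)"
  unfolding factor_map_def
  by (subst tensor_map_pure) (use assms multilinear_factor in \<open>auto simp: nth_append\<close>)

lemma replace_factor_pure_append: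
  assumes "Suc (length xs + length ys) = d" "i = length xs"
  shows "replace_factor d i c (pure_tensor scale (xs @ x # ys)) =
    tscale (unit_functional x) (pure_tensor scale (xs @ c # ys))"
  unfolding replace_factor_def factor_map_pure_append[OF assms linear_replacement]
  by (rule linear_scaleD[OF linear_pure_tensor])

lemma replace_factor_unit:
  assumes "Suc (length xs + length ys) = d" "i = length xs"
  shows "replace_factor d i c (pure_tensor scale (xs @ 1 # ys)) = pure_tensor scale (xs @ c # ys)"
  unfolding replace_factor_def factor_map_pure_append[OF assms linear_replacement]
  by (simp only: scale_unit_functional_one)

definition remove_factor :: "nat \<Rightarrow> nat \<Rightarrow> ('k, 'a) tensor \<Rightarrow> ('k, 'a) tensor"
  where "remove_factor d i T = (\<lambda>\<phi>. if multilinear scale (*) d \<phi>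
    then T (\<lambda>xs. unit_functional (xs ! i) * \<phi> (take i xs @ drop (Suc i) xs)) else 0)"

lemma linear_times_const:
  assumes "Vector_Spaces.linear scale (*) h"
  shows "Vector_Spaces.linear scale (*) (\<lambda>x. h x * (c::'k))"
    "Vector_Spaces.linear scale (*) (\<lambda>x. c * h x)"
  using assms by (auto simp: Vector_Spaces.linear_iff algebra_simps)

lemma tensor_linear_remove_factor: "tensor_linear (remove_factor d i)"
  by (rule linear_intro) (auto simp: vector_space_tscale remove_factor_def tscale_def fun_eq_iff)

lemma multilinear_remove:
  assumes "multilinear scale (*) d \<phi>" "i < Suc d"
  shows "multilinear scale (*) (Suc d)
    (\<lambda>xs. unit_functional (xs ! i) * \<phi> (take i xs @ drop (Suc i) xs))"
proof (rule multilinearI)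
  fix xs ys :: "'a list" assume len: "Suc (length xs + length ys) = Suc d"
  consider "i < length xs" | "i = length xs" | k where "i = Suc (length xs + k)"
    by (metis less_imp_Suc_add linorder_neqE_nat)
  then show "Vector_Spaces.linear scale (*) (\<lambda>x. unit_functional ((xs @ x # ys) ! i) *
      \<phi> (take i (xs @ x # ys) @ drop (Suc i) (xs @ x # ys)))"
  proof cases
    case 1
    then show ?thesis using multilinearD[OF assms(1), of "take i xs @ drop (Suc i) xs" ys] len
      by (simp add: nth_append linear_times_const)
  next
    case 2
    then show ?thesis using linear_unit_functional
      by (simp add: nth_append linear_times_const)
  next
    case 3
    then show ?thesis
      using multilinearD[OF assms(1), of xs "take k ys @ drop (Suc k) ys"] len assms(2)
      by (simp add: nth_append linear_times_const)
  qed
qed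

lemma remove_factor_pure_append:
  assumes "length xs + length ys = d" "i = length xs"
  shows "remove_factor d i (pure_tensor scale (xs @ x # ys)) =
    tscale (unit_functional x) (pure_tensor scale (xs @ ys))"
  using assms multilinear_remove[of d _ i]
  by (auto simp: remove_factor_def pure_tensor_def tscale_def fun_eq_iff nth_append)

lemma factor_map_in:
  assumes "T \<in> tensor_power scale d" "i < d" "Vector_Spaces.linear scale scale h"
  shows "factor_map d i h T \<in> tensor_power scale d"
proof (rule linear_image_tensor_power[OF assms(1) tensor_linear_factor_map])
  fix xs :: "'a list" assume "length xs = d"
  with assms(2) obtain u x v where "xs = u @ x # v" "length u = i" "Suc (length u + length v) = d"
    using split_at[of i xs] by auto
  then show "factor_map d i h (pure_tensor scale xs) \<in> tensor_power scale d"
    by (simp add: factor_map_pure_append assms(3) tensor_power_pure)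
qed

lemma lmult_in: "T \<in> tensor_power scale d \<Longrightarrow> i < d \<Longrightarrow> lmult scale d i b T \<in> tensor_power scale d"
  and rmult_in: "T \<in> tensor_power scale d \<Longrightarrow> i < d \<Longrightarrow> rmult scale d i b T \<in> tensor_power scale d"
  unfolding lmult_eq_factor_map rmult_eq_factor_map
  by (auto intro: factor_map_in linear_mult_left linear_mult_right)

lemma merge_in:
  "T \<in> tensor_power scale (Suc d) \<Longrightarrow> i < d \<Longrightarrow> merge scale d i T \<in> tensor_power scale d"
  by (rule linear_image_tensor_power[OF _ tensor_linear_merge]) (auto simp: merge_pure tensor_power_pure)

lemma remove_factor_in:
  assumes "T \<in> tensor_power scale (Suc d)" "i < Suc d"
  shows "remove_factor d i T \<in> tensor_power scale d"
proof (rule linear_image_tensor_power[OF assms(1) tensor_linear_remove_factor])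
  fix xs :: "'a list" assume "length xs = Suc d"
  with assms(2) obtain u x v where "xs = u @ x # v" "length u = i" "length u + length v = d"
    using split_at[of i xs] by auto
  then show "remove_factor d i (pure_tensor scale xs) \<in> tensor_power scale d"
    by (simp add: remove_factor_pure_append tensor_power_scale tensor_power_pure)
qed

lemma insert_remove_factor:
  assumes "T \<in> tensor_power scale (Suc d)" "i < Suc d"
  shows "insert_factor scale (Suc d) i c (remove_factor d i T) = replace_factor (Suc d) i c T"
proof (rule linear_eq_on_tensor_power[OF assms(1) _ tensor_linear_replace_factor])
  show "tensor_linear (\<lambda>T. insert_factor scale (Suc d) i c (remove_factor d i T))"
    by (rule linear_compose_field[OF tensor_linear_remove_factor tensor_linear_insert_factor])
  fix xs :: "'a list" assume "length xs = Suc d"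
  with assms(2) obtain u x v where "xs = u @ x # v" "length u = i" "length u + length v = d"
    using split_at[of i xs] by auto
  then show "insert_factor scale (Suc d) i c (remove_factor d i (pure_tensor scale xs)) =
      replace_factor (Suc d) i c (pure_tensor scale xs)"
    by (simp add: remove_factor_pure_append replace_factor_pure_append insert_factor_pure_append
        linear_scaleD[OF tensor_linear_insert_factor])
qed

lemma replace_insert_unit:
  assumes "T \<in> tensor_power scale d" "i < Suc d"
  shows "replace_factor (Suc d) i c (insert_factor scale (Suc d) i 1 T) =
    insert_factor scale (Suc d) i c T"
proof (rule linear_eq_on_tensor_power[OF assms(1) _ tensor_linear_insert_factor])
  show "tensor_linear (\<lambda>T. replace_factor (Suc d) i c (insert_factor scale (Suc d) i 1 T))"
    by (rule linear_compose_field[OF tensor_linear_insert_factor tensor_linear_replace_factor])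
  fix xs :: "'a list" assume "length xs = d"
  then have "xs = take i xs @ drop i xs" "length (take i xs) = i"
    "Suc (length (take i xs) + length (drop i xs)) = Suc d" using assms(2) by auto
  then show "replace_factor (Suc d) i c (insert_factor scale (Suc d) i 1 (pure_tensor scale xs)) =
      insert_factor scale (Suc d) i c (pure_tensor scale xs)"
    by (metis insert_factor_pure_append replace_factor_unit)
qed

lemma lmult_lmult:
  assumes "T \<in> tensor_power scale d" "i < d"
  shows "lmult scale d i (a * b) T = lmult scale d i a (lmult scale d i b T)"
  by (rule linear_eq_on_tensor_power[OF assms(1) tensor_linear_lmult
        linear_compose_field[OF tensor_linear_lmult tensor_linear_lmult]])
    (use assms(2) in \<open>simp add: lmult_pure mult.assoc\<close>)

lemma tensor_linear_comp:
  "tensor_linear L \<Longrightarrow> tensor_linear (\<lambda>T. lmult scale d i b (L T))"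
  "tensor_linear L \<Longrightarrow> tensor_linear (\<lambda>T. rmult scale d i b (L T))"
  "tensor_linear L \<Longrightarrow> tensor_linear (\<lambda>T. merge scale d i (L T))"
  "tensor_linear L \<Longrightarrow> tensor_linear (\<lambda>T. factor_map d i h (L T))"
  by (erule linear_compose_field,
      rule tensor_linear_lmult tensor_linear_rmult tensor_linear_merge tensor_linear_factor_map)+

lemma tensor_linear_id: "tensor_linear (\<lambda>T. T)"
  by (rule linear_intro) (auto simp: vector_space_tscale)

lemmas tensor_linear_ops = tensor_linear_comp tensor_linear_id

text \<open>
  The operation \<open>lmult d j c \<circ> merge d j\<close> occurs in the construction of lifts below.  It commutes
  with the operations at other factors, as these are distinct arguments of a pure tensor; to the right of \<open>j\<close> their index drops by one.
\<close>

lemma commute_left: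
  assumes "T \<in> tensor_power scale (Suc d)" "i < j" "j < d" and h: "Vector_Spaces.linear scale scale h"
  shows "factor_map d i h (lmult scale d j c (merge scale d j T)) =
    lmult scale d j c (merge scale d j (factor_map (Suc d) i h T))"
proof (rule linear_eq_on_tensor_power[OF assms(1), where t = tscale])
  fix xs :: "'a list" assume len: "length xs = Suc d"
  obtain u' x y w where 1: "xs = u' @ x # y # w" "length u' = j"
    using split_at_2[of j xs] len assms(3) by auto
  then obtain u a v where 2: "u' = u @ a # v" "length u = i" using split_at[of i u'] assms(2) by auto
  have xs: "xs = u @ a # v @ x # y # w" and i: "i = length u"
    and j: "j = Suc (length u + length v)" and d: "d = Suc (Suc (length u + length v + length w))"
    using 1 2 len by simp_all
  have at_j: "merge scale d j (pure_tensor scale (u @ a # v @ x # y # w)) =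
      pure_tensor scale (u @ a # v @ (x * y) # w)"
    "lmult scale d j c (pure_tensor scale (u @ a # v @ z # w)) =
      pure_tensor scale (u @ a # v @ (c * z) # w)" for a z
    by (rule merge_pure_append[of "u @ a # v" w d j x y, unfolded append_assoc append_Cons]
        lmult_pure_append[of "u @ a # v" w d j c z, unfolded append_assoc append_Cons];
        simp add: j d)+
  have "factor_map d i h (pure_tensor scale (u @ a # v @ z # w)) = pure_tensor scale (u @ h a # v @ z # w)"
    "factor_map (Suc d) i h (pure_tensor scale (u @ a # v @ x # y # w)) =
      pure_tensor scale (u @ h a # v @ x # y # w)" for z
    by (rule factor_map_pure_append[OF _ i h]; simp add: d)+
  then show "factor_map d i h (lmult scale d j c (merge scale d j (pure_tensor scale xs))) =
      lmult scale d j c (merge scale d j (factor_map (Suc d) i h (pure_tensor scale xs)))"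
    by (simp only: xs at_j)
qed (intro tensor_linear_ops)+

lemma commute_right:
  assumes "T \<in> tensor_power scale (Suc d)" "j < i" "i < d" and h: "Vector_Spaces.linear scale scale h"
  shows "factor_map d i h (lmult scale d j c (merge scale d j T)) =
    lmult scale d j c (merge scale d j (factor_map (Suc d) (Suc i) h T))"
proof (rule linear_eq_on_tensor_power[OF assms(1), where t = tscale])
  fix xs :: "'a list" assume len: "length xs = Suc d"
  obtain u' a w where 1: "xs = u' @ a # w" "length u' = Suc i"
    using split_at[of "Suc i" xs] len assms by auto
  then obtain u x y v where 2: "u' = u @ x # y # v" "length u = j"
    using split_at_2[of j u'] assms by auto
  have xs: "xs = u @ x # y # v @ a # w" and j: "j = length u"
    and i: "i = Suc (length u + length v)" and d: "d = Suc (Suc (length u + length v + length w))"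
    using 1 2 len by simp_all
  have at_i: "factor_map d i h (pure_tensor scale (u @ z # v @ a # w)) =
      pure_tensor scale (u @ z # v @ h a # w)"
    "factor_map (Suc d) (Suc i) h (pure_tensor scale (u @ x # y # v @ a # w)) =
      pure_tensor scale (u @ x # y # v @ h a # w)" for z
    by (rule factor_map_pure_append[of "u @ z # v" w d i h a, unfolded append_assoc append_Cons]
        factor_map_pure_append[of "u @ x # y # v" w "Suc d" "Suc i" h a, unfolded append_assoc append_Cons];
        simp add: i d h)+
  have "merge scale d j (pure_tensor scale (u @ x # y # v @ a # w)) =
      pure_tensor scale (u @ (x * y) # v @ a # w)"
    "lmult scale d j c (pure_tensor scale (u @ z # v @ a # w)) =
      pure_tensor scale (u @ (c * z) # v @ a # w)" for a z
    by (rule merge_pure_append lmult_pure_append; simp add: j d)+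
  then show "factor_map d i h (lmult scale d j c (merge scale d j (pure_tensor scale xs))) =
      lmult scale d j c (merge scale d j (factor_map (Suc d) (Suc i) h (pure_tensor scale xs)))"
    by (simp only: xs at_i)
qed (intro tensor_linear_ops)+

lemma commute_right_merge:
  assumes "T \<in> tensor_power scale (Suc (Suc d))" "j < i" "i < d"
  shows "merge scale d i (lmult scale (Suc d) j c (merge scale (Suc d) j T)) =
    lmult scale d j c (merge scale d j (merge scale (Suc d) (Suc i) T))"
proof (rule linear_eq_on_tensor_power[OF assms(1), where t = tscale])
  fix xs :: "'a list" assume len: "length xs = Suc (Suc d)"
  obtain u' a b w where 1: "xs = u' @ a # b # w" "length u' = Suc i"
    using split_at_2[of "Suc i" xs] len assms by auto
  then obtain u x y v where 2: "u' = u @ x # y # v" "length u = j"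
    using split_at_2[of j u'] assms by auto
  have xs: "xs = u @ x # y # v @ a # b # w" and j: "j = length u"
    and i: "i = Suc (length u + length v)" and d: "d = Suc (Suc (length u + length v + length w))"
    using 1 2 len by simp_all
  have "merge scale d i (pure_tensor scale ((u @ (c * (x * y)) # v) @ a # b # w)) =
      pure_tensor scale ((u @ (c * (x * y)) # v) @ (a * b) # w)"
    by (rule merge_pure_append) (simp_all add: i d)
  then have "merge scale d i (pure_tensor scale (u @ (c * (x * y)) # v @ a # b # w)) =
      pure_tensor scale (u @ (c * (x * y)) # v @ (a * b) # w)"
    by (simp only: append_assoc append_Cons)
  moreover have "merge scale (Suc d) (Suc i) (pure_tensor scale ((u @ x # y # v) @ a # b # w)) =
      pure_tensor scale ((u @ x # y # v) @ (a * b) # w)"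
    by (rule merge_pure_append) (simp_all add: i d)
  then have "merge scale (Suc d) (Suc i) (pure_tensor scale (u @ x # y # v @ a # b # w)) =
      pure_tensor scale (u @ x # y # v @ (a * b) # w)"
    by (simp only: append_assoc append_Cons)
  moreover have "lmult scale (Suc d) j c (merge scale (Suc d) j
      (pure_tensor scale (u @ x # y # v @ a # b # w))) =
      pure_tensor scale (u @ (c * (x * y)) # v @ a # b # w)"
    unfolding j d by (simp add: merge_pure_append lmult_pure_append)
  moreover have "lmult scale d j c (merge scale d j
      (pure_tensor scale (u @ x # y # v @ (a * b) # w))) =
      pure_tensor scale (u @ (c * (x * y)) # v @ (a * b) # w)"
    unfolding j d by (simp add: merge_pure_append lmult_pure_append)
  ultimately show "merge scale d i (lmult scale (Suc d) j c (merge scale (Suc d) j (pure_tensor scale xs))) =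
    lmult scale d j c (merge scale d j (merge scale (Suc d) (Suc i) (pure_tensor scale xs)))"
    by (simp only: xs)
qed (intro tensor_linear_ops)+

text \<open>
  The operations at the second of the two merged factors.  By associativity a multiplication from
  the left moves to the first factor, from the right it moves out of the product.
\<close>

lemma commute_at:
  fixes d j :: nat and c b :: 'a
  assumes "T \<in> tensor_power scale (Suc d)" "j < d"
  shows "lmult scale d j c (merge scale d j (rmult scale (Suc d) (Suc j) b T)) =
      rmult scale d j b (lmult scale d j c (merge scale d j T))"
    and "lmult scale d j c (merge scale d j (lmult scale (Suc d) (Suc j) b T)) =
      merge scale d j (lmult scale (Suc d) j c (rmult scale (Suc d) j b T))"
proof -
  have pure_ops:
    "lmult scale (Suc d) (Suc j) b (pure_tensor scale (u @ x # y # v)) =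
      pure_tensor scale (u @ x # (b * y) # v)"
    "rmult scale (Suc d) (Suc j) b (pure_tensor scale (u @ x # y # v)) =
      pure_tensor scale (u @ x # (y * b) # v)"
    if "j = length u" "d = Suc (length u + length v)" for u x y v
  proof -
    have "lmult scale (Suc d) (Suc j) b (pure_tensor scale ((u @ [x]) @ y # v)) =
        pure_tensor scale ((u @ [x]) @ (b * y) # v)"
      by (rule lmult_pure_append) (simp_all add: that)
    then show "lmult scale (Suc d) (Suc j) b (pure_tensor scale (u @ x # y # v)) =
        pure_tensor scale (u @ x # (b * y) # v)"
      by (simp only: append_assoc append_Cons append_Nil)
    have "rmult scale (Suc d) (Suc j) b (pure_tensor scale ((u @ [x]) @ y # v)) =
        pure_tensor scale ((u @ [x]) @ (y * b) # v)"
      by (rule rmult_pure_append) (simp_all add: that)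
    then show "rmult scale (Suc d) (Suc j) b (pure_tensor scale (u @ x # y # v)) =
        pure_tensor scale (u @ x # (y * b) # v)"
      by (simp only: append_assoc append_Cons append_Nil)
  qed
  have "lmult scale d j c (merge scale d j (rmult scale (Suc d) (Suc j) b (pure_tensor scale xs))) =
      rmult scale d j b (lmult scale d j c (merge scale d j (pure_tensor scale xs))) \<and>
    lmult scale d j c (merge scale d j (lmult scale (Suc d) (Suc j) b (pure_tensor scale xs))) =
      merge scale d j (lmult scale (Suc d) j c (rmult scale (Suc d) j b (pure_tensor scale xs)))"
    if len: "length xs = Suc d" for xs
  proof -
    obtain u x y v where *: "xs = u @ x # y # v" "length u = j"
      using split_at_2[of j xs] len assms by auto
    then have j: "j = length u" and d: "d = Suc (length u + length v)" using len by simp_all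
    show ?thesis unfolding *(1) pure_ops[OF j d] unfolding j d
      by (simp add: merge_pure_append lmult_pure_append rmult_pure_append mult.assoc)
  qed
  then show "lmult scale d j c (merge scale d j (rmult scale (Suc d) (Suc j) b T)) =
      rmult scale d j b (lmult scale d j c (merge scale d j T))"
    and "lmult scale d j c (merge scale d j (lmult scale (Suc d) (Suc j) b T)) =
      merge scale d j (lmult scale (Suc d) j c (rmult scale (Suc d) j b T))"
    by - (rule linear_eq_on_tensor_power[OF assms(1), where t = tscale],
        intro tensor_linear_ops, intro tensor_linear_ops, blast)+
qed

lemma commute_at_merge:
  assumes "T \<in> tensor_power scale (Suc (Suc d))" "j < d"
  shows "lmult scale d j c (merge scale d j (merge scale (Suc d) (Suc j) T)) =
    merge scale d j (lmult scale (Suc d) j c (merge scale (Suc d) j T))"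
proof (rule linear_eq_on_tensor_power[OF assms(1), where t = tscale])
  fix xs :: "'a list" assume len: "length xs = Suc (Suc d)"
  obtain u x v' where 1: "xs = u @ x # v'" "length u = j"
    using split_at[of j xs] len assms by auto
  with len assms obtain y z v where 2: "v' = y # z # v" by (cases v'; cases "tl v'") auto
  have xs: "xs = u @ x # y # z # v" and j: "j = length u" and d: "d = Suc (length u + length v)"
    using 1 2 len by simp_all
  have "merge scale (Suc d) (Suc j) (pure_tensor scale ((u @ [x]) @ y # z # v)) =
      pure_tensor scale ((u @ [x]) @ (y * z) # v)"
    by (rule merge_pure_append) (simp_all add: j d)
  then have "merge scale (Suc d) (Suc j) (pure_tensor scale (u @ x # y # z # v)) =
      pure_tensor scale (u @ x # (y * z) # v)"
    by (simp only: append_assoc append_Cons append_Nil)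
  then show "lmult scale d j c (merge scale d j (merge scale (Suc d) (Suc j) (pure_tensor scale xs))) =
    merge scale d j (lmult scale (Suc d) j c (merge scale (Suc d) j (pure_tensor scale xs)))"
    unfolding xs j d by (simp add: merge_pure_append lmult_pure_append mult.assoc)
qed (intro tensor_linear_ops)+

lemma linear_lmult_parameter:
  assumes "T \<in> tensor_power scale d" "i < d"
  shows "Vector_Spaces.linear scale tscale (\<lambda>c. lmult scale d i c T)"
proof (rule linear_parameter[OF assms(1) vector_space_axioms tensor_linear_lmult])
  fix xs :: "'a list" assume len: "length xs = d"
  obtain u x v where "xs = u @ x # v" "length u = i" using split_at[of i xs] len assms by auto
  then show "Vector_Spaces.linear scale tscale (\<lambda>c. lmult scale d i c (pure_tensor scale xs))"
    using len linear_compose_field[OF linear_mult_right[of x] linear_pure_tensor[of u v]]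
    by (simp add: lmult_pure_append)
qed

lemma linear_replace_factor_parameter:
  assumes "T \<in> tensor_power scale d" "i < d"
  shows "Vector_Spaces.linear scale tscale (\<lambda>c. replace_factor d i c T)"
proof (rule linear_parameter[OF assms(1) vector_space_axioms tensor_linear_replace_factor])
  fix xs :: "'a list" assume len: "length xs = d"
  obtain u x v where "xs = u @ x # v" "length u = i" using split_at[of i xs] len assms by auto
  moreover have "Vector_Spaces.linear scale tscale (\<lambda>c. tscale k (pure_tensor scale (u @ c # v)))" for k
    by (rule linear_compose_field[OF linear_pure_tensor tensor_linear_tscale])
  ultimately show "Vector_Spaces.linear scale tscale (\<lambda>c. replace_factor d i c (pure_tensor scale xs))"
    using len by (simp add: replace_factor_pure_append)
qed

end


section \<open>The spaces of families in terms of multilinear maps\<close>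

lemma nondeg_partitions_2:
  assumes "m > 0"
  shows "nondeg_partitions 2 m = (\<lambda>k. [k, m - k]) ` {1..<m}"
proof (intro set_eqI iffI)
  fix \<mu> assume \<mu>: "\<mu> \<in> nondeg_partitions 2 m"
  then obtain k l where "\<mu> = [k, l]"
    by (auto simp: nondeg_partitions_def ordered_partitions_def length_2_iff)
  with \<mu> assms have "\<mu> = [k, m - k]" "k \<in> {1..<m}"
    by (auto simp: nondeg_partitions_def ordered_partitions_def degenerate_def)
  then show "\<mu> \<in> (\<lambda>k. [k, m - k]) ` {1..<m}" by blast
qed (use assms in \<open>auto simp: nondeg_partitions_def ordered_partitions_def degenerate_def\<close>)

lemma sum_nondeg_partitions_2:
  assumes "m > 0"
  shows "(\<Sum>\<mu>\<in>nondeg_partitions 2 m. h \<mu>) = (\<Sum>k\<in>{1..<m}. h [k, m - k])"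
  unfolding nondeg_partitions_2[OF assms] by (subst sum.reindex) (auto simp: inj_on_def)

context k_algebra_hom
begin

definition tensor_multilinear :: "nat \<Rightarrow> ('a list \<Rightarrow> ('k, 'b) tensor) \<Rightarrow> bool"
  where "tensor_multilinear d F \<longleftrightarrow> multilinear sA tscale d F \<and>
    (\<forall>as. length as = d \<longrightarrow> F as \<in> tensor_power sB d)"

text \<open>
  The conditions on a family are easier to handle for functions of lists of arguments than for
  linear maps on a tensor power.  They are stated for one refinement \<open>r\<close> at a time, but the Leibniz
  rule at \<open>r\<close> also involves the components at the refinements with one part of \<open>r\<close> split in two.
\<close>

definition leibniz :: "(nat list \<Rightarrow> 'a list \<Rightarrow> ('k, 'b) tensor) \<Rightarrow> nat list \<Rightarrow> bool"
  where "leibniz g r \<longleftrightarrow> (\<forall>r1 m r2 as1 as2 x y.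
    r = r1 @ m # r2 \<longrightarrow> m > 0 \<longrightarrow> length as1 = length r1 \<longrightarrow> length as2 = length r2 \<longrightarrow>
    g r (as1 @ (x * y) # as2) =
      lmult sB (length r) (length r1) (f x) (g r (as1 @ y # as2)) +
      rmult sB (length r) (length r1) (f y) (g r (as1 @ x # as2)) +
      (\<Sum>k\<in>{1..<m}. merge sB (length r) (length r1)
        (g (r1 @ k # (m - k) # r2) (as1 @ x # y # as2))))"

text \<open>
  That \<open>f a\<close> is inserted at a zero part, without a quantifier over the map into which it is inserted:
  this map is determined by the value at \<open>a = 1\<close>.  See \<open>inserts_at_zeros_iff\<close>.
\<close>

definition inserts_at_zeros :: "nat list \<Rightarrow> ('a list \<Rightarrow> ('k, 'b) tensor) \<Rightarrow> bool"
  where "inserts_at_zeros r F \<longleftrightarrow> (\<forall>r1 r2 as1 as2 a.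
    r = r1 @ 0 # r2 \<longrightarrow> length as1 = length r1 \<longrightarrow> length as2 = length r2 \<longrightarrow>
    F (as1 @ a # as2) = B.replace_factor (length r) (length r1) (f a) (F (as1 @ 1 # as2)))"

definition jet_component :: "(nat list \<Rightarrow> 'a list \<Rightarrow> ('k, 'b) tensor) \<Rightarrow> nat list \<Rightarrow> bool"
  where "jet_component g r \<longleftrightarrow>
    tensor_multilinear (length r) (g r) \<and> leibniz g r \<and> inserts_at_zeros r (g r)"

lemma vector_space_sA: "vector_space sA" and vector_space_sB: "vector_space sB"
  by unfold_locales

lemma tensor_multilinear_tensor_hom:
  assumes "P \<in> tensor_hom sA sB d d"
  shows "tensor_multilinear d (\<lambda>as. P (pure_tensor sA as))"
  unfolding tensor_multilinear_def
  using multilinear_tensor_hom[OF assms vector_space_sA] tensor_hom_value[OF assms]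
  by (simp add: tensor_power_pure)

text \<open>Refinements at index \<open>i\<close> correspond to decompositions of the list around its entry \<open>i\<close>.\<close>

lemma leibniz_iff:
  "leibniz (\<lambda>r as. P r (pure_tensor sA as)) r \<longleftrightarrow>
    (\<forall>i<length r. r ! i > 0 \<longrightarrow> (\<forall>as x y. length as = length r \<longrightarrow>
      P r (pure_tensor sA (as[i := x * y])) =
        lmult sB (length r) i (f x) (P r (pure_tensor sA (as[i := y]))) +
        rmult sB (length r) i (f y) (P r (pure_tensor sA (as[i := x]))) +
        (\<Sum>\<mu>\<in>nondeg_partitions 2 (r ! i). merge sB (length r) i
          (P (refine_at \<mu> i r) (pure_tensor sA (take i as @ [x, y] @ drop (Suc i) as))))))"
  (is "?L \<longleftrightarrow> ?R")
proof
  assume ?L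
  show ?R
  proof (intro allI impI)
    fix i :: nat and as :: "'a list" and x y :: 'a
    assume i: "i < length r" "r ! i > 0" and as: "length as = length r"
    have r: "r = take i r @ r ! i # drop (Suc i) r" using i by (simp add: id_take_nth_drop[symmetric])
    have len: "length (take i as) = length (take i r)"
      "length (drop (Suc i) as) = length (drop (Suc i) r)" "length (take i r) = i"
      using i as by auto
    have "as[i := z] = take i as @ z # drop (Suc i) as" for z
      using i as by (simp add: upd_conv_take_nth_drop)
    then show "P r (pure_tensor sA (as[i := x * y])) =
        lmult sB (length r) i (f x) (P r (pure_tensor sA (as[i := y]))) +
        rmult sB (length r) i (f y) (P r (pure_tensor sA (as[i := x]))) +
        (\<Sum>\<mu>\<in>nondeg_partitions 2 (r ! i). merge sB (length r) i
          (P (refine_at \<mu> i r) (pure_tensor sA (take i as @ [x, y] @ drop (Suc i) as))))"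
      using \<open>?L\<close>[unfolded leibniz_def, rule_format, OF r i(2) len(1,2), of x y]
      unfolding sum_nondeg_partitions_2[OF i(2)] len(3) refine_at_def append_Cons append_Nil
      by (simp only:)
  qed
next
  assume ?R
  show ?L unfolding leibniz_def
  proof (intro allI impI)
    fix r1 m r2 and as1 as2 :: "'a list" and x y
    assume r: "r = r1 @ m # r2" and m: "m > 0"
      and len: "length as1 = length r1" "length as2 = length r2"
    have 1: "length r1 < length r" "r ! length r1 > 0" "length (as1 @ x # as2) = length r"
      using r m len by auto
    have 2: "(as1 @ x # as2)[length r1 := z] = as1 @ z # as2" for z
      using len by (simp add: list_update_append)
    have 3: "take (length r1) (as1 @ x # as2) @ [x, y] @ drop (Suc (length r1)) (as1 @ x # as2) =
        as1 @ x # y # as2" using len by simp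
    have 4: "r ! length r1 = m" by (simp add: r)
    have 5: "refine_at [k, l] (length r1) r = r1 @ k # l # r2" for k l
      by (simp add: r refine_at_def)
    show "P r (pure_tensor sA (as1 @ (x * y) # as2)) =
        lmult sB (length r) (length r1) (f x) (P r (pure_tensor sA (as1 @ y # as2))) +
        rmult sB (length r) (length r1) (f y) (P r (pure_tensor sA (as1 @ x # as2))) +
        (\<Sum>k\<in>{1..<m}. merge sB (length r) (length r1)
          (P (r1 @ k # (m - k) # r2) (pure_tensor sA (as1 @ x # y # as2))))"
      using \<open>?R\<close>[rule_format, OF 1, of x y]
      unfolding 2 3 4 sum_nondeg_partitions_2[OF m] 5 .
  qed
qed

text \<open>
  The map into which \<open>f a\<close> is inserted is recovered by setting \<open>a = 1\<close> and applying the unit functional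
  to the factor.
\<close>

lemma inserts_at_zeros_iff:
  assumes P: "P \<in> tensor_hom sA sB (length r) (length r)"
  shows "inserts_at_zeros r (\<lambda>as. P (pure_tensor sA as)) \<longleftrightarrow>
    (\<forall>i<length r. r ! i = 0 \<longrightarrow>
      (\<exists>Q\<in>tensor_hom sA sB (length r - 1) (length r - 1). \<forall>as. length as = length r \<longrightarrow>
        P (pure_tensor sA as) = insert_factor sB (length r) i (f (as ! i))
          (Q (pure_tensor sA (take i as @ drop (Suc i) as)))))"
  (is "?L \<longleftrightarrow> ?R")
proof
  assume ?L
  show ?R
  proof (intro allI impI)
    fix i assume i: "i < length r" "r ! i = 0"
    define d where "d = length r - 1"
    have d: "length r = Suc d" using i by (simp add: d_def)
    have r: "r = take i r @ 0 # drop (Suc i) r" using i by (metis id_take_nth_drop)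
    let ?F = "\<lambda>as. P (pure_tensor sA as)"
    let ?Q = "\<lambda>as. B.remove_factor d i (?F (take i as @ 1 # drop i as))"
    have ml: "multilinear sA tscale (Suc d) ?F" and val: "\<And>as. length as = Suc d \<Longrightarrow>
      ?F as \<in> tensor_power sB (Suc d)"
      using tensor_multilinear_tensor_hom[OF P] by (simp_all add: tensor_multilinear_def d)
    have i_le: "i \<le> d" "i < Suc d" using i d by simp_all
    have "\<exists>Q\<in>tensor_hom sA sB d d. \<forall>as. length as = d \<longrightarrow> Q (pure_tensor sA as) = ?Q as"
    proof (rule tensor_hom_of_multilinear[OF vector_space_sA])
      show "multilinear sA tscale d ?Q"
        by (rule multilinear_compose_linear[OF multilinear_insert_entry[OF ml i_le(1)]
              B.tensor_linear_remove_factor])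
      show "?Q as \<in> tensor_power sB d" if "length as = d" for as
        using that i_le by (intro B.remove_factor_in val) auto
    qed
    then obtain Q where Q: "Q \<in> tensor_hom sA sB d d"
      "\<And>as. length as = d \<Longrightarrow> Q (pure_tensor sA as) = ?Q as" by blast
    have "P (pure_tensor sA as) = insert_factor sB (Suc d) i (f (as ! i))
        (Q (pure_tensor sA (take i as @ drop (Suc i) as)))" if as: "length as = Suc d" for as
    proof -
      let ?as1 = "take i as" and ?as2 = "drop (Suc i) as"
      have len: "length ?as1 = length (take i r)" "length ?as2 = length (drop (Suc i) r)"
        "length (take i r) = i" "length (?as1 @ ?as2) = d" "length (?as1 @ 1 # ?as2) = Suc d"
        using as i_le d by auto
      have "P (pure_tensor sA as) = P (pure_tensor sA (?as1 @ as ! i # ?as2))"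
        using as i_le by (simp add: id_take_nth_drop[symmetric])
      also have "\<dots> = B.replace_factor (Suc d) i (f (as ! i)) (P (pure_tensor sA (?as1 @ 1 # ?as2)))"
        using \<open>?L\<close>[unfolded inserts_at_zeros_def, rule_format, OF r len(1,2)] unfolding len(3) d .
      also have "\<dots> = insert_factor sB (Suc d) i (f (as ! i))
          (B.remove_factor d i (P (pure_tensor sA (?as1 @ 1 # ?as2))))"
        by (rule B.insert_remove_factor[symmetric, OF val[OF len(5)] i_le(2)])
      also have "B.remove_factor d i (P (pure_tensor sA (?as1 @ 1 # ?as2))) =
          Q (pure_tensor sA (?as1 @ ?as2))"
        using Q(2)[OF len(4)] as i_le by simp
      finally show ?thesis .
    qed
    then show "\<exists>Q\<in>tensor_hom sA sB (length r - 1) (length r - 1). \<forall>as. length as = length r \<longrightarrow>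
        P (pure_tensor sA as) = insert_factor sB (length r) i (f (as ! i))
          (Q (pure_tensor sA (take i as @ drop (Suc i) as)))"
      using Q(1) unfolding d by auto
  qed
next
  assume ?R
  show ?L unfolding inserts_at_zeros_def
  proof (intro allI impI)
    fix r1 r2 and as1 as2 :: "'a list" and a
    assume r: "r = r1 @ 0 # r2" and len: "length as1 = length r1" "length as2 = length r2"
    have 1: "length r1 < length r" "r ! length r1 = 0" using r by auto
    obtain d where d: "length r = Suc d" using r by simp
    from \<open>?R\<close>[rule_format, OF 1] obtain Q where Q: "Q \<in> tensor_hom sA sB d d"
      "\<And>as. length as = Suc d \<Longrightarrow> P (pure_tensor sA as) = insert_factor sB (Suc d) (length r1)
        (f (as ! length r1)) (Q (pure_tensor sA (take (length r1) as @ drop (Suc (length r1)) as)))"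
      unfolding d by auto
    have *: "P (pure_tensor sA (as1 @ c # as2)) =
        insert_factor sB (Suc d) (length r1) (f c) (Q (pure_tensor sA (as1 @ as2)))" for c
    proof -
      have "length (as1 @ c # as2) = Suc d" using len r d by simp
      note Q(2)[OF this]
      moreover have "(as1 @ c # as2) ! length r1 = c"
        "take (length r1) (as1 @ c # as2) @ drop (Suc (length r1)) (as1 @ c # as2) = as1 @ as2"
        by (simp_all flip: len(1))
      ultimately show ?thesis by (simp only:)
    qed
    have "Q (pure_tensor sA (as1 @ as2)) \<in> tensor_power sB d"
      by (rule tensor_hom_value[OF Q(1)], rule tensor_power_pure) (use len r d in simp)
    then show "P (pure_tensor sA (as1 @ a # as2)) =
        B.replace_factor (length r) (length r1) (f a) (P (pure_tensor sA (as1 @ 1 # as2)))"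
      using 1(1) unfolding * hom_one d by (intro B.replace_insert_unit[symmetric])
  qed
qed

lemma D_space_iff:
  "P \<in> D_space sA sB f p \<longleftrightarrow>
    (\<forall>r. r \<notin> refinements p \<longrightarrow> P r = 0) \<and>
    (\<forall>r\<in>refinements p. P r \<in> tensor_hom sA sB (length r) (length r)) \<and>
    (\<forall>r\<in>refinements p. leibniz (\<lambda>r as. P r (pure_tensor sA as)) r) \<and>
    (\<forall>r\<in>refinements p. inserts_at_zeros r (\<lambda>as. P r (pure_tensor sA as)))"
proof (cases "\<forall>r\<in>refinements p. P r \<in> tensor_hom sA sB (length r) (length r)")
  case True
  then have eq: "(\<forall>r\<in>refinements p. inserts_at_zeros r (\<lambda>as. P r (pure_tensor sA as))) \<longleftrightarrow>
    (\<forall>r\<in>refinements p. \<forall>i<length r. r ! i = 0 \<longrightarrow>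
      (\<exists>Q\<in>tensor_hom sA sB (length r - 1) (length r - 1). \<forall>as. length as = length r \<longrightarrow>
        P r (pure_tensor sA as) = insert_factor sB (length r) i (f (as ! i))
          (Q (pure_tensor sA (take i as @ drop (Suc i) as)))))"
    by (intro ball_cong refl inserts_at_zeros_iff) (rule bspec)
  show ?thesis
    unfolding D_space_def mem_Collect_eq leibniz_iff eq by (rule refl)
next
  case False
  show ?thesis unfolding D_space_def mem_Collect_eq by (simp only: False simp_thms)
qed

lemma D_spaceD:
  assumes "P \<in> D_space sA sB f p"
  shows "r \<notin> refinements p \<Longrightarrow> P r = 0"
    and "r \<in> refinements p \<Longrightarrow> P r \<in> tensor_hom sA sB (length r) (length r)"
    and "r \<in> refinements p \<Longrightarrow> leibniz (\<lambda>r as. P r (pure_tensor sA as)) r"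
    and "r \<in> refinements p \<Longrightarrow> inserts_at_zeros r (\<lambda>as. P r (pure_tensor sA as))"
  using assms unfolding D_space_iff by blast+

lemma leibniz_cong:
  assumes "leibniz g r"
    and "\<And>as. length as = length r \<Longrightarrow> g r as = h r as"
    and "\<And>r1 k l r2 as. r = r1 @ (k + l) # r2 \<Longrightarrow> k > 0 \<Longrightarrow> l > 0 \<Longrightarrow> length as = Suc (length r) \<Longrightarrow>
      g (r1 @ k # l # r2) as = h (r1 @ k # l # r2) as"
  shows "leibniz h r"
  unfolding leibniz_def
proof (intro allI impI)
  fix r1 m r2 and as1 as2 :: "'a list" and x y :: 'a
  assume r: "r = r1 @ m # r2" and m: "m > 0"
    and len: "length as1 = length r1" "length as2 = length r2"
  have h: "h r (as1 @ z # as2) = g r (as1 @ z # as2)" for z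
    using len r by (intro assms(2)[symmetric]) simp
  have hk: "h (r1 @ k # (m - k) # r2) (as1 @ x # y # as2) =
      g (r1 @ k # (m - k) # r2) (as1 @ x # y # as2)" if "k \<in> {1..<m}" for k
    using len r that by (intro assms(3)[symmetric]) auto
  show "h r (as1 @ (x * y) # as2) =
      lmult sB (length r) (length r1) (f x) (h r (as1 @ y # as2)) +
      rmult sB (length r) (length r1) (f y) (h r (as1 @ x # as2)) +
      (\<Sum>k\<in>{1..<m}. merge sB (length r) (length r1)
        (h (r1 @ k # (m - k) # r2) (as1 @ x # y # as2)))"
    unfolding h using assms(1)[unfolded leibniz_def, rule_format, OF r m len] hk by simp
qed

lemma inserts_at_zeros_cong:
  assumes "inserts_at_zeros r F" "\<And>as. length as = length r \<Longrightarrow> F as = G as"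
  shows "inserts_at_zeros r G"
  unfolding inserts_at_zeros_def
proof (intro allI impI)
  fix r1 r2 and as1 as2 :: "'a list" and a :: 'a
  assume r: "r = r1 @ 0 # r2" and len: "length as1 = length r1" "length as2 = length r2"
  have G: "G (as1 @ z # as2) = F (as1 @ z # as2)" for z
    using len r by (intro assms(2)[symmetric]) simp
  show "G (as1 @ a # as2) = B.replace_factor (length r) (length r1) (f a) (G (as1 @ 1 # as2))"
    unfolding G by (rule assms(1)[unfolded inserts_at_zeros_def, rule_format, OF r len])
qed

text \<open>
  Families are constructed from multilinear maps.  The components \<open>g r\<close> at lists of a wrong length, or
  for \<open>r\<close> that is not a refinement, have to be discarded; splitting a part of a refinement gives a
  refinement, so the Leibniz rules are not affected.
\<close>

lemma D_space_of_components:
  assumes "\<And>r. r \<in> refinements p \<Longrightarrow> jet_component g r"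
  shows "\<exists>P\<in>D_space sA sB f p. \<forall>r\<in>refinements p. \<forall>as. length as = length r \<longrightarrow>
    P r (pure_tensor sA as) = g r as"
proof -
  have "\<exists>P\<in>tensor_hom sA sB (length r) (length r). \<forall>as. length as = length r \<longrightarrow>
      P (pure_tensor sA as) = g r as" if "r \<in> refinements p" for r
    using assms[OF that] unfolding jet_component_def tensor_multilinear_def
    by (intro tensor_hom_of_multilinear[OF vector_space_sA]) auto
  then obtain P where P: "\<And>r. r \<in> refinements p \<Longrightarrow> P r \<in> tensor_hom sA sB (length r) (length r)"
    "\<And>r as. r \<in> refinements p \<Longrightarrow> length as = length r \<Longrightarrow> P r (pure_tensor sA as) = g r as"
    by metis
  define P' where "P' r = (if r \<in> refinements p then P r else 0)" for r
  have P': "P' r (pure_tensor sA as) = g r as" if "r \<in> refinements p" "length as = length r" for r as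
    using that P(2) by (simp add: P'_def)
  have "leibniz (\<lambda>r as. P' r (pure_tensor sA as)) r" if r: "r \<in> refinements p" for r
  proof (rule leibniz_cong[of g])
    show "leibniz g r" using assms[OF r] by (simp add: jet_component_def)
    show "g r as = P' r (pure_tensor sA as)" if "length as = length r" for as
      using P'[OF r that] by simp
    show "g (r1 @ k # l # r2) as = P' (r1 @ k # l # r2) (pure_tensor sA as)"
      if "r = r1 @ (k + l) # r2" "k > 0" "l > 0" "length as = Suc (length r)" for r1 k l r2 as
      using that r by (intro P'[symmetric] refinement_split) auto
  qed
  moreover have "inserts_at_zeros r (\<lambda>as. P' r (pure_tensor sA as))" if r: "r \<in> refinements p" for r
  proof (rule inserts_at_zeros_cong[of r "g r"])
    show "inserts_at_zeros r (g r)" using assms[OF r] by (simp add: jet_component_def)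
  qed (simp add: P'[OF r])
  ultimately have "P' \<in> D_space sA sB f p"
    unfolding D_space_iff using P(1) by (simp add: P'_def)
  then show ?thesis using P' by blast
qed

lemma D_space_combination:
  assumes P: "P \<in> D_space sA sB f p" and Q: "Q \<in> D_space sA sB f p"
  shows "fscale c P + Q \<in> D_space sA sB f p"
proof -
  have scale_sum: "tscale c (sum h S) = (\<Sum>i\<in>S. tscale c (h i))" for h :: "nat \<Rightarrow> ('k, 'b) tensor" and S
    by (rule linear_sumD[OF tensor_linear_tscale])
  have at: "(fscale c P + Q) r = (\<lambda>T. tscale c (P r T)) + Q r"
    "(fscale c P + Q) r T = tscale c (P r T) + Q r T" for r T
    by (simp_all only: plus_fun_apply fscale_def)
  have "(fscale c P + Q) r = 0" if "r \<notin> refinements p" for r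
  proof -
    have "tscale c (P r T) + Q r T = 0" for T
      using D_spaceD(1)[OF P that] D_spaceD(1)[OF Q that] by (simp add: tscale_def fun_eq_iff)
    then show ?thesis by (intro ext[of "(fscale c P + Q) r"]) (simp only: at(2) zero_fun_apply)
  qed
  moreover have "(fscale c P + Q) r \<in> tensor_hom sA sB (length r) (length r)"
    if "r \<in> refinements p" for r
    unfolding at(1) by (intro add_in_tensor_hom scale_in_tensor_hom D_spaceD(2)[OF P that]
        D_spaceD(2)[OF Q that])
  moreover have "leibniz (\<lambda>r as. (fscale c P + Q) r (pure_tensor sA as)) r"
    if r: "r \<in> refinements p" for r
    unfolding leibniz_def at(2)
  proof (intro allI impI)
    fix r1 m r2 and as1 as2 :: "'a list" and x y :: 'a
    assume *: "r = r1 @ m # r2" "m > 0" "length as1 = length r1" "length as2 = length r2"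
    let ?C = "\<lambda>r as. tscale c (P r (pure_tensor sA as)) + Q r (pure_tensor sA as)"
    show "?C r (as1 @ (x * y) # as2) =
        lmult sB (length r) (length r1) (f x) (?C r (as1 @ y # as2)) +
        rmult sB (length r) (length r1) (f y) (?C r (as1 @ x # as2)) +
        (\<Sum>k\<in>{1..<m}. merge sB (length r) (length r1) (?C (r1 @ k # (m - k) # r2) (as1 @ x # y # as2)))"
      unfolding D_spaceD(3)[OF P r, unfolded leibniz_def, rule_format, OF *]
        D_spaceD(3)[OF Q r, unfolded leibniz_def, rule_format, OF *]
      by (simp only: linear_addD[OF tensor_linear_lmult] linear_addD[OF tensor_linear_rmult]
          linear_addD[OF tensor_linear_merge] linear_scaleD[OF tensor_linear_lmult]
          linear_scaleD[OF tensor_linear_rmult] linear_scaleD[OF tensor_linear_merge]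
          linear_addD[OF tensor_linear_tscale] scale_sum sum.distrib ac_simps)
  qed
  moreover have "inserts_at_zeros r (\<lambda>as. (fscale c P + Q) r (pure_tensor sA as))"
    if r: "r \<in> refinements p" for r
    unfolding inserts_at_zeros_def at(2)
  proof (intro allI impI)
    fix r1 r2 and as1 as2 :: "'a list" and a :: 'a
    assume *: "r = r1 @ 0 # r2" "length as1 = length r1" "length as2 = length r2"
    show "tscale c (P r (pure_tensor sA (as1 @ a # as2))) + Q r (pure_tensor sA (as1 @ a # as2)) =
      B.replace_factor (length r) (length r1) (f a)
        (tscale c (P r (pure_tensor sA (as1 @ 1 # as2))) + Q r (pure_tensor sA (as1 @ 1 # as2)))"
      unfolding linear_addD[OF B.tensor_linear_replace_factor]
        linear_scaleD[OF B.tensor_linear_replace_factor]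
      using D_spaceD(4)[OF P r, unfolded inserts_at_zeros_def, rule_format, OF *, of a]
        D_spaceD(4)[OF Q r, unfolded inserts_at_zeros_def, rule_format, OF *, of a] by argo
  qed
  ultimately show ?thesis unfolding D_space_iff by blast
qed

lemma subspace_D_space: "module.subspace fscale (D_space sA sB f p)"
proof -
  interpret V: vector_space "fscale :: 'k \<Rightarrow> ('k, 'a, 'b) family \<Rightarrow> _"
    by (rule vector_space_fscale)
  have zero: "0 \<in> D_space sA sB f p"
  proof -
    have "leibniz (\<lambda>r as. 0) r" for r
      by (simp only: leibniz_def linear_zeroD[OF tensor_linear_lmult]
          linear_zeroD[OF tensor_linear_rmult] linear_zeroD[OF tensor_linear_merge]
          sum.neutral_const add_0) simp
    moreover have "inserts_at_zeros r (\<lambda>as. 0)" for r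
      by (simp only: inserts_at_zeros_def linear_zeroD[OF B.tensor_linear_replace_factor]) simp
    moreover note zero_in_tensor_hom
    ultimately show ?thesis unfolding D_space_iff zero_fun_def by blast
  qed
  show ?thesis
  proof (rule V.subspaceI[OF zero])
    show "P + Q \<in> D_space sA sB f p" if "P \<in> D_space sA sB f p" "Q \<in> D_space sA sB f p" for P Q
      using D_space_combination[OF that, of 1] by (simp only: V.scale_one)
    show "fscale c P \<in> D_space sA sB f p" if "P \<in> D_space sA sB f p" for c P
      using D_space_combination[OF that zero, of c] by (simp only: add_0_right)
  qed
qed

end


section \<open>Lifting multiderivations\<close>

text \<open>
  The number of splits which lead to the finest refinement; the measure for the construction of
  lifts.
\<close>

definition excess :: "nat list \<Rightarrow> nat"
  where "excess p = sum_list (map (\<lambda>k. k - 1) p)"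

lemma excess_split: "a > 0 \<Longrightarrow> b > 0 \<Longrightarrow> excess (p @ a # b # q) < excess (p @ (a + b) # q)"
  by (simp add: excess_def)

context k_algebra_hom
begin

definition tensor_bilinear :: "nat \<Rightarrow> ('a \<Rightarrow> 'a \<Rightarrow> ('k, 'b) tensor) \<Rightarrow> bool"
  where "tensor_bilinear d K \<longleftrightarrow>
    (\<forall>v. Vector_Spaces.linear sA tscale (\<lambda>t. K t v)) \<and>
    (\<forall>t. Vector_Spaces.linear sA tscale (\<lambda>v. K t v)) \<and>
    (\<forall>t v. K t v \<in> tensor_power sB d)"

definition expand_map :: "nat \<Rightarrow> nat \<Rightarrow> ('a \<Rightarrow> 'a \<Rightarrow> ('k, 'b) tensor) \<Rightarrow> 'a list \<Rightarrow> ('k, 'b) tensor"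
  where "expand_map d j K l = lmult sB d j (f (l ! 0)) (merge sB d j (K (l ! 1) (l ! 2)))"

text \<open>
  For \<open>\<theta> = \<Sum> w \<otimes> t \<otimes> v\<close> this is \<open>\<Sum> f w \<cdot>\<^sub>j m\<^bsub>j\<^esub> (K t v)\<close>.  Applied to the value at \<open>a\<close> of a
  splitting derivation, it replaces an argument \<open>a\<close> of a part \<open>n\<close> by two arguments \<open>t, v\<close> of parts
  \<open>1\<close> and \<open>n - 1\<close>.
\<close>

definition expand :: "nat \<Rightarrow> nat \<Rightarrow> ('a \<Rightarrow> 'a \<Rightarrow> ('k, 'b) tensor) \<Rightarrow> ('k, 'a) tensor \<Rightarrow> ('k, 'b) tensor"
  where "expand d j K \<theta> = contract \<theta> (expand_map d j K)"

lemma tensor_bilinear_op: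
  assumes "tensor_bilinear d K" "tensor_linear L"
    "\<And>X. X \<in> tensor_power sB d \<Longrightarrow> L X \<in> tensor_power sB e"
  shows "tensor_bilinear e (\<lambda>t v. L (K t v))"
  unfolding tensor_bilinear_def
proof (intro conjI allI)
  have K: "Vector_Spaces.linear sA tscale (\<lambda>t. K t v)" "Vector_Spaces.linear sA tscale (\<lambda>v. K t v)"
    "K t v \<in> tensor_power sB d" for t v
    using assms(1) by (simp_all add: tensor_bilinear_def)
  show "Vector_Spaces.linear sA tscale (\<lambda>t. L (K t v))" for v
    by (rule linear_compose_field[OF K(1) assms(2)])
  show "Vector_Spaces.linear sA tscale (\<lambda>v. L (K t v))" for t
    by (rule linear_compose_field[OF K(2) assms(2)])
  show "L (K t v) \<in> tensor_power sB e" for t v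
    by (rule assms(3)[OF K(3)])
qed

lemma tensor_bilinear_slice:
  assumes "tensor_multilinear (Suc d) F" "Suc (length as1 + length as2) = d"
  shows "tensor_bilinear (Suc d) (\<lambda>t v. F (as1 @ t # v # as2))"
  unfolding tensor_bilinear_def
proof (intro conjI allI)
  have ml: "multilinear sA tscale (Suc d) F" using assms(1) by (simp add: tensor_multilinear_def)
  show "Vector_Spaces.linear sA tscale (\<lambda>t. F (as1 @ t # v # as2))" for v
    by (rule multilinearD[OF ml]) (use assms(2) in simp)
  have "Vector_Spaces.linear sA tscale (\<lambda>v. F ((as1 @ [t]) @ v # as2))" for t
    by (rule multilinearD[OF ml]) (use assms(2) in simp)
  then show "Vector_Spaces.linear sA tscale (\<lambda>v. F (as1 @ t # v # as2))" for t by simp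
  show "F (as1 @ t # v # as2) \<in> tensor_power sB (Suc d)" for t v
    using assms by (simp add: tensor_multilinear_def)
qed

lemma expand_map_multilinear:
  assumes "tensor_bilinear (Suc d) K" "j < d"
  shows "multilinear sA tscale 3 (expand_map d j K)"
proof -
  have K: "Vector_Spaces.linear sA tscale (\<lambda>t. K t v)" "Vector_Spaces.linear sA tscale (\<lambda>v. K t v)"
    "merge sB d j (K t v) \<in> tensor_power sB d" for t v
    using assms by (auto simp: tensor_bilinear_def intro!: B.merge_in)
  have 1: "Vector_Spaces.linear sA tscale (\<lambda>x. lmult sB d j (f x) (merge sB d j (K t v)))" for t v
    by (rule linear_compose_field[OF hom_linear B.linear_lmult_parameter[OF K(3) assms(2)]])
  have 2: "tensor_linear (\<lambda>X. lmult sB d j c (merge sB d j X))" for c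
    by (rule linear_compose_field[OF tensor_linear_merge tensor_linear_lmult])
  show ?thesis
    unfolding multilinear_3_iff
    using 1 linear_compose_field[OF K(1) 2] linear_compose_field[OF K(2) 2]
    by (simp add: expand_map_def)
qed

lemma expand_in:
  assumes "\<theta> \<in> tensor_power sA 3" "tensor_bilinear (Suc d) K" "j < d"
  shows "expand d j K \<theta> \<in> tensor_power sB d"
  unfolding expand_def
proof (rule contract_in_tensor_power[OF assms(1) expand_map_multilinear[OF assms(2,3)]])
  show "expand_map d j K xs \<in> tensor_power sB d" for xs
    unfolding expand_map_def using assms(2,3)
    by (intro B.lmult_in B.merge_in) (auto simp: tensor_bilinear_def)
qed

lemma expand_add:
  assumes "\<theta> \<in> tensor_power sA 3" "tensor_bilinear (Suc d) K" "tensor_bilinear (Suc d) K'" "j < d"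
  shows "expand d j (\<lambda>t v. K t v + K' t v) \<theta> = expand d j K \<theta> + expand d j K' \<theta>"
proof -
  have "expand_map d j (\<lambda>t v. K t v + K' t v) = (\<lambda>l. expand_map d j K l + expand_map d j K' l)"
    unfolding expand_map_def linear_addD[OF tensor_linear_merge] linear_addD[OF tensor_linear_lmult] ..
  then show ?thesis
    unfolding expand_def
    using contract_add_right[OF assms(1) expand_map_multilinear[OF assms(2,4)]
        expand_map_multilinear[OF assms(3,4)]] by (simp only:)
qed

lemma tensor_bilinear_sum:
  assumes "\<And>k. k \<in> I \<Longrightarrow> tensor_bilinear d (K k)"
  shows "tensor_bilinear d (\<lambda>t v. \<Sum>k\<in>I. K k t v)"
  using assms
proof (induction I rule: infinite_finite_induct)
  case (insert k I)
  then have "tensor_bilinear d (K k)" "tensor_bilinear d (\<lambda>t v. \<Sum>k\<in>I. K k t v)" by auto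
  then have "tensor_bilinear d (\<lambda>t v. K k t v + (\<Sum>k\<in>I. K k t v))"
    unfolding tensor_bilinear_def by (auto intro: linear_plus tensor_power_add)
  then show ?case by (simp only: sum.insert[OF insert(1,2)])
qed (simp_all only: sum.infinite sum.empty tensor_bilinear_def tensor_power_zero
    linear_const_zero[OF vector_space_sA vector_space_tscale] simp_thms)

lemma expand_sum:
  assumes "\<theta> \<in> tensor_power sA 3" "\<And>k. k \<in> I \<Longrightarrow> tensor_bilinear (Suc d) (K k)" "finite I" "j < d"
  shows "expand d j (\<lambda>t v. \<Sum>k\<in>I. K k t v) \<theta> = (\<Sum>k\<in>I. expand d j (K k) \<theta>)"
proof -
  have "expand_map d j (\<lambda>t v. \<Sum>k\<in>I. K k t v) = (\<lambda>l. \<Sum>k\<in>I. expand_map d j (K k) l)"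
    unfolding expand_map_def linear_sumD[OF tensor_linear_merge] linear_sumD[OF tensor_linear_lmult] ..
  then show ?thesis
    unfolding expand_def
    using contract_sum_right[OF assms(1) expand_map_multilinear[OF assms(2,4)] assms(3) vector_space_sA]
    by (simp only: simp_thms)
qed

text \<open>
  Operations which commute with \<open>lmult d j c \<circ> merge d j\<close> pass through \<open>expand\<close>, because contraction is
  compatible with linear maps.
\<close>

lemma expand_op:
  assumes "\<theta> \<in> tensor_power sA 3" "tensor_bilinear (Suc d') K" "j < d'" "tensor_linear L"
    and "\<And>X c. X \<in> tensor_power sB (Suc d') \<Longrightarrow>
      L (lmult sB d' j c (merge sB d' j X)) = lmult sB d j c (merge sB d j (L' X))"
  shows "L (expand d' j K \<theta>) = expand d j (\<lambda>t v. L' (K t v)) \<theta>"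
  unfolding expand_def contract_linear[OF assms(1) expand_map_multilinear[OF assms(2,3)] assms(4)]
proof (rule contract_cong[OF assms(1)])
  show "L (expand_map d' j K xs) = expand_map d j (\<lambda>t v. L' (K t v)) xs" for xs
    unfolding expand_map_def using assms(2) by (intro assms(5)) (simp add: tensor_bilinear_def)
qed

lemma expand_lmult_argument:
  assumes "\<theta> \<in> tensor_power sA 3" "tensor_bilinear (Suc d) K" "j < d"
  shows "expand d j K (lmult sA 3 0 x \<theta>) = lmult sB d j (f x) (expand d j K \<theta>)"
proof -
  note ml = expand_map_multilinear[OF assms(2,3)]
  have K: "merge sB d j (K t v) \<in> tensor_power sB d" for t v
    using assms by (auto simp: tensor_bilinear_def intro!: B.merge_in)
  have "expand d j K (lmult sA 3 0 x \<theta>) = contract \<theta> (\<lambda>l. expand_map d j K (l[0 := x * l ! 0]))"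
    unfolding expand_def lmult_def[of sA] by (rule contract_tensor_map[OF ml])
  also have "\<dots> = contract \<theta> (\<lambda>l. lmult sB d j (f x) (expand_map d j K l))"
    by (rule contract_cong[OF assms(1)])
      (auto simp: expand_map_def length_3_iff hom_mult B.lmult_lmult[OF K assms(3)])
  also have "\<dots> = lmult sB d j (f x) (expand d j K \<theta>)"
    unfolding expand_def by (rule contract_linear[OF assms(1) ml tensor_linear_lmult, symmetric])
  finally show ?thesis .
qed

lemma expand_rmult_argument:
  assumes "\<theta> \<in> tensor_power sA 3" "tensor_bilinear (Suc d) K" "j < d"
  shows "expand d j K (rmult sA 3 2 y \<theta>) = expand d j (\<lambda>t v. K t (v * y)) \<theta>"
proof -
  have "expand d j K (rmult sA 3 2 y \<theta>) = contract \<theta> (\<lambda>l. expand_map d j K (l[2 := l ! 2 * y]))"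
    unfolding expand_def rmult_def[of sA] by (rule contract_tensor_map[OF expand_map_multilinear[OF assms(2,3)]])
  also have "\<dots> = expand d j (\<lambda>t v. K t (v * y)) \<theta>"
    unfolding expand_def by (rule contract_cong[OF assms(1)]) (simp add: expand_map_def)
  finally show ?thesis .
qed

text \<open>
  An argument of another part does not take part in the expansion, so its Leibniz rule passes
  through.  Its factor has the index \<open>i'\<close> before the factors \<open>j\<close> and \<open>j + 1\<close> are merged, and \<open>i\<close>
  afterwards.
\<close>

lemma expand_leibniz:
  assumes \<theta>: "\<theta> \<in> tensor_power sA 3"
    and K: "tensor_bilinear (Suc d) Kx" "tensor_bilinear (Suc d) Ky"
    and M: "\<And>k. k \<in> I \<Longrightarrow> tensor_bilinear (Suc (Suc d)) (M k)" and I: "finite I"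
    and j: "j < d" and i': "i' < Suc d"
    and eq: "\<And>t v. Kxy t v = lmult sB (Suc d) i' b (Ky t v) + rmult sB (Suc d) i' c (Kx t v) +
      (\<Sum>k\<in>I. merge sB (Suc d) i' (M k t v))"
    and comm: "\<And>h X a. Vector_Spaces.linear sB sB h \<Longrightarrow> X \<in> tensor_power sB (Suc d) \<Longrightarrow>
      B.factor_map d i h (lmult sB d j a (merge sB d j X)) =
      lmult sB d j a (merge sB d j (B.factor_map (Suc d) i' h X))"
    and comm_m: "\<And>X a. I \<noteq> {} \<Longrightarrow> X \<in> tensor_power sB (Suc (Suc d)) \<Longrightarrow>
      merge sB d i (lmult sB (Suc d) j a (merge sB (Suc d) j X)) =
      lmult sB d j a (merge sB d j (merge sB (Suc d) i' X))"
  shows "expand d j Kxy \<theta> = lmult sB d i b (expand d j Ky \<theta>) + rmult sB d i c (expand d j Kx \<theta>) +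
    (\<Sum>k\<in>I. merge sB d i (expand (Suc d) j (M k) \<theta>))"
proof -
  note comm_l = comm[OF B.linear_mult_left, folded B.lmult_eq_factor_map]
    and comm_r = comm[OF B.linear_mult_right, folded B.rmult_eq_factor_map]
  have Kl: "tensor_bilinear (Suc d) (\<lambda>t v. lmult sB (Suc d) i' b (Ky t v))"
    by (rule tensor_bilinear_op[OF K(2) tensor_linear_lmult B.lmult_in[OF _ i']])
  have Kr: "tensor_bilinear (Suc d) (\<lambda>t v. rmult sB (Suc d) i' c (Kx t v))"
    by (rule tensor_bilinear_op[OF K(1) tensor_linear_rmult B.rmult_in[OF _ i']])
  have Km: "tensor_bilinear (Suc d) (\<lambda>t v. merge sB (Suc d) i' (M k t v))" if "k \<in> I" for k
    by (rule tensor_bilinear_op[OF M[OF that] tensor_linear_merge B.merge_in[OF _ i']])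
  have Klr: "tensor_bilinear (Suc d) (\<lambda>t v. lmult sB (Suc d) i' b (Ky t v) + rmult sB (Suc d) i' c (Kx t v))"
    using Kl Kr unfolding tensor_bilinear_def by (auto intro: linear_plus tensor_power_add)
  have "Kxy = (\<lambda>t v. lmult sB (Suc d) i' b (Ky t v) + rmult sB (Suc d) i' c (Kx t v) +
      (\<Sum>k\<in>I. merge sB (Suc d) i' (M k t v)))" by (intro ext[of Kxy] ext eq)
  then have "expand d j Kxy \<theta> =
      expand d j (\<lambda>t v. lmult sB (Suc d) i' b (Ky t v)) \<theta> +
      expand d j (\<lambda>t v. rmult sB (Suc d) i' c (Kx t v)) \<theta> +
      (\<Sum>k\<in>I. expand d j (\<lambda>t v. merge sB (Suc d) i' (M k t v)) \<theta>)"
    by (simp only: expand_add[OF \<theta> Klr tensor_bilinear_sum[OF Km] j] expand_add[OF \<theta> Kl Kr j]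
        expand_sum[OF \<theta> Km I j])
  also have "expand d j (\<lambda>t v. lmult sB (Suc d) i' b (Ky t v)) \<theta> = lmult sB d i b (expand d j Ky \<theta>)"
    by (rule expand_op[OF \<theta> K(2) j tensor_linear_lmult comm_l, symmetric])
  also have "expand d j (\<lambda>t v. rmult sB (Suc d) i' c (Kx t v)) \<theta> = rmult sB d i c (expand d j Kx \<theta>)"
    by (rule expand_op[OF \<theta> K(1) j tensor_linear_rmult comm_r, symmetric])
  also have "(\<Sum>k\<in>I. expand d j (\<lambda>t v. merge sB (Suc d) i' (M k t v)) \<theta>) =
      (\<Sum>k\<in>I. merge sB d i (expand (Suc d) j (M k) \<theta>))"
  proof (rule sum.cong[OF refl])
    fix k assume k: "k \<in> I"
    then have "I \<noteq> {}" by blast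
    show "expand d j (\<lambda>t v. merge sB (Suc d) i' (M k t v)) \<theta> =
        merge sB d i (expand (Suc d) j (M k) \<theta>)"
      by (rule expand_op[OF \<theta> M[OF k] _ tensor_linear_merge comm_m[OF \<open>I \<noteq> {}\<close>], symmetric])
        (use j in simp)
  qed
  finally show ?thesis .
qed

lemma lmult_one: "X \<in> tensor_power sB d \<Longrightarrow> i < d \<Longrightarrow> lmult sB d i 1 X = X"
  by (rule linear_eq_on_tensor_power[OF _ tensor_linear_lmult B.tensor_linear_id])
    (auto simp: B.lmult_pure)

lemma rmult_one: "X \<in> tensor_power sB d \<Longrightarrow> i < d \<Longrightarrow> rmult sB d i 1 X = X"
  by (rule linear_eq_on_tensor_power[OF _ tensor_linear_rmult B.tensor_linear_id])
    (auto simp: B.rmult_pure)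

text \<open>
  The bimodule map \<open>\<Omega>\<^sup>1 \<rightarrow> M\<close> which corresponds to a derivation \<open>D : A \<rightarrow> M\<close> takes \<open>\<Sum> w d t v = d a\<close>
  to \<open>D a\<close>.  Explicitly, \<open>w D(t) v = w D(t v) - w t D(v)\<close>; summing over \<open>\<Theta> a\<close>, the second term vanishes
  because \<open>\<Sum> w t \<otimes> v = 0\<close>, and the first gives \<open>1 D(a) - a D(1) = D(a)\<close> because
  \<open>\<Sum> w \<otimes> t v = 1 \<otimes> a - a \<otimes> 1\<close>.
\<close>

lemma contract_splitting_derivation:
  assumes \<Theta>: "A.splitting_derivation \<Theta>" and j: "j < e"
    and lin: "Vector_Spaces.linear sA tscale D" and val: "\<And>t. D t \<in> tensor_power sB e"
    and der: "\<And>t u. D (t * u) = lmult sB e j (f t) (D u) + rmult sB e j (f u) (D t)"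
  shows "multilinear sA tscale 3 (\<lambda>l. lmult sB e j (f (l ! 0)) (rmult sB e j (f (l ! 2)) (D (l ! 1))))"
    and "contract (\<Theta> a) (\<lambda>l. lmult sB e j (f (l ! 0)) (rmult sB e j (f (l ! 2)) (D (l ! 1)))) = D a"
proof -
  have \<theta>: "\<Theta> a \<in> tensor_power sA 3"
    and right: "merge sA 2 1 (\<Theta> a) = pure_tensor sA [1, a] - pure_tensor sA [a, 1]"
    and left: "merge sA 2 0 (\<Theta> a) = 0"
    using \<Theta> by (auto simp: A.splitting_derivation_def)
  let ?F = "\<lambda>l. lmult sB e j (f (l ! 0)) (rmult sB e j (f (l ! 2)) (D (l ! 1)))"
  let ?S = "\<lambda>l. lmult sB e j (f (l ! 0)) (D (l ! 1))"
  let ?F1 = "\<lambda>l. ?S [l ! 0, l ! 1 * l ! 2]" and ?F2 = "\<lambda>l. ?S [l ! 0 * l ! 1, l ! 2]"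
  have l1: "Vector_Spaces.linear sA tscale (\<lambda>c. lmult sB e j (f c) (D u))" for u
    by (rule linear_compose_field[OF hom_linear B.linear_lmult_parameter[OF val j]])
  have l2: "Vector_Spaces.linear sA tscale (\<lambda>u. lmult sB e j c (D u))" for c
    by (rule linear_compose_field[OF lin tensor_linear_lmult])
  have S: "multilinear sA tscale 2 ?S"
    unfolding multilinear_2_iff using l1 l2 by simp
  have F1: "multilinear sA tscale 3 ?F1"
    unfolding multilinear_3_iff
    using l1 linear_compose_field[OF A.linear_mult_right l2] linear_compose_field[OF A.linear_mult_left l2]
    by simp
  have F2: "multilinear sA tscale 3 ?F2"
    unfolding multilinear_3_iff
    using l2 linear_compose_field[OF A.linear_mult_right l1] linear_compose_field[OF A.linear_mult_left l1]
    by simp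
  have F: "?F l = ?F1 l - ?F2 l" if "length l = 3" for l
  proof -
    have "rmult sB e j (f (l ! 2)) (D (l ! 1)) = D (l ! 1 * l ! 2) - lmult sB e j (f (l ! 1)) (D (l ! 2))"
      unfolding der by (simp only: add_diff_cancel_left')
    then have "?F l = lmult sB e j (f (l ! 0)) (D (l ! 1 * l ! 2)) -
        lmult sB e j (f (l ! 0)) (lmult sB e j (f (l ! 1)) (D (l ! 2)))"
      by (simp only: linear_diffD[OF tensor_linear_lmult])
    then show ?thesis by (simp add: hom_mult B.lmult_lmult[OF val j])
  qed
  have F': "multilinear sA tscale 3 ?F"
  proof -
    have "multilinear sA tscale 3 (\<lambda>l. ?F1 l + tscale (- 1) (?F2 l))"
      by (rule multilinear_add[OF F1 multilinear_compose_linear[OF F2 tensor_linear_tscale]])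
    moreover have "?F l = ?F1 l + tscale (- 1) (?F2 l)" if "length l = 3" for l
      unfolding F[OF that] by (simp add: tscale_def fun_eq_iff)
    then have "multilinear sA tscale 3 ?F \<longleftrightarrow>
        multilinear sA tscale 3 (\<lambda>l. ?F1 l + tscale (- 1) (?F2 l))" by (rule multilinear_cong)
    ultimately show ?thesis by blast
  qed
  have "D 1 = D 1 + D 1"
    using der[of 1 1] by (simp only: hom_one lmult_one[OF val j] rmult_one[OF val j] mult_1)
  then have D1: "D 1 = 0" by (rule add_cancel_right_right[THEN iffD1])
  have "contract (\<Theta> a) ?F1 = contract (\<Theta> a) (\<lambda>l. ?F l + ?F2 l)"
    by (rule contract_cong[OF \<theta>]) (simp only: F diff_add_cancel)
  also have "\<dots> = contract (\<Theta> a) ?F + contract (\<Theta> a) ?F2"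
    by (rule contract_add_right[OF \<theta> F' F2])
  also have "contract (\<Theta> a) ?F2 = contract (merge sA 2 0 (\<Theta> a)) ?S"
    unfolding merge_def
    by (subst contract_tensor_map[OF S], rule contract_cong[OF \<theta>]) (auto simp: length_3_iff)
  also have "\<dots> = 0" unfolding left by (rule contract_zero_left)
  finally have "contract (\<Theta> a) ?F = contract (\<Theta> a) ?F1" by (simp only: add_0_right)
  also have "\<dots> = contract (merge sA 2 1 (\<Theta> a)) ?S"
    unfolding merge_def
    by (subst contract_tensor_map[OF S], rule contract_cong[OF \<theta>]) (auto simp: length_3_iff)
  also have "\<dots> = ?S [1, a] - ?S [a, 1]"
    unfolding right contract_diff_left
    using contract_pure[of sA "[1, a]" ?S] contract_pure[of sA "[a, 1]" ?S] S
    by (simp only: list.size One_nat_def[symmetric] one_add_one add_0 simp_thms)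
  also have "\<dots> = D a"
    by (simp only: nth_Cons_0 nth_Cons_Suc One_nat_def hom_one lmult_one[OF val j] D1
        linear_zeroD[OF tensor_linear_lmult] diff_0_right)
  finally show "contract (\<Theta> a) ?F = D a" .
  show "multilinear sA tscale 3 ?F" by (rule F')
qed

text \<open>
  The lift of a multiderivation \<open>G\<close>, the component at the finest refinement of \<open>p\<close>: each argument
  \<open>a\<close> at a part \<open>n \<ge> 2\<close> is expanded, by a splitting derivation, into two arguments at the parts
  \<open>1, n - 1\<close>, starting with the leftmost such part.
\<close>

function lift :: "('a \<Rightarrow> ('k, 'a) tensor) \<Rightarrow> ('a list \<Rightarrow> ('k, 'b) tensor) \<Rightarrow> nat list \<Rightarrow>
    'a list \<Rightarrow> ('k, 'b) tensor" where
  "lift \<Theta> G p = (case dropWhile (\<lambda>k. k \<le> 1) p of [] \<Rightarrow> G | k # r \<Rightarrow>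
    (let zs = takeWhile (\<lambda>k. k \<le> 1) p; j = length zs; h = lift \<Theta> G (zs @ 1 # (k - 1) # r) in
    (\<lambda>as. expand (length p) j (\<lambda>t v. h (take j as @ t # v # drop (Suc j) as)) (\<Theta> (as ! j)))))"
  by pat_completeness auto
termination
proof (relation "measure (\<lambda>(\<Theta>, G, p). excess p)")
  fix p r zs :: "nat list" and k j :: nat and \<Theta> :: "'a \<Rightarrow> ('k, 'a) tensor" and G :: "'a list \<Rightarrow> ('k, 'b) tensor"
  assume d: "dropWhile (\<lambda>k. k \<le> 1) p = k # r" and zs: "zs = takeWhile (\<lambda>k. k \<le> 1) p"
  have p: "p = zs @ k # r" using d zs by (metis takeWhile_dropWhile_id)
  have "\<not> k \<le> 1" using d unfolding dropWhile_eq_Cons_conv by blast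
  then have "excess (zs @ 1 # (k - 1) # r) < excess (zs @ (1 + (k - 1)) # r)"
    by (intro excess_split) auto
  then show "((\<Theta>, G, zs @ 1 # (k - 1) # r), (\<Theta>, G, p)) \<in> measure (\<lambda>(\<Theta>, G, p). excess p)"
    using \<open>\<not> k \<le> 1\<close> by (simp add: p)
qed simp

declare lift.simps [simp del]

lemma lift_finest: "\<forall>k\<in>set p. k \<le> 1 \<Longrightarrow> lift \<Theta> G p = G"
proof -
  assume "\<forall>k\<in>set p. k \<le> 1"
  then have "dropWhile (\<lambda>k. k \<le> 1) p = []" by simp
  then show ?thesis by (subst lift.simps) (simp only: list.case)
qed

lemma lift_expand:
  assumes "\<forall>k\<in>set zs. k \<le> 1" "length as1 = length zs"
  shows "lift \<Theta> G (zs @ Suc (Suc n) # r) (as1 @ a # as2) =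
    expand (Suc (length zs + length r)) (length zs)
      (\<lambda>t v. lift \<Theta> G (zs @ 1 # Suc n # r) (as1 @ t # v # as2)) (\<Theta> a)"
proof -
  have "dropWhile (\<lambda>k. k \<le> 1) (zs @ Suc (Suc n) # r) = Suc (Suc n) # r"
    "takeWhile (\<lambda>k. k \<le> 1) (zs @ Suc (Suc n) # r) = zs"
    using assms(1) by (auto simp: dropWhile_append3 takeWhile_tail)
  then show ?thesis using assms(2) by (subst lift.simps) (simp add: Let_def nth_append)
qed

end


context k_algebra_hom
begin

text \<open>
  The Leibniz rule of the lift at its first part \<open>n + 2\<close>, the fact \<open>middle\<close> below, is the computation in
  the introduction: the term \<open>K1\<close>, with a multiplication by \<open>f v\<close> from the left at the second of the two
  new factors, becomes the summand with parts \<open>1, n + 1\<close> of the rule at \<open>n + 2\<close>, and the summands \<open>K3\<close> of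
  the rule at \<open>n + 1\<close> become the others.
\<close>

lemma jet_component_lift_step:
  assumes \<Theta>: "A.splitting_derivation \<Theta>" and zs: "\<forall>k\<in>set zs. k \<le> 1"
    and p: "p = zs @ Suc (Suc n) # r"
    and IH: "\<And>q. excess q < excess p \<Longrightarrow> finest_refinement q = finest_refinement p \<Longrightarrow>
      jet_component (lift \<Theta> G) q"
  shows "jet_component (lift \<Theta> G) p"
proof -
  define j d where "j = length zs" and "d = Suc (length zs + length r)"
  have len_p: "length p = d" and jd: "j < d" by (simp_all add: p d_def j_def)
  let ?l = "lift \<Theta> G"
  define p' where "p' = zs @ 1 # Suc n # r"
  have len_p': "length p' = Suc d" by (simp add: p'_def d_def)
  have IH_split: "jet_component ?l (q1 @ a # b # q2)"
    if "excess (q1 @ (a + b) # q2) \<le> excess p"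
      "finest_refinement (q1 @ (a + b) # q2) = finest_refinement p" "a > 0" "b > 0" for q1 a b q2
    using excess_split[OF that(3,4), of q1 q2] that(1,2) finest_refinement_split[OF that(3,4)]
    by (intro IH) auto
  have jet': "jet_component ?l p'"
    unfolding p'_def by (rule IH_split) (simp_all add: p)
  then have tm': "tensor_multilinear (Suc d) (?l p')" and leib': "leibniz ?l p'"
    and ins': "inserts_at_zeros p' (?l p')"
    by (simp_all add: jet_component_def len_p')
  have ml': "multilinear sA tscale (Suc d) (?l p')" using tm' by (simp add: tensor_multilinear_def)
  have slice: "tensor_bilinear (Suc d) (\<lambda>t v. ?l p' (as1 @ t # v # as2))"
    if "Suc (length as1 + length as2) = d" for as1 as2
    by (rule tensor_bilinear_slice[OF tm' that])
  have unf: "?l p (as1 @ a # as2) = expand d j (\<lambda>t v. ?l p' (as1 @ t # v # as2)) (\<Theta> a)"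
    if "length as1 = j" for as1 a as2
    using lift_expand[OF zs, of as1 \<Theta> G n r a as2] that unfolding p p'_def d_def j_def by blast
  have \<theta>: "\<Theta> a \<in> tensor_power sA 3" and \<Theta>_lin: "Vector_Spaces.linear sA tscale \<Theta>"
    and \<Theta>_mult: "\<Theta> (x * y) = lmult sA 3 0 x (\<Theta> y) + rmult sA 3 2 y (\<Theta> x)" for a x y
    using \<Theta> by (auto simp: A.splitting_derivation_def)

  have vals: "?l p as \<in> tensor_power sB d" if len: "length as = d" for as
  proof -
    obtain as1 a as2 where as: "as = as1 @ a # as2" "length as1 = j"
      using split_at[of j as] len jd by auto
    show ?thesis unfolding as(1) unf[OF as(2)]
      by (rule expand_in[OF \<theta> slice jd]) (use len as in simp)
  qed

  have step_linear: "tensor_linear (\<lambda>X. lmult sB d j c (merge sB d j X))" for c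
    by (rule linear_compose_field[OF tensor_linear_merge tensor_linear_lmult])
  have ml: "multilinear sA tscale d (?l p)"
  proof (rule multilinearI)
    fix xs ys :: "'a list" assume len: "Suc (length xs + length ys) = d"
    consider "length xs = j" | v a as2 where "ys = v @ a # as2" "Suc (length xs + length v) = j"
      | as1 a v where "xs = as1 @ a # v" "length as1 = j"
    proof -
      assume 1: "length xs = j \<Longrightarrow> thesis"
        and 2: "\<And>v a as2. ys = v @ a # as2 \<Longrightarrow> Suc (length xs + length v) = j \<Longrightarrow> thesis"
        and 3: "\<And>as1 a v. xs = as1 @ a # v \<Longrightarrow> length as1 = j \<Longrightarrow> thesis"
      show thesis
      proof (cases "length xs" j rule: linorder_cases)
        case less
        then have "j - Suc (length xs) < length ys" using len jd by simp
        with less show ?thesis using split_at[of "j - Suc (length xs)" ys] 2 by force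
      next
        case greater
        then show ?thesis using split_at[of j xs] 3 by blast
      qed (use 1 in blast)
    qed
    then show "Vector_Spaces.linear sA tscale (\<lambda>x. ?l p (xs @ x # ys))"
    proof cases
      case 1
      show ?thesis unfolding unf[OF 1] expand_def
        by (rule linear_compose_field[OF \<Theta>_lin linear_contract])
    next
      case (2 v a as2)
      have eq: "?l p (xs @ x # ys) =
          contract (\<Theta> a) (expand_map d j (\<lambda>t w. ?l p' ((xs @ x # v) @ t # w # as2)))" for x
        using unf[of "xs @ x # v" a as2] 2 by (simp add: expand_def)
      show ?thesis unfolding eq
      proof (rule linear_contract_parameter[OF \<theta> vector_space_sA])
        show "multilinear sA tscale 3 (expand_map d j (\<lambda>t w. ?l p' ((xs @ x # v) @ t # w # as2)))" for x
          by (rule expand_map_multilinear[OF slice jd]) (use 2 len in simp)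
        have "Vector_Spaces.linear sA tscale (\<lambda>x. ?l p' (xs @ x # v @ t # w # as2))" for t w
          by (rule multilinearD[OF ml']) (use 2 len in simp)
        from linear_compose_field[OF this step_linear]
        show "Vector_Spaces.linear sA tscale
            (\<lambda>x. expand_map d j (\<lambda>t w. ?l p' ((xs @ x # v) @ t # w # as2)) l)" for l
          by (simp add: expand_map_def)
      qed
    next
      case (3 as1 a v)
      have eq: "?l p (xs @ x # ys) =
          contract (\<Theta> a) (expand_map d j (\<lambda>t w. ?l p' (as1 @ t # w # v @ x # ys)))" for x
        using unf[of as1 a "v @ x # ys"] 3 by (simp add: expand_def)
      show ?thesis unfolding eq
      proof (rule linear_contract_parameter[OF \<theta> vector_space_sA])
        show "multilinear sA tscale 3 (expand_map d j (\<lambda>t w. ?l p' (as1 @ t # w # v @ x # ys)))" for x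
          by (rule expand_map_multilinear[OF slice jd]) (use 3 len in simp)
        have "Vector_Spaces.linear sA tscale (\<lambda>x. ?l p' ((as1 @ t # w # v) @ x # ys))" for t w
          by (rule multilinearD[OF ml']) (use 3 len in simp)
        from linear_compose_field[OF this step_linear]
        show "Vector_Spaces.linear sA tscale
            (\<lambda>x. expand_map d j (\<lambda>t w. ?l p' (as1 @ t # w # v @ x # ys)) l)" for l
          by (simp add: expand_map_def)
      qed
    qed
  qed

  \<comment> \<open>Any other part is a part of \<open>p'\<close> too, at the same position or, to the right of \<open>j\<close>, at the next,
    and the expansion commutes with the operations at this factor.  The lists \<open>L t w\<close> and \<open>R t w\<close> are
    the arguments to its left and right after the argument \<open>a\<close> of the expanded part is replaced by
    \<open>t, w\<close>.  A part \<open>m\<close> to the left of \<open>j\<close> is at most \<open>1\<close>, so it cannot be split.\<close>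
  have other: "thesis"
    if pr: "p = r1 @ m # r2" and m: "m \<noteq> Suc (Suc n) \<or> length r1 \<noteq> j"
      and len: "length as1 = length r1" "length as2 = length r2"
      and elim: "\<And>q1 q2 L R a. p' = q1 @ m # q2 \<Longrightarrow>
        (\<And>t w. length (L t w) = length q1) \<Longrightarrow> (\<And>t w. length (R t w) = length q2) \<Longrightarrow>
        (\<And>z. ?l p (as1 @ z # as2) = expand d j (\<lambda>t w. ?l p' (L t w @ z # R t w)) (\<Theta> a)) \<Longrightarrow>
        (\<And>z. tensor_bilinear (Suc d) (\<lambda>t w. ?l p' (L t w @ z # R t w))) \<Longrightarrow>
        (\<And>h X c. Vector_Spaces.linear sB sB h \<Longrightarrow> X \<in> tensor_power sB (Suc d) \<Longrightarrow>
          B.factor_map d (length r1) h (lmult sB d j c (merge sB d j X)) =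
          lmult sB d j c (merge sB d j (B.factor_map (Suc d) (length q1) h X))) \<Longrightarrow>
        (\<And>k x y. k \<in> {1..<m} \<Longrightarrow> ?l (r1 @ k # (m - k) # r2) (as1 @ x # y # as2) =
          expand (Suc d) j (\<lambda>t w. ?l (q1 @ k # (m - k) # q2) (L t w @ x # y # R t w)) (\<Theta> a)) \<Longrightarrow>
        (\<And>k x y. k \<in> {1..<m} \<Longrightarrow>
          tensor_bilinear (Suc (Suc d)) (\<lambda>t w. ?l (q1 @ k # (m - k) # q2) (L t w @ x # y # R t w))) \<Longrightarrow>
        (\<And>X c. {1..<m} \<noteq> {} \<Longrightarrow> X \<in> tensor_power sB (Suc (Suc d)) \<Longrightarrow>
          merge sB d (length r1) (lmult sB (Suc d) j c (merge sB (Suc d) j X)) =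
          lmult sB d j c (merge sB d j (merge sB (Suc d) (length q1) X))) \<Longrightarrow> thesis"
    for thesis r1 m r2 as1 as2
  proof (cases "length r1" j rule: linorder_cases)
    case equal
    then have "m = Suc (Suc n)" using pr unfolding p j_def by (simp add: append_eq_append_conv)
    then show ?thesis using m equal by blast
  next
    case less
    then obtain v' where "zs = r1 @ v'" "m # r2 = v' @ Suc (Suc n) # r"
      using pr unfolding p j_def by (auto simp: append_eq_append_conv2)
    with less obtain v where v: "zs = r1 @ m # v" "r2 = v @ Suc (Suc n) # r"
      by (cases v') (auto simp: j_def)
    have m1: "m \<le> 1" using zs v(1) by auto
    obtain c a b where as2: "as2 = c @ a # b" "length c = length v" "length b = length r"
      using split_at[of "length v" as2] len(2) v(2) by auto
    have j: "length (as1 @ z # c) = j" for z using len(1) v(1) as2 by (simp add: j_def)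
    have "?l p (as1 @ z # as2) = expand d j (\<lambda>t w. ?l p' (as1 @ z # c @ t # w # b)) (\<Theta> a)" for z
      using unf[OF j, of z a b] by (simp add: as2(1))
    moreover have "tensor_bilinear (Suc d) (\<lambda>t w. ?l p' (as1 @ z # c @ t # w # b))" for z
      using slice[of "as1 @ z # c" b] j[of z] as2(3) by (simp add: d_def j_def)
    moreover have "p' = r1 @ m # (v @ 1 # Suc n # r)" by (simp add: p'_def v(1))
    ultimately show ?thesis
      using len(1) as2 B.commute_left[OF _ less jd] m1
      by (intro elim[of r1 "v @ 1 # Suc n # r" "\<lambda>t w. as1" "\<lambda>t w. c @ t # w # b" a])
        simp_all
  next
    case greater
    then obtain v' where "r1 = zs @ v'" "v' @ m # r2 = Suc (Suc n) # r"
      using pr unfolding p j_def by (auto simp: append_eq_append_conv2)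
    with greater obtain v where v: "r1 = zs @ Suc (Suc n) # v" "r = v @ m # r2"
      by (cases v') (auto simp: j_def)
    obtain b a c where as1: "as1 = b @ a # c" "length b = j" "length c = length v"
      using split_at[of j as1] len(1) v(1) by (auto simp: j_def)
    define q1 where "q1 = zs @ 1 # Suc n # v"
    have i: "length r1 < d" and q1: "length q1 = Suc (length r1)" using v by (simp_all add: d_def q1_def)
    have p'1: "p' = q1 @ m # r2" by (simp add: p'_def v(2) q1_def)
    have "?l p (as1 @ z # as2) = expand d j (\<lambda>t w. ?l p' ((b @ t # w # c) @ z # as2)) (\<Theta> a) \<and>
        tensor_bilinear (Suc d) (\<lambda>t w. ?l p' ((b @ t # w # c) @ z # as2))" for z
      using unf[OF as1(2), of a "c @ z # as2"] slice[of b "c @ z # as2"] as1 v len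
      by (simp add: d_def j_def)
    moreover have "?l (r1 @ k # (m - k) # r2) (as1 @ x # y # as2) =
        expand (Suc d) j (\<lambda>t w. ?l (q1 @ k # (m - k) # r2) ((b @ t # w # c) @ x # y # as2)) (\<Theta> a)" for k x y
    proof -
      have "Suc (length zs + length (v @ k # (m - k) # r2)) = Suc d" using v by (simp add: d_def)
      then show ?thesis
        using lift_expand[OF zs, of b \<Theta> G n "v @ k # (m - k) # r2" a "c @ x # y # as2"] as1(2)
        unfolding v(1) as1(1) j_def append_assoc append_Cons q1_def by (simp only:)
    qed
    moreover have "tensor_bilinear (Suc (Suc d))
        (\<lambda>t w. ?l (q1 @ k # (m - k) # r2) ((b @ t # w # c) @ x # y # as2))" if k: "k \<in> {1..<m}" for k x y
    proof -
      have "q1 @ (k + (m - k)) # r2 = p'" using k by (simp add: p'1)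
      moreover have "excess p' < excess p" "finest_refinement p' = finest_refinement p"
        using excess_split[of 1 "Suc n" zs r] finest_refinement_split[of 1 "Suc n" zs r]
        by (simp_all add: p'_def p)
      ultimately have "jet_component ?l (q1 @ k # (m - k) # r2)"
        using k by (intro IH_split) simp_all
      then have "tensor_multilinear (Suc (Suc d)) (?l (q1 @ k # (m - k) # r2))"
        using v by (simp add: jet_component_def d_def q1_def)
      from tensor_bilinear_slice[OF this, of b "c @ x # y # as2"] show ?thesis
        using as1 v len by (simp add: d_def j_def)
    qed
    ultimately show ?thesis
      using p'1 B.commute_right[OF _ greater i] B.commute_right_merge[OF _ greater i] as1 len(2)
      unfolding q1[symmetric]
      by (intro elim[of q1 r2 "\<lambda>t w. b @ t # w # c" "\<lambda>t w. as2" a]) (simp_all add: j_def q1_def)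
  qed

  have middle: "?l p (as1 @ (x * y) # as2) =
      lmult sB d j (f x) (?l p (as1 @ y # as2)) + rmult sB d j (f y) (?l p (as1 @ x # as2)) +
      (\<Sum>k\<in>{1..<Suc (Suc n)}. merge sB d j (?l (zs @ k # (Suc (Suc n) - k) # r) (as1 @ x # y # as2)))"
    if len1: "length as1 = j" and len2: "length as2 = length r" for as1 as2 x y
  proof -
    have len: "Suc (length as1 + length as2) = d" using len1 len2 by (simp add: d_def j_def)
    let ?K = "\<lambda>t v. ?l p' (as1 @ t # v # as2)"
    let ?M = "\<lambda>k t v. ?l (zs @ 1 # k # (Suc n - k) # r) (as1 @ t # v # y # as2)"
    have M: "tensor_bilinear (Suc (Suc d)) (?M k)" if k: "k \<in> {1..<Suc n}" for k
    proof -
      have "jet_component ?l ((zs @ [1]) @ k # (Suc n - k) # r)"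
        using k jet' excess_split[of 1 "Suc n" zs r] finest_refinement_split[of 1 "Suc n" zs r]
        by (intro IH_split) (auto simp: p)
      then have "tensor_multilinear (Suc (Suc d)) (?l (zs @ 1 # k # (Suc n - k) # r))"
        by (simp add: jet_component_def d_def)
      then show ?thesis by (rule tensor_bilinear_slice) (use len in simp)
    qed
    let ?K1 = "\<lambda>t v. lmult sB (Suc d) (Suc j) (f v) (?K t y)"
    let ?K2 = "\<lambda>t v. rmult sB (Suc d) (Suc j) (f y) (?K t v)"
    let ?K3 = "\<lambda>k t v. merge sB (Suc d) (Suc j) (?M k t v)"
    have K_mult: "?K t (v * y) = ?K1 t v + ?K2 t v + (\<Sum>k\<in>{1..<Suc n}. ?K3 k t v)" for t v
    proof -
      have 1: "p' = (zs @ [1]) @ Suc n # r" by (simp add: p'_def)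
      have 2: "length (as1 @ [t]) = length (zs @ [1])" using len1 by (simp add: j_def)
      show ?thesis
        using leib'[unfolded leibniz_def, rule_format, OF 1 zero_less_Suc 2 len2, of v y]
        unfolding len_p' length_append list.size append_assoc append_Cons append_Nil
        by (simp only: j_def[symmetric] add_0 add_Suc_right add_0_right)
    qed
    have bil_K: "tensor_bilinear (Suc d) ?K" by (rule slice[OF len])
    have K: "Vector_Spaces.linear sA tscale (\<lambda>t. ?K t y)" "?K t v \<in> tensor_power sB (Suc d)" for t v
      using bil_K by (simp_all add: tensor_bilinear_def)
    have bil1: "tensor_bilinear (Suc d) ?K1"
      unfolding tensor_bilinear_def
    proof (intro conjI allI)
      show "Vector_Spaces.linear sA tscale (\<lambda>t. ?K1 t v)" for v
        by (rule linear_compose_field[OF K(1) tensor_linear_lmult])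
      show "Vector_Spaces.linear sA tscale (\<lambda>v. ?K1 t v)" for t
        by (rule linear_compose_field[OF hom_linear B.linear_lmult_parameter[OF K(2)]]) (use jd in simp)
      show "?K1 t v \<in> tensor_power sB (Suc d)" for t v
        by (rule B.lmult_in[OF K(2)]) (use jd in simp)
    qed
    have bil2: "tensor_bilinear (Suc d) ?K2"
      by (rule tensor_bilinear_op[OF bil_K tensor_linear_rmult B.rmult_in]) (use jd in auto)
    have bil3: "tensor_bilinear (Suc d) (?K3 k)" if "k \<in> {1..<Suc n}" for k
      by (rule tensor_bilinear_op[OF M[OF that] tensor_linear_merge B.merge_in]) (use jd in auto)
    have bil12: "tensor_bilinear (Suc d) (\<lambda>t v. ?K1 t v + ?K2 t v)"
      using bil1 bil2 unfolding tensor_bilinear_def by (auto intro: linear_plus tensor_power_add)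

    have "?l p (as1 @ (x * y) # as2) =
        expand d j ?K (lmult sA 3 0 x (\<Theta> y)) + expand d j ?K (rmult sA 3 2 y (\<Theta> x))"
      unfolding unf[OF len1] \<Theta>_mult expand_def by (rule contract_add_left)
    also have "expand d j ?K (lmult sA 3 0 x (\<Theta> y)) = lmult sB d j (f x) (?l p (as1 @ y # as2))"
      unfolding unf[OF len1] by (rule expand_lmult_argument[OF \<theta> bil_K jd])
    also have "expand d j ?K (rmult sA 3 2 y (\<Theta> x)) = expand d j (\<lambda>t v. ?K t (v * y)) (\<Theta> x)"
      by (rule expand_rmult_argument[OF \<theta> bil_K jd])
    also have "\<dots> = expand d j ?K1 (\<Theta> x) + expand d j ?K2 (\<Theta> x) +
        (\<Sum>k\<in>{1..<Suc n}. expand d j (?K3 k) (\<Theta> x))"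
      unfolding K_mult
      by (simp only: expand_add[OF \<theta> bil12 tensor_bilinear_sum[OF bil3] jd]
          expand_add[OF \<theta> bil1 bil2 jd] expand_sum[OF \<theta> bil3 finite_atLeastLessThan jd])
    \<comment> \<open>at a part \<open>1\<close> the Leibniz rule is that of a derivation\<close>
    also have "expand d j ?K1 (\<Theta> x) = merge sB d j (?l p' (as1 @ x # y # as2))"
    proof -
      let ?H = "\<lambda>l. lmult sB (Suc d) j (f (l ! 0)) (rmult sB (Suc d) j (f (l ! 2)) (?K (l ! 1) y))"
      have "?K (t * u) y = lmult sB (Suc d) j (f t) (?K u y) + rmult sB (Suc d) j (f u) (?K t y)" for t u
      proof -
        have 1: "length as1 = length zs" "length (y # as2) = length (Suc n # r)"
          using len1 len2 by (simp_all add: j_def)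
        have 2: "(\<Sum>k\<in>{1..<1::nat}. g k) = (0 :: ('k, 'b) tensor)" for g by simp
        show ?thesis
          using leib'[unfolded leibniz_def, rule_format, OF p'_def zero_less_one 1, of t u]
          unfolding len_p' 2 j_def by (simp only: add_0_right)
      qed
      note D = contract_splitting_derivation[OF \<Theta> less_SucI[OF jd] K this]
      have "expand d j ?K1 (\<Theta> x) = contract (\<Theta> x) (\<lambda>l. merge sB d j (?H l))"
        unfolding expand_def expand_map_def
        by (rule contract_cong[OF \<theta>]) (rule B.commute_at(2)[OF K(2) jd])
      also have "\<dots> = merge sB d j (contract (\<Theta> x) ?H)"
        by (rule contract_linear[OF \<theta> D(1) tensor_linear_merge, symmetric])
      also have "contract (\<Theta> x) ?H = ?K x y" by (rule D(2))
      finally show ?thesis .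
    qed
    also have "expand d j ?K2 (\<Theta> x) = rmult sB d j (f y) (?l p (as1 @ x # as2))"
      unfolding unf[OF len1]
      by (rule expand_op[OF \<theta> bil_K jd tensor_linear_rmult B.commute_at(1)[OF _ jd, symmetric], symmetric])
    also have "(\<Sum>k\<in>{1..<Suc n}. expand d j (?K3 k) (\<Theta> x)) =
        (\<Sum>k\<in>{1..<Suc n}. merge sB d j (?l (zs @ Suc k # (Suc n - k) # r) (as1 @ x # y # as2)))"
    proof (rule sum.cong[OF refl])
      fix k assume k: "k \<in> {1..<Suc n}"
      then have "Suc (Suc (k - 1)) = Suc k" "Suc (k - 1) = k" by auto
      then have "?l (zs @ Suc k # (Suc n - k) # r) (as1 @ x # y # as2) =
          expand (Suc d) j (?M k) (\<Theta> x)"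
        using lift_expand[OF zs, of as1 \<Theta> G "k - 1" "(Suc n - k) # r" x "y # as2"] len1
        by (simp add: d_def j_def)
      then show "expand d j (?K3 k) (\<Theta> x) =
          merge sB d j (?l (zs @ Suc k # (Suc n - k) # r) (as1 @ x # y # as2))"
        using expand_op[OF \<theta> M[OF k] less_SucI[OF jd] tensor_linear_merge
            B.commute_at_merge[OF _ jd, symmetric], of x] by (simp only:)
    qed
    also have "lmult sB d j (f x) (?l p (as1 @ y # as2)) + (merge sB d j (?l p' (as1 @ x # y # as2)) +
        rmult sB d j (f y) (?l p (as1 @ x # as2)) +
        (\<Sum>k\<in>{1..<Suc n}. merge sB d j (?l (zs @ Suc k # (Suc n - k) # r) (as1 @ x # y # as2)))) =
      lmult sB d j (f x) (?l p (as1 @ y # as2)) + rmult sB d j (f y) (?l p (as1 @ x # as2)) +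
        (merge sB d j (?l p' (as1 @ x # y # as2)) +
        (\<Sum>k\<in>{1..<Suc n}. merge sB d j (?l (zs @ Suc k # (Suc n - k) # r) (as1 @ x # y # as2))))"
      by (simp only: ac_simps)
    also have "merge sB d j (?l p' (as1 @ x # y # as2)) +
        (\<Sum>k\<in>{1..<Suc n}. merge sB d j (?l (zs @ Suc k # (Suc n - k) # r) (as1 @ x # y # as2))) =
      (\<Sum>k\<in>{1..<Suc (Suc n)}. merge sB d j (?l (zs @ k # (Suc (Suc n) - k) # r) (as1 @ x # y # as2)))"
    proof -
      let ?g = "\<lambda>k. merge sB d j (?l (zs @ k # (Suc (Suc n) - k) # r) (as1 @ x # y # as2))"
      have "sum ?g {1..<Suc (Suc n)} = ?g 1 + sum ?g {Suc 1..<Suc (Suc n)}"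
        by (rule sum.atLeast_Suc_lessThan) simp
      also have "sum ?g {Suc 1..<Suc (Suc n)} = (\<Sum>k\<in>{1..<Suc n}. ?g (Suc k))"
        by (rule sum.shift_bounds_Suc_ivl)
      finally show ?thesis by (simp only: p'_def diff_Suc_Suc One_nat_def diff_zero)
    qed
    finally show ?thesis .
  qed

  have "leibniz ?l p"
    unfolding leibniz_def
  proof (intro allI impI)
    fix r1 m r2 and as1 as2 :: "'a list" and x y :: 'a
    assume pr: "p = r1 @ m # r2" and m: "m > 0"
      and len: "length as1 = length r1" "length as2 = length r2"
    show "?l p (as1 @ (x * y) # as2) =
      lmult sB (length p) (length r1) (f x) (?l p (as1 @ y # as2)) +
      rmult sB (length p) (length r1) (f y) (?l p (as1 @ x # as2)) +
      (\<Sum>k\<in>{1..<m}. merge sB (length p) (length r1)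
        (?l (r1 @ k # (m - k) # r2) (as1 @ x # y # as2)))"
    proof (cases "m = Suc (Suc n) \<and> length r1 = j")
      case True
      then have "r1 = zs" "r2 = r" using pr by (simp_all add: p j_def append_eq_append_conv)
      then show ?thesis
        using middle[of as1 as2 x y] len True unfolding len_p by (simp only: j_def)
    next
      case False
      then have "m \<noteq> Suc (Suc n) \<or> length r1 \<noteq> j" by blast
      obtain q1 q2 L R a where q: "p' = q1 @ m # q2"
        and lens: "\<And>t w. length (L t w) = length q1" "\<And>t w. length (R t w) = length q2"
        and unf': "\<And>z. ?l p (as1 @ z # as2) = expand d j (\<lambda>t w. ?l p' (L t w @ z # R t w)) (\<Theta> a)"
        and bil: "\<And>z. tensor_bilinear (Suc d) (\<lambda>t w. ?l p' (L t w @ z # R t w))"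
        and comm: "\<And>h X c. Vector_Spaces.linear sB sB h \<Longrightarrow> X \<in> tensor_power sB (Suc d) \<Longrightarrow>
          B.factor_map d (length r1) h (lmult sB d j c (merge sB d j X)) =
          lmult sB d j c (merge sB d j (B.factor_map (Suc d) (length q1) h X))"
        and fine: "\<And>k x y. k \<in> {1..<m} \<Longrightarrow> ?l (r1 @ k # (m - k) # r2) (as1 @ x # y # as2) =
          expand (Suc d) j (\<lambda>t w. ?l (q1 @ k # (m - k) # q2) (L t w @ x # y # R t w)) (\<Theta> a)"
          "\<And>k x y. k \<in> {1..<m} \<Longrightarrow>
            tensor_bilinear (Suc (Suc d)) (\<lambda>t w. ?l (q1 @ k # (m - k) # q2) (L t w @ x # y # R t w))"
        and comm_m: "\<And>X c. {1..<m} \<noteq> {} \<Longrightarrow> X \<in> tensor_power sB (Suc (Suc d)) \<Longrightarrow>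
          merge sB d (length r1) (lmult sB (Suc d) j c (merge sB (Suc d) j X)) =
          lmult sB d j c (merge sB d j (merge sB (Suc d) (length q1) X))"
        by (rule other[OF pr \<open>m \<noteq> Suc (Suc n) \<or> length r1 \<noteq> j\<close> len]) (rule that)
      have i': "length q1 < Suc d" using arg_cong[OF q, of length] len_p' by simp
      have "?l p (as1 @ (x * y) # as2) =
          lmult sB d (length r1) (f x) (?l p (as1 @ y # as2)) +
          rmult sB d (length r1) (f y) (?l p (as1 @ x # as2)) +
          (\<Sum>k\<in>{1..<m}. merge sB d (length r1)
            (expand (Suc d) j (\<lambda>t w. ?l (q1 @ k # (m - k) # q2) (L t w @ x # y # R t w)) (\<Theta> a)))"
        unfolding unf'
        by (rule expand_leibniz[OF \<theta> bil bil fine(2) finite_atLeastLessThan jd i'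
              leib'[unfolded leibniz_def, rule_format, OF q m lens, where x = x and y = y, unfolded len_p'] comm comm_m])
      then show ?thesis unfolding len_p by (simp only: fine(1) cong: sum.cong)
    qed
  qed
  moreover have "inserts_at_zeros p (?l p)"
    unfolding inserts_at_zeros_def
  proof (intro allI impI)
    fix r1 r2 and as1 as2 :: "'a list" and x :: 'a
    assume pr: "p = r1 @ 0 # r2" and len: "length as1 = length r1" "length as2 = length r2"
    have "0 \<noteq> Suc (Suc n) \<or> length r1 \<noteq> j" by simp
    obtain q1 q2 L R a where q: "p' = q1 @ 0 # q2"
      and lens: "\<And>t w. length (L t w) = length q1" "\<And>t w. length (R t w) = length q2"
      and unf': "\<And>z. ?l p (as1 @ z # as2) = expand d j (\<lambda>t w. ?l p' (L t w @ z # R t w)) (\<Theta> a)"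
      and bil: "\<And>z. tensor_bilinear (Suc d) (\<lambda>t w. ?l p' (L t w @ z # R t w))"
      and comm: "\<And>h X c. Vector_Spaces.linear sB sB h \<Longrightarrow> X \<in> tensor_power sB (Suc d) \<Longrightarrow>
        B.factor_map d (length r1) h (lmult sB d j c (merge sB d j X)) =
        lmult sB d j c (merge sB d j (B.factor_map (Suc d) (length q1) h X))"
      by (rule other[OF pr \<open>0 \<noteq> Suc (Suc n) \<or> length r1 \<noteq> j\<close> len]) (rule that)
    have ins_x: "?l p' (L t w @ x # R t w) =
        B.replace_factor (Suc d) (length q1) (f x) (?l p' (L t w @ 1 # R t w))" for t w
      using ins'[unfolded inserts_at_zeros_def, rule_format, OF q lens, where a = x] unfolding len_p' .
    show "?l p (as1 @ x # as2) =
        B.replace_factor (length p) (length r1) (f x) (?l p (as1 @ 1 # as2))"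
      unfolding len_p unf' ins_x
      by (rule expand_op[OF \<theta> bil jd B.tensor_linear_replace_factor
            comm[OF B.linear_replacement, folded B.replace_factor_def], symmetric])
  qed
  ultimately show ?thesis
    using ml vals unfolding jet_component_def tensor_multilinear_def len_p by blast
qed

text \<open>Every multiderivation lifts: induction on the number of splits, starting from \<open>G\<close> itself.\<close>

theorem jet_component_lift:
  assumes "A.splitting_derivation \<Theta>" "jet_component (\<lambda>_. G) (finest_refinement p)"
  shows "jet_component (lift \<Theta> G) p"
  using assms(2)
proof (induction "excess p" arbitrary: p rule: less_induct)
  case less
  show ?case
  proof (cases "\<forall>k\<in>set p. k \<le> 1")
    case True
    then have p: "finest_refinement p = p" by (rule finest_refinement_idem)
    have G: "tensor_multilinear (length p) G" "leibniz (\<lambda>_. G) p" "inserts_at_zeros p G"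
      using less(2) by (simp_all add: p jet_component_def)
    have "leibniz (lift \<Theta> G) p"
    proof (rule leibniz_cong[OF G(2)])
      show "G as = lift \<Theta> G p as" for as by (simp only: lift_finest[OF True])
      show "G as = lift \<Theta> G (r1 @ k # l # r2) as" if "p = r1 @ (k + l) # r2" "k > 0" "l > 0" for r1 k l r2 as
        using True that by auto
    qed
    then show ?thesis using G by (simp add: jet_component_def lift_finest[OF True])
  next
    case False
    then obtain zs k r where p: "p = zs @ k # r" and zs: "\<forall>k\<in>set zs. k \<le> 1" and "\<not> k \<le> 1"
      using split_list_first_prop[of p "\<lambda>k. \<not> k \<le> 1"] by auto
    then obtain n where k: "k = Suc (Suc n)" by (metis One_nat_def not0_implies_Suc not_less_eq_eq zero_le)
    show ?thesis
      by (rule jet_component_lift_step[OF assms(1) zs p[unfolded k]]) (use less in simp)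
  qed
qed

end


section \<open>Degeneracy maps and the order filtration\<close>

lemma length_le_finest_refinement: "length p \<le> length (finest_refinement p)"
  by (induction p) (auto simp: finest_refinement_Cons)

lemma length_less_finest_refinement:
  assumes "r \<in> refinements p" "r \<noteq> finest_refinement p"
  shows "length r < length (finest_refinement p)"
proof -
  obtain r1 k r2 where r: "r = r1 @ k # r2" "k \<ge> 2" using big_part_or_finest[OF assms(1)] assms(2) by blast
  have "length r < length (finest_refinement r)"
    using length_le_finest_refinement[of r1] length_le_finest_refinement[of r2] r
    by (simp add: finest_refinement_append finest_refinement_Cons)
  then show ?thesis by (simp only: finest_refinement_of_refinement[OF assms(1)])
qed

text \<open>
  In terms of block sums, a degeneracy map is given by \<open>block_sums ws \<kappa>' \<mapsto> P \<kappa>'\<close>; the choice in its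
  definition is unique because block sums with positive weights are injective.
\<close>

lemma degeneracy_at_pullback:
  assumes \<sigma>: "ordered_surjection m n \<sigma>" and "sum_list \<kappa> = n" "\<kappa>' \<in> refinements \<kappa>"
  shows "degeneracy m \<kappa> \<sigma> P (block_sums (fibre_sizes m n \<sigma>) \<kappa>') = P \<kappa>'"
proof -
  let ?ws = "fibre_sizes m n \<sigma>"
  have pb: "pullback m \<kappa>'' \<sigma> = block_sums ?ws \<kappa>''" if "\<kappa>'' \<in> refinements \<kappa>" for \<kappa>''
    using sum_list_refinement[OF that] assms(2) by (intro pullback_eq_block_sums[OF \<sigma>]) simp
  have "(THE \<kappa>''. \<kappa>'' \<in> refinements \<kappa> \<and> block_sums ?ws \<kappa>' = pullback m \<kappa>'' \<sigma>) = \<kappa>'"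
  proof (rule the_equality)
    fix \<kappa>'' assume *: "\<kappa>'' \<in> refinements \<kappa> \<and> block_sums ?ws \<kappa>' = pullback m \<kappa>'' \<sigma>"
    then have "block_sums ?ws \<kappa>'' = block_sums ?ws \<kappa>'" using pb by simp
    then show "\<kappa>'' = \<kappa>'"
      using sum_list_refinement[of \<kappa>'' \<kappa>] sum_list_refinement[OF assms(3)] * assms(2)
      by - (rule block_sums_inject[OF fibre_sizes_positive[OF \<sigma>]], simp_all)
  qed (use pb assms(3) in simp)
  moreover have "\<exists>\<kappa>''\<in>refinements \<kappa>. block_sums ?ws \<kappa>' = pullback m \<kappa>'' \<sigma>"
    using assms(3) pb[OF assms(3)] by force
  ultimately show ?thesis unfolding degeneracy_def by (simp only: if_True)
qed

lemma degeneracy_off_pullback: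
  assumes \<sigma>: "ordered_surjection m n \<sigma>" and "sum_list \<kappa> = n"
    and "\<And>\<kappa>'. \<kappa>' \<in> refinements \<kappa> \<Longrightarrow> r \<noteq> block_sums (fibre_sizes m n \<sigma>) \<kappa>'"
  shows "degeneracy m \<kappa> \<sigma> P r = 0"
proof -
  have "pullback m \<kappa>' \<sigma> = block_sums (fibre_sizes m n \<sigma>) \<kappa>'" if "\<kappa>' \<in> refinements \<kappa>" for \<kappa>'
    using sum_list_refinement[OF that] assms(2) by (intro pullback_eq_block_sums[OF \<sigma>]) simp
  then have "\<not> (\<exists>\<kappa>'\<in>refinements \<kappa>. r = pullback m \<kappa>' \<sigma>)" using assms(3) by metis
  then show ?thesis unfolding degeneracy_def by (simp only: if_False)
qed

text \<open>
  Let \<open>m\<close> be the part of a pulled back partition which comes from the part \<open>k\<close>.  If splitting \<open>m\<close> gives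
  a pulled back partition again, then the split is at the boundary of two fibres, and comes from
  splitting \<open>k\<close>.
\<close>

lemma block_sums_eq_splitD:
  assumes ws: "\<forall>w\<in>set ws. 0 < w" and len: "sum_list k1 + k + sum_list k2 = length ws"
    and eq: "block_sums ws (k1 @ k # k2) = r1 @ m # r2" "length k1 = length r1"
    and \<kappa>: "block_sums ws \<kappa> = r1 @ a # (m - a) # r2" "sum_list \<kappa> = length ws" "a \<in> {1..<m}"
  shows "\<exists>c\<in>{1..<k}. \<kappa> = k1 @ c # (k - c) # k2 \<and> a = sum_list (take c (drop (sum_list k1) ws))"
proof -
  let ?ws = "drop (sum_list k1) ws"
  have r: "r1 = block_sums ws k1" "m = sum_list (take k ?ws)" "r2 = block_sums (drop k ?ws) k2"
    using eq by (simp_all add: block_sums_append)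
  obtain l1 l' where l: "\<kappa> = l1 @ l'" "block_sums ws l1 = r1"
    "block_sums (drop (sum_list l1) ws) l' = a # (m - a) # r2"
    using block_sums_eq_appendD[OF \<kappa>(1)] by blast
  have l1: "l1 = k1"
    using l(1,2) r(1) \<kappa>(2) len by - (rule block_sums_inject[OF ws], simp_all)
  obtain c l'' where c: "l' = c # l''" "a = sum_list (take c ?ws)"
    "block_sums (drop c ?ws) l'' = (m - a) # r2"
    using block_sums_eq_ConsD[OF l(3)[unfolded l1]] by blast
  obtain d l2 where d: "l'' = d # l2" "m - a = sum_list (take d (drop c ?ws))"
    "block_sums (drop d (drop c ?ws)) l2 = r2"
    using block_sums_eq_ConsD[OF c(3)] by blast
  have ws': "\<forall>w\<in>set ?ws. 0 < w" by (rule drop_positive[OF ws])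
  have sum: "sum_list k1 + (c + d) + sum_list l2 = length ws"
    using \<kappa>(2) by (simp add: l(1) l1 c(1) d(1))
  have "sum_list (take (c + d) ?ws) = a + (m - a)"
    unfolding take_add sum_list_append c(2)[symmetric] d(2)[symmetric] by (rule refl)
  then have "sum_list (take (c + d) ?ws) = sum_list (take k ?ws)"
    using \<kappa>(3) r(2) by simp
  then have k: "k = c + d"
    using sum_list_take_eq_iff[OF ws', of "c + d" k] sum len by simp
  moreover have "l2 = k2"
  proof (rule block_sums_inject[of "drop k ?ws"])
    show "\<forall>w\<in>set (drop k ?ws). 0 < w" by (rule drop_positive[OF ws'])
    show "block_sums (drop k ?ws) l2 = block_sums (drop k ?ws) k2"
      using d(3) r(3) k by (simp add: ac_simps)
  qed (use sum len k in simp_all)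
  moreover have "c \<noteq> 0" "d \<noteq> 0" using c(2) d(2) \<kappa>(3) by (auto intro: gr0I)
  ultimately show ?thesis using l(1) l1 c(1,2) d(1) by (intro bexI[of _ c]) auto
qed

context k_algebra_hom
begin

text \<open>
  At a pulled back refinement, the sum in the Leibniz rule reduces to the splits which are pulled
  back, and these correspond to the splits of the original part.  If a refinement is not pulled
  back, neither is any with one of its parts split, and all terms vanish.
\<close>

lemma degeneracy_in_D_space:
  assumes \<sigma>: "ordered_surjection m n \<sigma>" and \<kappa>: "sum_list \<kappa> = n" and P: "P \<in> D_space sA sB f \<kappa>"
  shows "degeneracy m \<kappa> \<sigma> P \<in> D_space sA sB f (pullback m \<kappa> \<sigma>)"
proof -
  define ws where "ws = fibre_sizes m n \<sigma>"
  define s where "s = degeneracy m \<kappa> \<sigma> P"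
  have ws: "\<forall>w\<in>set ws. 0 < w" and len: "length ws = n"
    using fibre_sizes_positive[OF \<sigma>] by (simp_all add: ws_def)
  have \<lambda>: "pullback m \<kappa> \<sigma> = block_sums ws \<kappa>"
    unfolding ws_def by (rule pullback_eq_block_sums[OF \<sigma> \<kappa>])
  have s_at: "s (block_sums ws \<kappa>') = P \<kappa>'" if "\<kappa>' \<in> refinements \<kappa>" for \<kappa>'
    unfolding s_def ws_def by (rule degeneracy_at_pullback[OF \<sigma> \<kappa> that])
  have s_off: "s r = 0" if "\<And>\<kappa>'. \<kappa>' \<in> refinements \<kappa> \<Longrightarrow> r \<noteq> block_sums ws \<kappa>'" for r
    using that unfolding s_def ws_def by (rule degeneracy_off_pullback[OF \<sigma> \<kappa>])
  have sum: "sum_list \<kappa>' = n" if "\<kappa>' \<in> refinements \<kappa>" for \<kappa>'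
    using sum_list_refinement[OF that] \<kappa> by simp
  have ref: "block_sums ws \<kappa>' \<in> refinements (block_sums ws \<kappa>) \<longleftrightarrow> \<kappa>' \<in> refinements \<kappa>"
    if "sum_list \<kappa>' = n" for \<kappa>'
    using that \<kappa> len by (intro refinements_block_sums[OF ws]) auto
  have "s r = 0" if "r \<notin> refinements (block_sums ws \<kappa>)" for r
    using that ref sum by (intro s_off) auto
  moreover have "s r \<in> tensor_hom sA sB (length r) (length r)" for r
  proof (cases "\<exists>\<kappa>'\<in>refinements \<kappa>. r = block_sums ws \<kappa>'")
    case True
    then obtain \<kappa>' where "\<kappa>' \<in> refinements \<kappa>" "r = block_sums ws \<kappa>'" by blast
    then show ?thesis using D_spaceD(2)[OF P, of \<kappa>'] s_at by simp
  next
    case False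
    then have "s r = 0" by (intro s_off) blast
    then show ?thesis by (simp only: zero_in_tensor_hom)
  qed
  moreover have "leibniz (\<lambda>r as. s r (pure_tensor sA as)) r"
    if r: "r \<in> refinements (block_sums ws \<kappa>)" for r
    unfolding leibniz_def
  proof (intro allI impI)
    fix r1 m r2 and as1 as2 :: "'a list" and x y :: 'a
    assume rs: "r = r1 @ m # r2" and m: "m > 0"
      and len_as: "length as1 = length r1" "length as2 = length r2"
    show "s r (pure_tensor sA (as1 @ (x * y) # as2)) =
      lmult sB (length r) (length r1) (f x) (s r (pure_tensor sA (as1 @ y # as2))) +
      rmult sB (length r) (length r1) (f y) (s r (pure_tensor sA (as1 @ x # as2))) +
      (\<Sum>a\<in>{1..<m}. merge sB (length r) (length r1)
        (s (r1 @ a # (m - a) # r2) (pure_tensor sA (as1 @ x # y # as2))))"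
    proof (cases "\<exists>\<kappa>'\<in>refinements \<kappa>. r = block_sums ws \<kappa>'")
      case True
      then obtain \<kappa>' where \<kappa>': "\<kappa>' \<in> refinements \<kappa>" "block_sums ws \<kappa>' = r1 @ m # r2"
        using rs by auto
      obtain k1 l where l: "\<kappa>' = k1 @ l" "block_sums ws k1 = r1"
        "block_sums (drop (sum_list k1) ws) l = m # r2"
        by (rule block_sums_eq_appendD[OF \<kappa>'(2)])
      define ws2 where "ws2 = drop (sum_list k1) ws"
      obtain k k2 where k: "l = k # k2" "m = sum_list (take k ws2)" "block_sums (drop k ws2) k2 = r2"
        unfolding ws2_def by (rule block_sums_eq_ConsD[OF l(3)])
      have ws2: "\<forall>w\<in>set ws2. 0 < w" unfolding ws2_def by (rule drop_positive[OF ws])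
      have split: "\<kappa>' = k1 @ k # k2" using l(1) k(1) by simp
      have total: "sum_list k1 + k + sum_list k2 = length ws" using sum[OF \<kappa>'(1)] split len by simp
      have k_le: "k \<le> length ws2" using total by (simp add: ws2_def)
      have k_pos: "k > 0" using m k(2) by (auto intro: gr0I)
      have len_k: "length as1 = length k1" "length as2 = length k2" "length k1 = length r1"
        using len_as l(2) k(3) by auto
      have len_r: "length r = length \<kappa>'" using rs \<kappa>'(2) by (metis length_block_sums)
      \<comment> \<open>splitting \<open>k\<close> into \<open>c, k - c\<close> corresponds to splitting \<open>m\<close> into \<open>\<phi> c, m - \<phi> c\<close>\<close>
      define \<phi> where "\<phi> c = sum_list (take c ws2)" for c
      have \<phi>_less: "\<phi> c < \<phi> d" if "c < d" "d \<le> k" for c d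
        unfolding \<phi>_def using that k_le by (intro sum_list_take_less[OF ws2]) auto
      have inj: "inj_on \<phi> {1..<k}"
        by (rule linorder_inj_onI) (use \<phi>_less in \<open>auto simp: less_le\<close>)
      have into: "\<phi> ` {1..<k} \<subseteq> {1..<m}"
      proof
        fix a assume "a \<in> \<phi> ` {1..<k}"
        then obtain c where c: "a = \<phi> c" "0 < c" "c < k" by auto
        have "\<phi> 0 = 0" "\<phi> k = m" by (simp_all add: \<phi>_def k(2))
        then show "a \<in> {1..<m}" using \<phi>_less[OF c(2)] \<phi>_less[OF c(3)] c by simp
      qed
      let ?F = "\<lambda>a. merge sB (length r) (length r1)
        (s (r1 @ a # (m - a) # r2) (pure_tensor sA (as1 @ x # y # as2)))"
      have F0: "?F a = 0" if a: "a \<in> {1..<m} - \<phi> ` {1..<k}" for a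
      proof -
        have "s (r1 @ a # (m - a) # r2) = 0"
        proof (rule s_off)
          fix \<kappa>'' assume \<kappa>'': "\<kappa>'' \<in> refinements \<kappa>"
          show "r1 @ a # (m - a) # r2 \<noteq> block_sums ws \<kappa>''"
          proof
            assume eq: "r1 @ a # (m - a) # r2 = block_sums ws \<kappa>''"
            have "\<exists>c\<in>{1..<k}. \<kappa>'' = k1 @ c # (k - c) # k2 \<and> a = sum_list (take c (drop (sum_list k1) ws))"
              using a sum[OF \<kappa>''] len
              by (intro block_sums_eq_splitD[OF ws total \<kappa>'(2)[unfolded split] len_k(3) eq[symmetric]]) auto
            then show False using a by (auto simp: \<phi>_def ws2_def)
          qed
        qed
        then have "?F a = merge sB (length r) (length r1) (0 (pure_tensor sA (as1 @ x # y # as2)))"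
          by (simp only:)
        then show ?thesis by (simp only: zero_fun_apply linear_zeroD[OF tensor_linear_merge])
      qed
      have F\<phi>: "?F (\<phi> c) = merge sB (length \<kappa>') (length k1)
          (P (k1 @ c # (k - c) # k2) (pure_tensor sA (as1 @ x # y # as2)))" if c: "c \<in> {1..<k}" for c
      proof -
        have *: "k1 @ c # (k - c) # k2 \<in> refinements \<kappa>"
          using \<kappa>'(1) c unfolding split by (intro refinement_split) auto
        have "take c ws2 @ take (k - c) (drop c ws2) = take k ws2"
          using c by (simp flip: take_add)
        then have "\<phi> c + sum_list (take (k - c) (drop c ws2)) = m"
          unfolding \<phi>_def k(2) by (metis sum_list_append)
        then have "block_sums ws (k1 @ c # (k - c) # k2) = r1 @ \<phi> c # (m - \<phi> c) # r2"
          using c k(3) by (auto simp: block_sums_append l(2) \<phi>_def ws2_def[symmetric] add.commute)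
        then show ?thesis using s_at[OF *] len_k(3) len_r by (simp only:)
      qed
      have "sum ?F {1..<m} = sum ?F (\<phi> ` {1..<k})"
        using F0 by (intro sum.mono_neutral_right into) auto
      also have "\<dots> = (\<Sum>c\<in>{1..<k}. ?F (\<phi> c))"
        by (subst sum.reindex[OF inj]) (simp only: comp_def)
      also have "\<dots> = (\<Sum>c\<in>{1..<k}. merge sB (length \<kappa>') (length k1)
          (P (k1 @ c # (k - c) # k2) (pure_tensor sA (as1 @ x # y # as2))))"
        by (rule sum.cong[OF refl F\<phi>])
      finally have sum_eq: "sum ?F {1..<m} = \<dots>" .
      have sr: "s r = P \<kappa>'" using s_at[OF \<kappa>'(1)] \<kappa>'(2) rs by simp
      show ?thesis
        unfolding sr sum_eq
        using D_spaceD(3)[OF P \<kappa>'(1), unfolded leibniz_def, rule_format, OF split k_pos len_k(1,2), of x y]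
        unfolding len_r len_k(3) .
    next
      case False
      then have s0: "s r = 0" by (intro s_off) blast
      have sa: "s (r1 @ a # (m - a) # r2) = 0" if a: "a \<in> {1..<m}" for a
      proof (rule s_off)
        fix \<kappa>'' assume \<kappa>'': "\<kappa>'' \<in> refinements \<kappa>"
        show "r1 @ a # (m - a) # r2 \<noteq> block_sums ws \<kappa>''"
        proof
          assume eq: "r1 @ a # (m - a) # r2 = block_sums ws \<kappa>''"
          obtain k1 l where l: "\<kappa>'' = k1 @ l" "block_sums ws k1 = r1"
            "block_sums (drop (sum_list k1) ws) l = a # (m - a) # r2"
            by (rule block_sums_eq_appendD[OF eq[symmetric]])
          obtain c l' where c: "l = c # l'" "a = sum_list (take c (drop (sum_list k1) ws))"
            "block_sums (drop c (drop (sum_list k1) ws)) l' = (m - a) # r2"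
            by (rule block_sums_eq_ConsD[OF l(3)])
          obtain d k2 where d: "l' = d # k2"
            "m - a = sum_list (take d (drop c (drop (sum_list k1) ws)))"
            "block_sums (drop d (drop c (drop (sum_list k1) ws))) k2 = r2"
            by (rule block_sums_eq_ConsD[OF c(3)])
          have "sum_list (take (c + d) (drop (sum_list k1) ws)) = a + (m - a)"
            unfolding take_add sum_list_append c(2)[symmetric] d(2)[symmetric] by (rule refl)
          then have eq': "block_sums ws (k1 @ (c + d) # k2) = r"
            using a d(3) by (simp add: rs block_sums_append l(2) ac_simps)
          have "sum_list (k1 @ (c + d) # k2) = n" using sum[OF \<kappa>''] by (simp add: l(1) c(1) d(1))
          then have "k1 @ (c + d) # k2 \<in> refinements \<kappa>" using ref r eq' by blast
          then show False using False eq' by blast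
        qed
      qed
      have "(\<Sum>a\<in>{1..<m}. merge sB (length r) (length r1)
          (s (r1 @ a # (m - a) # r2) (pure_tensor sA (as1 @ x # y # as2)))) = 0"
        by (intro sum.neutral ballI) (simp only: sa zero_fun_apply linear_zeroD[OF tensor_linear_merge])
      then show ?thesis
        by (simp only: s0 zero_fun_apply linear_zeroD[OF tensor_linear_lmult]
            linear_zeroD[OF tensor_linear_rmult] add_0_right)
    qed
  qed
  moreover have "inserts_at_zeros r (\<lambda>as. s r (pure_tensor sA as))"
    if r: "r \<in> refinements (block_sums ws \<kappa>)" for r
  proof (cases "\<exists>\<kappa>'\<in>refinements \<kappa>. r = block_sums ws \<kappa>'")
    case True
    then obtain \<kappa>' where \<kappa>': "\<kappa>' \<in> refinements \<kappa>" "r = block_sums ws \<kappa>'" by blast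
    have sr: "s r = P \<kappa>'" using s_at[OF \<kappa>'(1)] \<kappa>'(2) by simp
    show ?thesis unfolding inserts_at_zeros_def
    proof (intro allI impI)
      fix r1 r2 and as1 as2 :: "'a list" and a :: 'a
      assume rs: "r = r1 @ 0 # r2" and len_as: "length as1 = length r1" "length as2 = length r2"
      have eq: "block_sums ws \<kappa>' = r1 @ 0 # r2" using rs \<kappa>'(2) by simp
      obtain k1 l where l: "\<kappa>' = k1 @ l" "block_sums ws k1 = r1"
        "block_sums (drop (sum_list k1) ws) l = 0 # r2"
        by (rule block_sums_eq_appendD[OF eq])
      obtain k k2 where k: "l = k # k2" "0 = sum_list (take k (drop (sum_list k1) ws))"
        "block_sums (drop k (drop (sum_list k1) ws)) k2 = r2"
        by (rule block_sums_eq_ConsD[OF l(3)])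
      have "k \<le> length (drop (sum_list k1) ws)" using sum[OF \<kappa>'(1)] len by (simp add: l(1) k(1))
      then have "k = 0" using sum_list_take_eq_0_iff[OF drop_positive[OF ws]] k(2) by metis
      then have split: "\<kappa>' = k1 @ 0 # k2" using l(1) k(1) by simp
      have lens: "length as1 = length k1" "length as2 = length k2" "length k1 = length r1"
        "length r = length \<kappa>'"
        using len_as l(2) k(3) \<kappa>'(2) by auto
      show "s r (pure_tensor sA (as1 @ a # as2)) = B.replace_factor (length r) (length r1) (f a)
          (s r (pure_tensor sA (as1 @ 1 # as2)))"
        unfolding sr using D_spaceD(4)[OF P \<kappa>'(1), unfolded inserts_at_zeros_def, rule_format,
          OF split lens(1,2)] unfolding lens(3,4) .
    qed
  next
    case False
    then have s0: "s r = 0" by (intro s_off) blast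
    show ?thesis
      unfolding inserts_at_zeros_def
      by (simp only: s0 zero_fun_apply linear_zeroD[OF B.tensor_linear_replace_factor]) simp
  qed
  ultimately show ?thesis
    unfolding \<lambda> s_def[symmetric] D_space_iff by blast
qed

lemma order_filtration_subset:
  "order_filtration sA sB f n p \<subseteq> D_space sA sB f p"
proof -
  interpret V: vector_space "fscale :: 'k \<Rightarrow> ('k, 'a, 'b) family \<Rightarrow> _"
    by (rule vector_space_fscale)
  show ?thesis unfolding order_filtration_def
    by (rule V.span_minimal[OF _ subspace_D_space])
      (auto simp: ordered_partitions_def intro: degeneracy_in_D_space)
qed

text \<open>
  The finest refinement has \<open>n\<close> non-zero parts, but a refinement pulled back from a partition of
  \<open>n - 1\<close> has at most \<open>n - 1\<close>.
\<close>

lemma order_filtration_finest: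
  assumes "P \<in> order_filtration sA sB f n p" "sum_list p = n" "n \<ge> 1"
  shows "P (finest_refinement p) = 0"
proof -
  interpret V: vector_space "fscale :: 'k \<Rightarrow> ('k, 'a, 'b) family \<Rightarrow> _"
    by (rule vector_space_fscale)
  show ?thesis using assms(1) unfolding order_filtration_def
  proof (induction rule: V.span_induct)
    show "V.subspace {P. P (finest_refinement p) = 0}"
    proof (rule V.subspaceI)
      show "0 \<in> {P. P (finest_refinement p) = 0}" by simp
      show "P + Q \<in> {P. P (finest_refinement p) = 0}"
        if "P \<in> {P. P (finest_refinement p) = 0}" "Q \<in> {P. P (finest_refinement p) = 0}"
        for P Q :: "('k, 'a, 'b) family"
        using that by (simp only: mem_Collect_eq plus_fun_apply add_0)
      show "fscale c P \<in> {P. P (finest_refinement p) = 0}"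
        if "P \<in> {P. P (finest_refinement p) = 0}" for c and P :: "('k, 'a, 'b) family"
        using that by (simp add: fscale_def tscale_def fun_eq_iff)
    qed
  next
    fix Q assume "Q \<in> \<Union>{degeneracy n \<kappa> \<sigma> ` D_space sA sB f \<kappa> | \<kappa> \<sigma>.
      ordered_surjection n (n - 1) \<sigma> \<and> \<kappa> \<in> ordered_partitions (length p) (n - 1) \<and> pullback n \<kappa> \<sigma> = p}"
    then obtain \<kappa> \<sigma> P where Q: "Q = degeneracy n \<kappa> \<sigma> P" and \<sigma>: "ordered_surjection n (n - 1) \<sigma>"
      and \<kappa>: "sum_list \<kappa> = n - 1"
      by (auto simp: ordered_partitions_def)
    show "Q (finest_refinement p) = 0" unfolding Q
    proof (rule degeneracy_off_pullback[OF \<sigma> \<kappa>])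
      fix \<kappa>' assume \<kappa>': "\<kappa>' \<in> refinements \<kappa>"
      let ?ws = "fibre_sizes n (n - 1) \<sigma>"
      have sum: "sum_list \<kappa>' = n - 1" using sum_list_refinement[OF \<kappa>'] \<kappa> by simp
      show "finest_refinement p \<noteq> block_sums ?ws \<kappa>'"
      proof
        assume eq: "finest_refinement p = block_sums ?ws \<kappa>'"
        have "n = length (filter (\<lambda>n. n \<noteq> 0) \<kappa>')"
          using length_filter_finest[of p] assms(2)
            length_filter_block_sums[OF fibre_sizes_positive[OF \<sigma>], of \<kappa>'] sum
          unfolding eq by simp
        also have "\<dots> \<le> sum_list \<kappa>'" by (induction \<kappa>') auto
        finally show False using sum assms(3) by simp
      qed
    qed
  qed
qed

text \<open>
  The sums in the Leibniz rules at \<open>r\<close> involve only components with one part more.  If these vanish,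
  the component at \<open>r\<close> is a derivation in each argument at a positive part; this is the Leibniz rule
  for the partition in which all positive parts are replaced by \<open>1\<close>, where the sum is empty.
\<close>

lemma top_component:
  assumes P: "P \<in> D_space sA sB f p" and r: "r \<in> refinements p"
    and top: "\<And>r'. r' \<in> refinements p \<Longrightarrow> length r < length r' \<Longrightarrow> P r' = 0"
  shows "jet_component (\<lambda>_ as. P r (pure_tensor sA as)) (map (min 1) r)"
  unfolding jet_component_def length_map
proof (intro conjI)
  show "tensor_multilinear (length r) (\<lambda>as. P r (pure_tensor sA as))"
    by (rule tensor_multilinear_tensor_hom[OF D_spaceD(2)[OF P r]])
  show "leibniz (\<lambda>_ as. P r (pure_tensor sA as)) (map (min 1) r)"
    unfolding leibniz_def length_map
  proof (intro allI impI)
    fix q1 m q2 and as1 as2 :: "'a list" and x y :: 'a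
    assume "map (min 1) r = q1 @ m # q2" and m: "m > 0"
      and len: "length as1 = length q1" "length as2 = length q2"
    then obtain r1 k r2 where rs: "r = r1 @ k # r2" and q: "q1 = map (min 1) r1" "m = min 1 k"
      "q2 = map (min 1) r2"
      by (auto simp: map_eq_append_conv map_eq_Cons_conv)
    have k: "k > 0" and m1: "m = 1" using m q(2) by auto
    have len': "length as1 = length r1" "length as2 = length r2" using len q by simp_all
    have "P (r1 @ c # (k - c) # r2) = 0" if "c \<in> {1..<k}" for c
    proof (rule top)
      show "r1 @ c # (k - c) # r2 \<in> refinements p"
        using r that unfolding rs by (intro refinement_split) auto
    qed (simp add: rs)
    then have "(\<Sum>c\<in>{1..<k}. merge sB (length r) (length r1)
        (P (r1 @ c # (k - c) # r2) (pure_tensor sA (as1 @ x # y # as2)))) = 0"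
      by (intro sum.neutral ballI) (simp only: zero_fun_apply linear_zeroD[OF tensor_linear_merge])
    moreover have "(\<Sum>c\<in>{1..<1::nat}. g c) = (0 :: ('k, 'b) tensor)" for g by simp
    moreover have "length q1 = length r1" by (simp add: q(1))
    ultimately show "P r (pure_tensor sA (as1 @ (x * y) # as2)) =
      lmult sB (length r) (length q1) (f x) (P r (pure_tensor sA (as1 @ y # as2))) +
      rmult sB (length r) (length q1) (f y) (P r (pure_tensor sA (as1 @ x # as2))) +
      (\<Sum>c\<in>{1..<m}. merge sB (length r) (length q1) (P r (pure_tensor sA (as1 @ x # y # as2))))"
      using D_spaceD(3)[OF P r, unfolded leibniz_def, rule_format, OF rs k len', of x y]
      by (simp only: m1)
  qed
  show "inserts_at_zeros (map (min 1) r) (\<lambda>as. P r (pure_tensor sA as))"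
    unfolding inserts_at_zeros_def length_map
  proof (intro allI impI)
    fix q1 q2 and as1 as2 :: "'a list" and a :: 'a
    assume "map (min 1) r = q1 @ 0 # q2" and len: "length as1 = length q1" "length as2 = length q2"
    then obtain r1 k r2 where rs: "r = r1 @ k # r2" and q: "q1 = map (min 1) r1" "0 = min 1 k"
      "q2 = map (min 1) r2"
      by (auto simp: map_eq_append_conv map_eq_Cons_conv)
    have k: "r = r1 @ 0 # r2" using q(2) rs by (cases k) auto
    have len': "length as1 = length r1" "length as2 = length r2" "length r1 = length q1"
      using len q by simp_all
    show "P r (pure_tensor sA (as1 @ a # as2)) = B.replace_factor (length r) (length q1) (f a)
        (P r (pure_tensor sA (as1 @ 1 # as2)))"
      using D_spaceD(4)[OF P r, unfolded inserts_at_zeros_def, rule_format, OF k len'(1,2)]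
      unfolding len'(3) .
  qed
qed

text \<open>
  The multiderivation \<open>G\<close> is prescribed at \<open>r\<close>.  If \<open>r\<close> is the finest refinement, a lift of \<open>G\<close> is the
  desired family, as all other refinements have fewer parts.  Otherwise \<open>r\<close> is pulled back from
  a refinement \<open>r'\<close> of a partition \<open>\<kappa>\<close> of a number which is smaller by one, and the degeneracy of a
  family for \<open>r'\<close> has the desired properties because block sums preserve the number of parts.
\<close>

theorem exists_with_top_component:
  assumes \<Theta>: "A.splitting_derivation \<Theta>"
  shows "r \<in> refinements p \<Longrightarrow> jet_component (\<lambda>_. G) (map (min 1) r) \<Longrightarrow>
    \<exists>Q\<in>D_space sA sB f p.
      (\<forall>as. length as = length r \<longrightarrow> Q r (pure_tensor sA as) = G as) \<and>
      (\<forall>r'\<in>refinements p. r' \<noteq> r \<longrightarrow> length r \<le> length r' \<longrightarrow> Q r' = 0) \<and>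
      (r \<noteq> finest_refinement p \<longrightarrow> Q \<in> order_filtration sA sB f (sum_list p) p)"
proof (induction "sum_list p" arbitrary: p r rule: less_induct)
  case less
  show ?case
  proof (cases "r = finest_refinement p")
    case True
    have le1: "\<forall>k\<in>set r. k \<le> 1" using finest_refinement_le unfolding True by blast
    then have r1: "map (min 1) r = r" by (intro map_idI) (simp add: min.absorb2)
    have "jet_component (lift \<Theta> G) r'" if "r' \<in> refinements p" for r'
    proof (rule jet_component_lift[OF \<Theta>])
      have "map (min 1) r = finest_refinement r'"
        using r1 True finest_refinement_of_refinement[OF that] by simp
      then show "jet_component (\<lambda>_. G) (finest_refinement r')" using less(3) by (simp only:)
    qed
    from D_space_of_components[of p "lift \<Theta> G", OF this] obtain Q where
      Q: "Q \<in> D_space sA sB f p"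
      "\<forall>r\<in>refinements p. \<forall>as. length as = length r \<longrightarrow> Q r (pure_tensor sA as) = lift \<Theta> G r as"
      by blast
    have "Q r (pure_tensor sA as) = G as" if "length as = length r" for as
      using Q(2) less(2) that lift_finest[OF le1] by metis
    moreover have "\<not> length r \<le> length r'" if "r' \<in> refinements p" "r' \<noteq> r" for r'
      using length_less_finest_refinement[OF that(1)] that(2) True by simp
    ultimately show ?thesis using Q(1) True by blast
  next
    case False
    then obtain r1 k r2 where r: "r = r1 @ k # r2" and k: "k \<ge> 2"
      using big_part_or_finest[OF less(2)] by blast
    from refinement_lower_part[OF less(2)[unfolded r] k] obtain p1 l p2 where
      p: "p = p1 @ l # p2" "sum_list p1 \<le> sum_list r1" "sum_list r1 + k \<le> sum_list p1 + l"
      and r'ref: "r1 @ (k - 1) # r2 \<in> refinements (p1 @ (l - 1) # p2)" by blast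
    define \<kappa> r' where "\<kappa> = p1 @ (l - 1) # p2" and "r' = r1 @ (k - 1) # r2"
    define N a b where "N = sum_list p" and "a = sum_list r1" and "b = N - Suc (Suc a)"
    have l: "l \<ge> 2" using p(2,3) k by simp
    have sum_r: "sum_list r1 + k + sum_list r2 = N"
      using sum_list_refinement[OF less(2)] by (simp add: r N_def)
    have N: "N = Suc (Suc (a + b))" using sum_r k by (simp add: a_def b_def)
    have sum_\<kappa>: "sum_list \<kappa> = Suc (a + b)" using l N by (simp add: \<kappa>_def N_def p(1))
    have bs_\<kappa>: "block_sums (double_weight a b) \<kappa> = p"
      using block_sums_double_weight[of p1 a "l - 1" p2 b] p k l sum_\<kappa>
      by (simp add: \<kappa>_def a_def)
    have bs_r': "block_sums (double_weight a b) r' = r"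
      using block_sums_double_weight[of r1 a "k - 1" r2 b] k sum_r N
      by (simp add: r'_def a_def r)
    obtain \<sigma> where \<sigma>: "ordered_surjection N (Suc (a + b)) \<sigma>"
      "fibre_sizes N (Suc (a + b)) \<sigma> = double_weight a b"
      using double_weight_realised[of a b] N by blast
    have pb: "pullback N \<kappa> \<sigma> = p"
      using pullback_eq_block_sums[OF \<sigma>(1) sum_\<kappa>] \<sigma>(2) bs_\<kappa> by simp
    have "map (min 1) r' = map (min 1) r" using k by (simp add: r r'_def min_def)
    then have "jet_component (\<lambda>_. G) (map (min 1) r')" using less(3) by simp
    moreover have "sum_list \<kappa> < sum_list p" using sum_\<kappa> N by (simp add: N_def)
    ultimately obtain Q where Q: "Q \<in> D_space sA sB f \<kappa>"
      "\<forall>as. length as = length r' \<longrightarrow> Q r' (pure_tensor sA as) = G as"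
      "\<forall>r''\<in>refinements \<kappa>. r'' \<noteq> r' \<longrightarrow> length r' \<le> length r'' \<longrightarrow> Q r'' = 0"
      using less(1)[of \<kappa> r'] r'ref unfolding \<kappa>_def[symmetric] r'_def[symmetric] by blast
    let ?Q = "degeneracy N \<kappa> \<sigma> Q"
    have at: "?Q (block_sums (double_weight a b) \<kappa>') = Q \<kappa>'" if "\<kappa>' \<in> refinements \<kappa>" for \<kappa>'
      using degeneracy_at_pullback[OF \<sigma>(1) sum_\<kappa> that] \<sigma>(2) by metis
    have len_r': "length r' = length r" by (simp add: r r'_def)
    have r'\<kappa>: "r' \<in> refinements \<kappa>" using r'ref by (simp add: r'_def \<kappa>_def)
    have "?Q \<in> D_space sA sB f p"
      using degeneracy_in_D_space[OF \<sigma>(1) sum_\<kappa> Q(1)] pb by simp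
    moreover have "?Q r (pure_tensor sA as) = G as" if "length as = length r" for as
      using at[OF r'\<kappa>] bs_r' Q(2) that len_r' by simp
    moreover have "?Q r'' = 0" if r'': "r'' \<noteq> r" "length r \<le> length r''" for r''
    proof (cases "\<exists>\<kappa>'\<in>refinements \<kappa>. r'' = block_sums (double_weight a b) \<kappa>'")
      case True
      then obtain \<kappa>' where \<kappa>': "\<kappa>' \<in> refinements \<kappa>" "r'' = block_sums (double_weight a b) \<kappa>'" by blast
      then have "\<kappa>' \<noteq> r'" "length r' \<le> length \<kappa>'" using r'' bs_r' len_r' by auto
      then show ?thesis using Q(3) at \<kappa>' by simp
    next
      case False
      then show ?thesis using \<sigma>(2) by (intro degeneracy_off_pullback[OF \<sigma>(1) sum_\<kappa>]) auto
    qed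
    moreover have "?Q \<in> order_filtration sA sB f N p"
    proof -
      interpret V: vector_space "fscale :: 'k \<Rightarrow> ('k, 'a, 'b) family \<Rightarrow> _"
        by (rule vector_space_fscale)
      have "ordered_surjection N (N - 1) \<sigma>" "\<kappa> \<in> ordered_partitions (length p) (N - 1)"
        using \<sigma>(1) sum_\<kappa> N by (simp_all add: ordered_partitions_def p(1) \<kappa>_def)
      then show ?thesis unfolding order_filtration_def using Q(1) pb
        by (intro V.span_base) blast
    qed
    ultimately show ?thesis unfolding N_def by blast
  qed
qed

text \<open>
  Induction on a bound \<open>k\<close> for the number of parts of the refinements at which \<open>P\<close> does not vanish.  For
  each refinement with the maximal number of parts, other than the finest, a family with the same
  component there is subtracted; these families do not interfere with each other at this length.
\<close>

theorem order_filtrationI: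
  assumes \<Theta>: "A.splitting_derivation \<Theta>" and "sum_list p = n" "n \<ge> 1"
    and P: "P \<in> D_space sA sB f p" "P (finest_refinement p) = 0"
  shows "P \<in> order_filtration sA sB f n p"
proof -
  interpret V: vector_space "fscale :: 'k \<Rightarrow> ('k, 'a, 'b) family \<Rightarrow> _"
    by (rule vector_space_fscale)
  let ?F = "order_filtration sA sB f n p" and ?D = "D_space sA sB f p"
  have subspace_F: "V.subspace ?F" unfolding order_filtration_def by (rule V.subspace_span)
  have "P \<in> ?F" if "P \<in> ?D" "P (finest_refinement p) = 0"
    "\<And>r. r \<in> refinements p \<Longrightarrow> k < length r \<Longrightarrow> P r = 0" for k P
    using that
  proof (induction k arbitrary: P)
    case 0
    have "r \<noteq> []" if "r \<in> refinements p" for r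
      using sum_list_refinement[OF that] assms(2,3) by auto
    then have "P r = 0" for r
      using D_spaceD(1)[OF 0(1), of r] 0(3)[of r] by (cases "r \<in> refinements p") blast+
    then have "P = 0" by (intro ext[of P 0]) (simp only: zero_fun_apply)
    then show ?case using V.subspace_0[OF subspace_F] by (simp only:)
  next
    case (Suc k)
    define S where "S = {r \<in> refinements p. length r = Suc k \<and> r \<noteq> finest_refinement p}"
    have fin: "finite S" using finite_refinements by (simp add: S_def)
    have "\<exists>Q. Q \<in> ?D \<and> Q \<in> ?F \<and> Q r = P r \<and>
      (\<forall>r'\<in>refinements p. r' \<noteq> r \<longrightarrow> length r \<le> length r' \<longrightarrow> Q r' = 0)" if r: "r \<in> S" for r
    proof -
      have r': "r \<in> refinements p" "length r = Suc k" "r \<noteq> finest_refinement p"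
        using r by (auto simp: S_def)
      have "jet_component (\<lambda>_ as. P r (pure_tensor sA as)) (map (min 1) r)"
        by (rule top_component[OF Suc.prems(1) r'(1)], rule Suc.prems(3)) (simp_all add: r'(2))
      from exists_with_top_component[OF \<Theta> r'(1) this] obtain Q where Q: "Q \<in> ?D"
        "\<And>as. length as = length r \<Longrightarrow> Q r (pure_tensor sA as) = P r (pure_tensor sA as)"
        "\<forall>r'\<in>refinements p. r' \<noteq> r \<longrightarrow> length r \<le> length r' \<longrightarrow> Q r' = 0" "Q \<in> ?F"
        using r'(3) assms(2) by blast
      have "Q r = P r"
        by (rule tensor_hom_ext[OF D_spaceD(2)[OF Q(1) r'(1)] D_spaceD(2)[OF Suc.prems(1) r'(1)] Q(2)])
      then show ?thesis using Q by blast
    qed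
    then have "\<forall>r\<in>S. \<exists>Q. Q \<in> ?D \<and> Q \<in> ?F \<and> Q r = P r \<and>
      (\<forall>r'\<in>refinements p. r' \<noteq> r \<longrightarrow> length r \<le> length r' \<longrightarrow> Q r' = 0)" by (rule ballI)
    from bchoice[OF this] obtain Q where Q': "\<forall>r\<in>S. Q r \<in> ?D \<and> Q r \<in> ?F \<and> Q r r = P r \<and>
      (\<forall>r'\<in>refinements p. r' \<noteq> r \<longrightarrow> length r \<le> length r' \<longrightarrow> Q r r' = 0)" by (rule exE)
    have Q: "\<And>r. r \<in> S \<Longrightarrow> Q r \<in> ?D" "\<And>r. r \<in> S \<Longrightarrow> Q r \<in> ?F"
      "\<And>r. r \<in> S \<Longrightarrow> Q r r = P r"
      "\<And>r r'. r \<in> S \<Longrightarrow> r' \<in> refinements p \<Longrightarrow> r' \<noteq> r \<Longrightarrow> length r \<le> length r' \<Longrightarrow> Q r r' = 0"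
      by (drule bspec[OF Q'], elim conjE, blast)+
    define R where "R = (\<Sum>r\<in>S. Q r)"
    have R_apply: "R r' = (\<Sum>r\<in>S. Q r r')" for r'
      unfolding R_def by (rule sum_fun_apply)
    have R0: "R r' = 0" if "r' \<in> refinements p" "r' \<notin> S" "Suc k \<le> length r'" for r'
      unfolding R_apply using that by (intro sum.neutral ballI Q(4)) (auto simp: S_def)
    have R1: "R r' = P r'" if r': "r' \<in> S" for r'
    proof -
      have "R r' = Q r' r' + (\<Sum>r\<in>S - {r'}. Q r r')"
        unfolding R_apply by (rule sum.remove[OF fin r'])
      also have "(\<Sum>r\<in>S - {r'}. Q r r') = 0"
        using r' by (intro sum.neutral ballI Q(4)) (auto simp: S_def)
      finally show ?thesis by (simp only: Q(3)[OF r'] add_0_right)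
    qed
    have RF: "R \<in> ?F" unfolding R_def by (rule V.subspace_sum[OF subspace_F]) (rule Q(2))
    have RD: "R \<in> ?D" unfolding R_def by (rule V.subspace_sum[OF subspace_D_space]) (rule Q(1))
    have "P - R \<in> ?F"
    proof (rule Suc.IH)
      show "P - R \<in> ?D" by (rule V.subspace_diff[OF subspace_D_space Suc.prems(1) RD])
      have minus: "(P - R) r = P r - R r" for r by (rule fun_diff_def[THEN fun_cong, THEN trans]) simp
      have vanish: "(P - R) r = 0" if "r \<in> refinements p" "k < length r" for r
      proof (cases "r \<in> S")
        case True
        then show ?thesis by (simp only: minus R1 diff_self)
      next
        case False
        have "P r = 0"
        proof (cases "length r = Suc k")
          case True
          then have "r = finest_refinement p" using that(1) False unfolding S_def by blast
          then show ?thesis using Suc.prems(2) by blast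
        next
          case False
          then have "Suc k < length r" using that(2) by simp
          then show ?thesis by (rule Suc.prems(3)[OF that(1)])
        qed
        then show ?thesis using R0[OF that(1) False] that(2) by (simp add: minus)
      qed
      then show "(P - R) r = 0" if "r \<in> refinements p" "k < length r" for r using that by blast
      show "(P - R) (finest_refinement p) = 0"
      proof (cases "S = {}")
        case True
        then have "R = 0" unfolding R_def by (simp only: sum.empty)
        then show ?thesis by (simp only: diff_0_right Suc.prems(2))
      next
        case False
        then obtain r where "r \<in> S" by blast
        then have "k < length (finest_refinement p)"
          using length_less_finest_refinement[of r p] by (simp add: S_def)
        then show ?thesis using vanish finest_refinement_in_refinements by blast
      qed
    qed
    then have "P - R + R \<in> ?F" using RF by (rule V.subspace_add[OF subspace_F])
    then show ?case by (simp only: diff_add_cancel)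
  qed
  note vanishing_above = this
  show ?thesis
  proof (rule vanishing_above[OF P, of "length (finest_refinement p)"])
    fix r assume r: "r \<in> refinements p" "length (finest_refinement p) < length r"
    then have "\<not> length r < length (finest_refinement p)" "r \<noteq> finest_refinement p" by auto
    then show "P r = 0" using length_less_finest_refinement[OF r(1)] by blast
  qed
qed

end


section \<open>Deleting zero parts\<close>

abbreviation nonzero_count :: "nat list \<Rightarrow> nat"
  where "nonzero_count z \<equiv> length (filter (\<lambda>n. n \<noteq> 0) z)"

lemma nonzero_args_Nil [simp]: "nonzero_args [] as = []"
  and nonzero_args_Cons [simp]: "nonzero_args (n # z) (a # as) =
    (if n = 0 then nonzero_args z as else a # nonzero_args z as)"
  by (simp_all add: nonzero_args_def)

lemma nonzero_args_append:
  "length as1 = length z1 \<Longrightarrow>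
    nonzero_args (z1 @ z2) (as1 @ as2) = nonzero_args z1 as1 @ nonzero_args z2 as2"
  by (simp add: nonzero_args_def)

lemma length_nonzero_args: "length as = length z \<Longrightarrow> length (nonzero_args z as) = nonzero_count z"
  by (induction as z rule: list_induct2) auto

lemma nonzero_args_ones: "length as = n \<Longrightarrow> nonzero_args (replicate n (1::nat)) as = as"
  by (induction n arbitrary: as) (auto simp: length_Suc_conv)

lemma length_fill_zero_parts: "length cs = length z \<Longrightarrow> length (fill_zero_parts z cs bs) = length z"
  by (induction cs z arbitrary: bs rule: list_induct2) auto

lemma fill_zero_parts_append:
  "length cs1 = length z1 \<Longrightarrow> length bs1 = nonzero_count z1 \<Longrightarrow>
    fill_zero_parts (z1 @ z2) (cs1 @ cs2) (bs1 @ bs2) =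
    fill_zero_parts z1 cs1 bs1 @ fill_zero_parts z2 cs2 bs2"
proof (induction cs1 z1 arbitrary: bs1 rule: list_induct2)
  case (Cons c cs n z)
  show ?case
  proof (cases "n = 0")
    case True
    then show ?thesis using Cons.IH[of bs1] Cons.prems by simp
  next
    case False
    then show ?thesis using Cons.IH[of "tl bs1"] Cons.prems by (cases bs1) auto
  qed
qed simp

lemma fill_zero_parts_ones:
  "length cs = n \<Longrightarrow> length bs = n \<Longrightarrow> fill_zero_parts (replicate n 1) cs bs = bs"
proof (induction n arbitrary: cs bs)
  case (Suc n)
  then show ?case by (cases cs; cases bs) auto
qed auto

lemma nonzero_args_fill:
  "length cs = length z \<Longrightarrow> length bs = nonzero_count z \<Longrightarrow>
    nonzero_args z (fill_zero_parts z cs bs) = bs"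
proof (induction cs z arbitrary: bs rule: list_induct2)
  case (Cons c cs n z)
  show ?case
  proof (cases "n = 0")
    case True
    then show ?thesis using Cons.IH[of bs] Cons.prems by simp
  next
    case False
    then show ?thesis using Cons.IH[of "tl bs"] Cons.prems by (cases bs) auto
  qed
qed simp

text \<open>Only the entries of the filling list at the zero parts matter, and these are \<open>f 1 = 1\<close>.\<close>

lemma fill_zero_parts_units:
  assumes "f 1 = (1 :: 'b :: one)"
  shows "length bs = nonzero_count z \<Longrightarrow>
    fill_zero_parts z (map f (fill_zero_parts z (replicate (length z) (1 :: 'a :: one)) bs)) ys =
    fill_zero_parts z (replicate (length z) 1) ys"
proof (induction z arbitrary: bs ys)
  case (Cons n z)
  then show ?case using assms by (cases bs) auto
qed simp

lemma nonzero_count_split: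
  "nonzero_count z = Suc (i + j) \<Longrightarrow>
    \<exists>z1 n z2. z = z1 @ n # z2 \<and> n \<noteq> 0 \<and> nonzero_count z1 = i \<and> nonzero_count z2 = j"
proof (induction z arbitrary: i)
  case (Cons n z)
  show ?case
  proof (cases "n = 0")
    case True
    with Cons obtain z1 k z2 where "z = z1 @ k # z2" "k \<noteq> 0" "nonzero_count z1 = i"
      "nonzero_count z2 = j" by fastforce
    then show ?thesis using True by (intro exI[of _ "n # z1"] exI[of _ k] exI[of _ z2]) simp
  next
    case nz: False
    show ?thesis
    proof (cases i)
      case 0
      then show ?thesis using Cons.prems nz by (intro exI[of _ "[]"] exI[of _ n] exI[of _ z]) simp
    next
      case (Suc i')
      with Cons nz obtain z1 k z2 where "z = z1 @ k # z2" "k \<noteq> 0" "nonzero_count z1 = i'"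
        "nonzero_count z2 = j" by fastforce
      then show ?thesis using nz Suc by (intro exI[of _ "n # z1"] exI[of _ k] exI[of _ z2]) simp
    qed
  qed
qed simp

lemma fill_zero_parts_split:
  assumes "Suc (length bs1 + length bs2) = nonzero_count z" "length cs = length z"
  shows "\<exists>z1 n z2 u v. z = z1 @ n # z2 \<and> n \<noteq> 0 \<and> nonzero_count z1 = length bs1 \<and>
    length u = length z1 \<and> length v = length z2 \<and>
    (\<forall>x. fill_zero_parts z cs (bs1 @ x # bs2) = u @ x # v)"
proof -
  obtain z1 n z2 where z: "z = z1 @ n # z2" "n \<noteq> 0" "nonzero_count z1 = length bs1"
    "nonzero_count z2 = length bs2"
    using nonzero_count_split[of z "length bs1" "length bs2"] assms(1) by auto
  obtain cs1 c cs2 where cs: "cs = cs1 @ c # cs2" "length cs1 = length z1"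
    using split_at[of "length z1" cs] assms(2) z(1) by auto
  have len: "length cs2 = length z2" using assms(2) z(1) cs by simp
  show ?thesis
    using z(2,3) cs(2) len fill_zero_parts_append[OF cs(2) z(3)[symmetric], of "n # z2" "c # cs2"]
    unfolding z(1) cs(1)
    by (intro exI[of _ z1] exI[of _ n] exI[of _ z2] exI[of _ "fill_zero_parts z1 cs1 bs1"]
        exI[of _ "fill_zero_parts z2 cs2 bs2"]) (simp add: length_fill_zero_parts)
qed

context k_algebra
begin

definition zero_weight :: "nat list \<Rightarrow> 'a list \<Rightarrow> 'k"
  where "zero_weight z xs =
    prod_list (map (\<lambda>(n, x). if n = 0 then unit_functional x else 1) (zip z xs))"

text \<open>
  The unit functional is applied to the factors at the zero parts of \<open>z\<close>.  By construction this is a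
  left inverse to the insertion of units: see \<open>remove_fill_zeros\<close>.
\<close>

definition remove_zeros :: "nat list \<Rightarrow> ('k, 'a) tensor \<Rightarrow> ('k, 'a) tensor"
  where "remove_zeros z T = (\<lambda>\<phi>. if multilinear scale (*) (nonzero_count z) \<phi>
    then T (\<lambda>xs. zero_weight z xs * \<phi> (nonzero_args z xs)) else 0)"

abbreviation fill_zeros :: "nat list \<Rightarrow> 'a list \<Rightarrow> ('k, 'a) tensor \<Rightarrow> ('k, 'a) tensor"
  where "fill_zeros z cs \<equiv> tensor_map scale (length z) (fill_zero_parts z cs)"

lemma zero_weight_Nil [simp]: "zero_weight [] xs = 1"
  and zero_weight_Cons [simp]: "zero_weight (n # z) (x # xs) =
    (if n = 0 then unit_functional x else 1) * zero_weight z xs"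
  by (simp_all add: zero_weight_def)

lemma zero_weight_append:
  "length xs1 = length z1 \<Longrightarrow>
    zero_weight (z1 @ z2) (xs1 @ xs2) = zero_weight z1 xs1 * zero_weight z2 xs2"
  by (simp add: zero_weight_def)

lemma zero_weight_ones: "zero_weight (replicate n 1) xs = 1"
  by (induction n arbitrary: xs) (auto simp: zero_weight_def zip_Cons1 split: list.split)

lemma tensor_linear_remove_zeros: "tensor_linear (remove_zeros z)"
  by (rule linear_intro) (auto simp: vector_space_tscale remove_zeros_def tscale_def fun_eq_iff)

lemma remove_zeros_pure:
  assumes "length xs = length z"
  shows "remove_zeros z (pure_tensor scale xs) =
    tscale (zero_weight z xs) (pure_tensor scale (nonzero_args z xs))"
proof -
  have "multilinear scale (*) (length z) (\<lambda>xs. zero_weight z xs * \<phi> (nonzero_args z xs))"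
    if \<phi>: "multilinear scale (*) (nonzero_count z) \<phi>" for \<phi>
  proof (rule multilinearI)
    fix xs ys :: "'a list" assume len: "Suc (length xs + length ys) = length z"
    then obtain z1 n z2 where z: "z = z1 @ n # z2" "length z1 = length xs"
      using split_at[of "length xs" z] by auto
    have lens: "length xs = length z1" "length ys = length z2" using z len by auto
    show "Vector_Spaces.linear scale (*)
        (\<lambda>x. zero_weight z (xs @ x # ys) * \<phi> (nonzero_args z (xs @ x # ys)))"
    proof (cases "n = 0")
      case True
      then show ?thesis unfolding z(1)
        by (simp add: zero_weight_append nonzero_args_append lens linear_times_const
            linear_unit_functional)
    next
      case False
      have "Vector_Spaces.linear scale (*) (\<lambda>x. \<phi> (nonzero_args z1 xs @ x # nonzero_args z2 ys))"
        by (rule multilinearD[OF \<phi>]) (use False lens in \<open>simp add: z(1) length_nonzero_args\<close>)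
      with False show ?thesis unfolding z(1)
        by (simp add: zero_weight_append nonzero_args_append lens linear_times_const)
    qed
  qed
  then show ?thesis
    using assms length_nonzero_args[OF assms]
    by (auto simp: remove_zeros_def pure_tensor_def tscale_def fun_eq_iff)
qed

lemma fill_zeros_pure:
  assumes "length bs = nonzero_count z" "length cs = length z"
  shows "fill_zeros z cs (pure_tensor scale bs) = pure_tensor scale (fill_zero_parts z cs bs)"
proof (rule tensor_map_pure)
  fix \<phi> :: "'a list \<Rightarrow> 'k" assume \<phi>: "multilinear scale (*) (length z) \<phi>"
  show "multilinear scale (*) (length bs) (\<lambda>xs. \<phi> (fill_zero_parts z cs xs))"
  proof (rule multilinearI)
    fix bs1 bs2 :: "'a list" assume "Suc (length bs1 + length bs2) = length bs"
    then obtain z1 n z2 u v where "z = z1 @ n # z2" "length u = length z1" "length v = length z2"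
      and eq: "\<forall>x. fill_zero_parts z cs (bs1 @ x # bs2) = u @ x # v"
      using fill_zero_parts_split[of bs1 bs2 z cs] assms by auto
    then have "Suc (length u + length v) = length z" by simp
    from multilinearD[OF \<phi> this]
    show "Vector_Spaces.linear scale (*) (\<lambda>x. \<phi> (fill_zero_parts z cs (bs1 @ x # bs2)))"
      by (simp only: eq)
  qed
qed (use assms in \<open>simp add: length_fill_zero_parts\<close>)

text \<open>
  In the zero algebra the unit functional vanishes; but there so do all tensors of positive degree,
  whence the condition that there is a non-zero part.
\<close>

lemma remove_fill_zeros:
  assumes "T \<in> tensor_power scale (nonzero_count z)" "nonzero_count z > 0"
  shows "remove_zeros z (fill_zeros z (replicate (length z) 1) T) = T"
proof (rule linear_eq_on_tensor_power[OF assms(1) _ tensor_linear_id])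
  show "tensor_linear (\<lambda>T. remove_zeros z (fill_zeros z (replicate (length z) 1) T))"
    by (rule linear_compose_field[OF tensor_linear_tensor_map tensor_linear_remove_zeros])
  fix bs :: "'a list" assume bs: "length bs = nonzero_count z"
  then obtain b bs' where ne: "bs = b # bs'" using assms(2) by (cases bs) auto
  have unit: "tscale (unit_functional 1) (pure_tensor scale bs) = pure_tensor scale bs"
    using linear_scaleD[OF linear_pure_tensor[of "[]" bs'], of "unit_functional 1" b, symmetric]
    by (simp add: ne scale_unit_functional_one)
  have "tscale (zero_weight z' (fill_zero_parts z' (replicate (length z') 1) bs'))
      (pure_tensor scale bs) = pure_tensor scale bs" if "length bs' = nonzero_count z'" for z' bs'
    using that
  proof (induction z' arbitrary: bs')
    case Nil
    then show ?case by (simp add: tscale_def fun_eq_iff)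
  next
    case (Cons n z')
    show ?case
    proof (cases "n = 0")
      case True
      have "tscale (unit_functional 1 * c) (pure_tensor scale bs) =
          tscale c (tscale (unit_functional 1) (pure_tensor scale bs))" for c
        by (simp add: tscale_def fun_eq_iff)
      then show ?thesis using Cons True by (simp add: unit)
    next
      case False
      then show ?thesis using Cons by (cases bs') auto
    qed
  qed
  from this[OF bs] show "remove_zeros z (fill_zeros z (replicate (length z) 1) (pure_tensor scale bs)) =
      pure_tensor scale bs"
    using bs by (simp add: fill_zeros_pure remove_zeros_pure length_fill_zero_parts nonzero_args_fill)
qed

lemma fill_zeros_in:
  assumes "T \<in> tensor_power scale (nonzero_count z)" "length cs = length z"
  shows "fill_zeros z cs T \<in> tensor_power scale (length z)"
  by (rule linear_image_tensor_power[OF assms(1) tensor_linear_tensor_map])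
    (use assms(2) in \<open>simp add: fill_zeros_pure tensor_power_pure length_fill_zero_parts\<close>)

lemma remove_zeros_in:
  assumes "T \<in> tensor_power scale (length z)"
  shows "remove_zeros z T \<in> tensor_power scale (nonzero_count z)"
  by (rule linear_image_tensor_power[OF assms tensor_linear_remove_zeros])
    (simp add: remove_zeros_pure tensor_power_scale tensor_power_pure length_nonzero_args)

lemma fill_remove_no_zeros:
  assumes "T \<in> tensor_power scale n" "length cs = n"
  shows "fill_zeros (replicate n 1) cs (remove_zeros (replicate n 1) T) = T"
proof (rule linear_eq_on_tensor_power[OF assms(1) _ tensor_linear_id])
  show "tensor_linear (\<lambda>T. fill_zeros (replicate n 1) cs (remove_zeros (replicate n 1) T))"
    by (rule linear_compose_field[OF tensor_linear_remove_zeros tensor_linear_tensor_map])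
  show "fill_zeros (replicate n 1) cs (remove_zeros (replicate n 1) (pure_tensor scale xs)) =
      pure_tensor scale xs" if "length xs = n" for xs
    using that assms(2) fill_zeros_pure[of xs "replicate n 1" cs]
      linear_scaleD[OF tensor_linear_tensor_map]
    by (simp add: remove_zeros_pure nonzero_args_ones[simplified] zero_weight_ones[simplified]
        fill_zero_parts_ones[simplified] tscale_def fun_eq_iff del: replicate_Suc)
qed

text \<open>
  Turns a factor at a part \<open>1\<close> into a factor at a part \<open>0\<close>.  It makes up the induction by which a map
  which inserts at all zero parts is seen to arise from a map without these arguments.
\<close>

lemma fill_remove_replace:
  fixes z1 :: "nat list" and m :: nat
  assumes "T \<in> tensor_power scale (Suc (length z1 + m))" "length cs1 = length z1" "length cs2 = m"
  shows "fill_zeros (z1 @ 1 # replicate m 1) (cs1 @ c # cs2) (remove_zeros (z1 @ 1 # replicate m 1)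
      (replace_factor (Suc (length z1 + m)) (length z1) c T)) =
    fill_zeros (z1 @ 0 # replicate m 1) (cs1 @ c # cs2) (remove_zeros (z1 @ 0 # replicate m 1) T)"
  (is "?L T = ?R T")
proof (rule linear_eq_on_tensor_power[OF assms(1), where t = tscale])
  show "tensor_linear ?L"
    by (rule linear_compose_field[OF linear_compose_field[OF tensor_linear_replace_factor
            tensor_linear_remove_zeros] tensor_linear_tensor_map])
  show "tensor_linear ?R"
    by (rule linear_compose_field[OF tensor_linear_remove_zeros tensor_linear_tensor_map])
  fix xs :: "'a list" assume "length xs = Suc (length z1 + m)"
  then obtain xs1 x xs2 where xs: "xs = xs1 @ x # xs2" "length xs1 = length z1" "length xs2 = m"
    using split_at[of "length z1" xs] by auto
  let ?z1 = "z1 @ 1 # replicate m 1" and ?z0 = "z1 @ 0 # replicate m (1::nat)"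
  let ?cs = "cs1 @ c # cs2" and ?n = "nonzero_args z1 xs1"
  have lens: "length (xs1 @ c # xs2) = length ?z1" "length (xs1 @ x # xs2) = length ?z0"
    "length ?cs = length ?z1" "length ?cs = length ?z0" using xs assms by simp_all
  have n: "length ?n = nonzero_count z1" by (rule length_nonzero_args[OF xs(2)])
  have ones: "nonzero_args (replicate m 1) xs2 = xs2" "fill_zero_parts (replicate m 1) cs2 xs2 = xs2"
    by (rule nonzero_args_ones[OF xs(3)], rule fill_zero_parts_ones[OF assms(3) xs(3)])
  have rm1: "remove_zeros ?z1 (pure_tensor scale (xs1 @ c # xs2)) =
      tscale (zero_weight z1 xs1) (pure_tensor scale (?n @ c # xs2))"
    unfolding remove_zeros_pure[OF lens(1)]
    by (simp add: zero_weight_append nonzero_args_append xs(2) zero_weight_ones[simplified]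
        ones(1)[simplified])
  have rm0: "remove_zeros ?z0 (pure_tensor scale (xs1 @ x # xs2)) =
      tscale (zero_weight z1 xs1 * unit_functional x) (pure_tensor scale (?n @ xs2))"
    unfolding remove_zeros_pure[OF lens(2)]
    by (simp add: zero_weight_append nonzero_args_append xs(2) zero_weight_ones[simplified]
        ones(1)[simplified])
  have fl1: "fill_zeros ?z1 ?cs (pure_tensor scale (?n @ c # xs2)) =
      pure_tensor scale (fill_zero_parts z1 cs1 ?n @ c # xs2)"
    using fill_zeros_pure[of "?n @ c # xs2" ?z1 ?cs] lens n xs(3)
    by (simp add: fill_zero_parts_append[OF assms(2) n] ones(2)[simplified])
  have fl0: "fill_zeros ?z0 ?cs (pure_tensor scale (?n @ xs2)) =
      pure_tensor scale (fill_zero_parts z1 cs1 ?n @ c # xs2)"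
    using fill_zeros_pure[of "?n @ xs2" ?z0 ?cs] lens n xs(3)
    by (simp add: fill_zero_parts_append[OF assms(2) n] ones(2)[simplified])
  have "replace_factor (Suc (length z1 + m)) (length z1) c (pure_tensor scale (xs1 @ x # xs2)) =
      tscale (unit_functional x) (pure_tensor scale (xs1 @ c # xs2))"
    by (rule replace_factor_pure_append) (simp_all add: xs)
  then show "?L (pure_tensor scale xs) = ?R (pure_tensor scale xs)"
    unfolding xs(1)
    by (simp only: rm1 rm0 fl1 fl0 linear_scaleD[OF tensor_linear_remove_zeros]
        linear_scaleD[OF tensor_linear_tensor_map])
      (simp add: tscale_def fun_eq_iff)
qed

lemma remove_zeros_factor_map:
  assumes "T \<in> tensor_power scale (length z)" "z = z1 @ n # z2" "n \<noteq> 0"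
    and h: "Vector_Spaces.linear scale scale h"
  shows "remove_zeros z (factor_map (length z) (length z1) h T) =
    factor_map (nonzero_count z) (nonzero_count z1) h (remove_zeros z T)"
proof (rule linear_eq_on_tensor_power[OF assms(1)
      linear_compose_field[OF tensor_linear_factor_map tensor_linear_remove_zeros]
      linear_compose_field[OF tensor_linear_remove_zeros tensor_linear_factor_map]])
  fix xs :: "'a list" assume len: "length xs = length z"
  obtain u x v where xs: "xs = u @ x # v" "length u = length z1"
    using split_at[of "length z1" xs] len assms(2) by auto
  then have v: "length v = length z2" using len assms(2) by simp
  have rm: "remove_zeros z (pure_tensor scale (u @ y # v)) =
      tscale (zero_weight z1 u * zero_weight z2 v)
        (pure_tensor scale (nonzero_args z1 u @ y # nonzero_args z2 v))" for y
    using xs(2) v assms(3) remove_zeros_pure[of "u @ y # v" z]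
    by (simp add: assms(2) zero_weight_append nonzero_args_append)
  have 1: "Suc (length u + length v) = length z" using xs(2) v assms(2) by simp
  have 2: "Suc (length (nonzero_args z1 u) + length (nonzero_args z2 v)) = nonzero_count z"
    "nonzero_count z1 = length (nonzero_args z1 u)"
    using xs(2) v assms(2,3) by (simp_all add: length_nonzero_args)
  show "remove_zeros z (factor_map (length z) (length z1) h (pure_tensor scale xs)) =
      factor_map (nonzero_count z) (nonzero_count z1) h (remove_zeros z (pure_tensor scale xs))"
    unfolding xs(1)
    by (simp only: factor_map_pure_append[OF 1 xs(2)[symmetric] h] rm
        factor_map_pure_append[OF 2 h] linear_scaleD[OF tensor_linear_factor_map])
qed

lemma fill_zeros_factor_map:
  assumes "T \<in> tensor_power scale (nonzero_count z)" "z = z1 @ n # z2" "n \<noteq> 0" "length cs = length z"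
    and h: "Vector_Spaces.linear scale scale h"
  shows "fill_zeros z cs (factor_map (nonzero_count z) (nonzero_count z1) h T) =
    factor_map (length z) (length z1) h (fill_zeros z cs T)"
proof (rule linear_eq_on_tensor_power[OF assms(1)
      linear_compose_field[OF tensor_linear_factor_map tensor_linear_tensor_map]
      linear_compose_field[OF tensor_linear_tensor_map tensor_linear_factor_map]])
  obtain c1 c c2 where cs: "cs = c1 @ c # c2" "length c1 = length z1" "length c2 = length z2"
    using split_at[of "length z1" cs] assms(2,4) by auto
  fix bs :: "'a list" assume len: "length bs = nonzero_count z"
  obtain u x v where bs: "bs = u @ x # v" "length u = nonzero_count z1" "length v = nonzero_count z2"
    using split_at[of "nonzero_count z1" bs] len assms(2,3) by auto
  have fl: "fill_zeros z cs (pure_tensor scale (u @ y # v)) =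
      pure_tensor scale (fill_zero_parts z1 c1 u @ y # fill_zero_parts z2 c2 v)" for y
    using bs(2,3) assms(3) fill_zeros_pure[of "u @ y # v" z cs] cs
    by (simp add: assms(2) fill_zero_parts_append)
  have 1: "Suc (length u + length v) = nonzero_count z" using bs(2,3) assms(2,3) by simp
  have 2: "Suc (length (fill_zero_parts z1 c1 u) + length (fill_zero_parts z2 c2 v)) = length z"
    "length z1 = length (fill_zero_parts z1 c1 u)"
    using cs assms(2) by (simp_all add: length_fill_zero_parts)
  show "fill_zeros z cs (factor_map (nonzero_count z) (nonzero_count z1) h (pure_tensor scale bs)) =
      factor_map (length z) (length z1) h (fill_zeros z cs (pure_tensor scale bs))"
    unfolding bs(1)
    by (simp only: factor_map_pure_append[OF 1 bs(2)[symmetric] h] fl factor_map_pure_append[OF 2 h])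
qed

lemmas remove_zeros_mult =
    remove_zeros_factor_map[OF _ _ _ linear_mult_left, folded lmult_eq_factor_map]
    remove_zeros_factor_map[OF _ _ _ linear_mult_right, folded rmult_eq_factor_map]
  and fill_zeros_mult =
    fill_zeros_factor_map[OF _ _ _ _ linear_mult_left, folded lmult_eq_factor_map]
    fill_zeros_factor_map[OF _ _ _ _ linear_mult_right, folded rmult_eq_factor_map]

text \<open>
  The next two lemmas describe the dependence on the filling list: on an entry at a zero part it is
  by insertion, on an entry at another part there is none.
\<close>

lemma fill_zeros_at_zero:
  assumes "T \<in> tensor_power scale (nonzero_count z)" "z = z1 @ 0 # z2"
    "length c1 = length z1" "length c2 = length z2"
  shows "fill_zeros z (c1 @ c # c2) T =
      replace_factor (length z) (length z1) c (fill_zeros z (c1 @ 1 # c2) T)"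
proof (rule linear_eq_on_tensor_power[OF assms(1) tensor_linear_tensor_map
      linear_compose_field[OF tensor_linear_tensor_map tensor_linear_replace_factor]])
  fix bs :: "'a list" assume bs: "length bs = nonzero_count z"
  obtain u v where uv: "bs = u @ v" "length u = nonzero_count z1" "length v = nonzero_count z2"
  proof
    show "bs = take (nonzero_count z1) bs @ drop (nonzero_count z1) bs" by simp
  qed (use bs assms(2) in simp_all)
  have "fill_zeros z (c1 @ d # c2) (pure_tensor scale bs) =
      pure_tensor scale (fill_zero_parts z1 c1 u @ d # fill_zero_parts z2 c2 v)" for d
    using fill_zeros_pure[OF bs, of "c1 @ d # c2"] assms(2-4)
    by (simp add: uv(1) fill_zero_parts_append[OF assms(3) uv(2)])
  moreover have "replace_factor (length z) (length z1) c
      (pure_tensor scale (fill_zero_parts z1 c1 u @ 1 # fill_zero_parts z2 c2 v)) =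
      pure_tensor scale (fill_zero_parts z1 c1 u @ c # fill_zero_parts z2 c2 v)"
    by (rule replace_factor_unit) (use assms(2-4) in \<open>simp_all add: length_fill_zero_parts\<close>)
  ultimately show "fill_zeros z (c1 @ c # c2) (pure_tensor scale bs) =
      replace_factor (length z) (length z1) c (fill_zeros z (c1 @ 1 # c2) (pure_tensor scale bs))"
    by (simp only:)
qed

lemma fill_zeros_at_nonzero:
  assumes "T \<in> tensor_power scale (nonzero_count z)" "z = z1 @ n # z2" "n \<noteq> 0"
    "length c1 = length z1" "length c2 = length z2"
  shows "fill_zeros z (c1 @ c # c2) T = fill_zeros z (c1 @ c' # c2) T"
proof (rule linear_eq_on_tensor_power[OF assms(1) tensor_linear_tensor_map tensor_linear_tensor_map])
  fix bs :: "'a list" assume bs: "length bs = nonzero_count z"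
  obtain u x v where uv: "bs = u @ x # v" "length u = nonzero_count z1" "length v = nonzero_count z2"
    using split_at[of "nonzero_count z1" bs] bs assms(2,3) by auto
  have "fill_zeros z (c1 @ d # c2) (pure_tensor scale bs) =
      pure_tensor scale (fill_zero_parts z1 c1 u @ x # fill_zero_parts z2 c2 v)" for d
    using fill_zeros_pure[OF bs, of "c1 @ d # c2"] assms(2-5)
    by (simp add: uv(1) fill_zero_parts_append[OF assms(4) uv(2)])
  then show "fill_zeros z (c1 @ c # c2) (pure_tensor scale bs) =
      fill_zeros z (c1 @ c' # c2) (pure_tensor scale bs)" by (simp only:)
qed

end


section \<open>The symbol map\<close>

context k_algebra_hom
begin

text \<open>
  The relation by which the deletion of zero parts is specified; existence and uniqueness of \<open>Q\<close>
  justify the description operator in the definition of the symbol map.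
\<close>

definition zero_part_deletion ::
  "nat list \<Rightarrow> (('k, 'a) tensor \<Rightarrow> ('k, 'b) tensor) \<Rightarrow> (('k, 'a) tensor \<Rightarrow> ('k, 'b) tensor) \<Rightarrow> bool"
  where "zero_part_deletion z T Q \<longleftrightarrow>
    Q \<in> tensor_hom sA sB (nonzero_count z) (nonzero_count z) \<and>
    (\<forall>as. length as = length z \<longrightarrow>
      T (pure_tensor sA as) = B.fill_zeros z (map f as) (Q (pure_tensor sA (nonzero_args z as))))"

text \<open>At arguments which are units at the zero parts, \<open>T\<close> inserts units, and these can be removed.\<close>

lemma zero_part_deletion_eq:
  assumes "zero_part_deletion z T Q" "nonzero_count z > 0" "length bs = nonzero_count z"
  shows "Q (pure_tensor sA bs) =
    B.remove_zeros z (T (pure_tensor sA (fill_zero_parts z (replicate (length z) 1) bs)))"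
proof -
  let ?as = "fill_zero_parts z (replicate (length z) 1) bs"
  have Q: "Q \<in> tensor_hom sA sB (nonzero_count z) (nonzero_count z)"
    and T: "\<And>as. length as = length z \<Longrightarrow>
      T (pure_tensor sA as) = B.fill_zeros z (map f as) (Q (pure_tensor sA (nonzero_args z as)))"
    using assms(1) by (auto simp: zero_part_deletion_def)
  have len: "length ?as = length z" by (simp add: length_fill_zero_parts)
  have "fill_zero_parts z (map f ?as) = fill_zero_parts z (replicate (length z) 1)"
    using fill_zero_parts_units[of f bs z, OF hom_one assms(3)] by (intro ext)
  then have "T (pure_tensor sA ?as) = B.fill_zeros z (replicate (length z) 1) (Q (pure_tensor sA bs))"
    using T[OF len] assms(3) by (simp add: nonzero_args_fill)
  moreover have "Q (pure_tensor sA bs) \<in> tensor_power sB (nonzero_count z)"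
    by (rule tensor_hom_value[OF Q tensor_power_pure[OF assms(3)]])
  ultimately show ?thesis using B.remove_fill_zeros assms(2) by simp
qed

lemma zero_part_deletion_unique:
  assumes "zero_part_deletion z T Q" "zero_part_deletion z T Q'" "nonzero_count z > 0"
  shows "Q = Q'"
proof (rule tensor_hom_ext)
  show "Q \<in> tensor_hom sA sB (nonzero_count z) (nonzero_count z)"
    "Q' \<in> tensor_hom sA sB (nonzero_count z) (nonzero_count z)"
    using assms by (auto simp: zero_part_deletion_def)
  show "Q (pure_tensor sA bs) = Q' (pure_tensor sA bs)" if "length bs = nonzero_count z" for bs
    using zero_part_deletion_eq[OF assms(1,3) that] zero_part_deletion_eq[OF assms(2,3) that] by simp
qed

text \<open>
  The formula for \<open>Q\<close> is forced by \<open>zero_part_deletion_eq\<close>.  To see that \<open>T\<close> is given by it, the zero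
  parts are treated one at a time from left to right.
\<close>

lemma zero_part_deletion_exists:
  assumes T: "T \<in> tensor_hom sA sB (length z) (length z)"
    and ins: "inserts_at_zeros z (\<lambda>as. T (pure_tensor sA as))" and z: "\<forall>k\<in>set z. k \<le> 1"
  shows "\<exists>Q. zero_part_deletion z T Q"
proof -
  have tm: "tensor_multilinear (length z) (\<lambda>as. T (pure_tensor sA as))"
    by (rule tensor_multilinear_tensor_hom[OF T])
  have ml: "multilinear sA tscale (length z) (\<lambda>as. T (pure_tensor sA as))"
    and val: "\<And>as. length as = length z \<Longrightarrow> T (pure_tensor sA as) \<in> tensor_power sB (length z)"
    using tm by (auto simp: tensor_multilinear_def)
  let ?u = "\<lambda>z bs. fill_zero_parts z (replicate (length z) (1 :: 'a)) bs"
  \<comment> \<open>The arguments at the zero parts in a prefix \<open>z1\<close> of \<open>z\<close> are set to \<open>1\<close>, and filled in again.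
    Replacing the later parts by \<open>1\<close> has the effect that zero parts among them are left alone.\<close>
  have prefix: "T (pure_tensor sA (as1 @ as2)) =
      B.fill_zeros (z1 @ replicate (length z2) 1) (map f (as1 @ as2))
        (B.remove_zeros (z1 @ replicate (length z2) 1)
          (T (pure_tensor sA (?u z1 (nonzero_args z1 as1) @ as2))))"
    if "z = z1 @ z2" "length as1 = length z1" "length as2 = length z2" for z1 z2 as1 as2
    using that
  proof (induction z1 arbitrary: z2 as1 as2 rule: rev_induct)
    case Nil
    then have "length as2 = length z2" "length (map f as2) = length z2" "length z = length z2" by simp_all
    then show ?case
      using B.fill_remove_no_zeros[OF val[of as2], of "map f as2"] Nil by simp
  next
    case (snoc n z1)
    from snoc.prems(2) obtain as1' a where as1: "as1 = as1' @ [a]" "length as1' = length z1"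
      by (cases as1 rule: rev_cases) auto
    let ?m = "length z2" and ?w = "?u z1 (nonzero_args z1 as1')"
    have IH: "T (pure_tensor sA (as1' @ a # as2)) =
        B.fill_zeros (z1 @ 1 # replicate ?m 1) (map f as1' @ f a # map f as2)
          (B.remove_zeros (z1 @ 1 # replicate ?m 1) (T (pure_tensor sA (?w @ a # as2))))"
      using snoc.IH[of "n # z2" as1' "a # as2"] snoc.prems as1 by simp
    have na: "length (nonzero_args z1 as1') = nonzero_count z1"
      using as1(2) by (rule length_nonzero_args)
    have w: "length ?w = length z1" by (simp add: length_fill_zero_parts)
    have n: "n = 0 \<or> n = 1" using z snoc.prems(1) by (auto simp: le_Suc_eq)
    then show ?case
    proof
      assume n: "n = 1"
      have "?u (z1 @ [n]) (nonzero_args (z1 @ [n]) as1) = ?w @ [a]"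
        using as1 na by (simp add: n nonzero_args_append fill_zero_parts_append replicate_append_same[symmetric])
      then show ?thesis using IH by (simp add: as1(1) n)
    next
      assume n: "n = 0"
      have "?u (z1 @ [n]) (nonzero_args (z1 @ [n]) as1) = ?w @ [1]"
        using as1 na fill_zero_parts_append[of "replicate (length z1) (1::'a)" z1 "nonzero_args z1 as1'" "[0]" "[1]" "[]"]
        by (simp add: n nonzero_args_append replicate_append_same[symmetric])
      moreover have "T (pure_tensor sA (?w @ a # as2)) = B.replace_factor (Suc (length z1 + ?m)) (length z1)
          (f a) (T (pure_tensor sA (?w @ 1 # as2)))"
      proof -
        have zz: "z = z1 @ 0 # z2" and lz: "length z = Suc (length z1 + ?m)" using snoc.prems(1) n by simp_all
        show ?thesis
          using ins[unfolded inserts_at_zeros_def, rule_format, OF zz w snoc.prems(3)] unfolding lz .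
      qed
      moreover have "T (pure_tensor sA (?w @ 1 # as2)) \<in> tensor_power sB (Suc (length z1 + ?m))"
        using val[of "?w @ 1 # as2"] w snoc.prems by simp
      ultimately show ?thesis
        using IH B.fill_remove_replace[of _ z1 ?m "map f as1'" "map f as2" "f a"] as1 snoc.prems(3)
        by (simp add: n)
    qed
  qed
  let ?F = "\<lambda>bs. B.remove_zeros z (T (pure_tensor sA (?u z bs)))"
  have "multilinear sA tscale (nonzero_count z) ?F"
  proof (rule multilinear_compose_linear[OF _ B.tensor_linear_remove_zeros], rule multilinearI)
    fix bs1 bs2 :: "'a list" assume "Suc (length bs1 + length bs2) = nonzero_count z"
    from fill_zero_parts_split[OF this, of "replicate (length z) 1"] obtain z1 n z2 u v where
      zz: "z = z1 @ n # z2" "length u = length z1" "length v = length z2"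
      and eq: "\<forall>x. ?u z (bs1 @ x # bs2) = u @ x # v" by auto
    have "Vector_Spaces.linear sA tscale (\<lambda>x. T (pure_tensor sA (u @ x # v)))"
      by (rule multilinearD[OF ml]) (use zz in simp)
    then show "Vector_Spaces.linear sA tscale (\<lambda>x. T (pure_tensor sA (?u z (bs1 @ x # bs2))))"
      by (simp only: eq)
  qed
  then obtain Q where Q: "Q \<in> tensor_hom sA sB (nonzero_count z) (nonzero_count z)"
    "\<And>bs. length bs = nonzero_count z \<Longrightarrow> Q (pure_tensor sA bs) = ?F bs"
    using tensor_hom_of_multilinear[OF vector_space_sA, of "nonzero_count z" ?F sB "nonzero_count z"]
      B.remove_zeros_in val length_fill_zero_parts[of _ z]
    by (metis length_replicate)
  have "T (pure_tensor sA as) = B.fill_zeros z (map f as) (Q (pure_tensor sA (nonzero_args z as)))"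
    if "length as = length z" for as
    using prefix[of z "[]" as "[]"] that Q(2)[OF length_nonzero_args[OF that]] by simp
  then show ?thesis using Q(1) unfolding zero_part_deletion_def by blast
qed

lemma delete_zero_parts_eqI:
  assumes "zero_part_deletion z T Q" "nonzero_count z > 0"
  shows "delete_zero_parts sA sB f z T = Q"
  unfolding delete_zero_parts_def zero_part_deletion_def[symmetric]
  using assms zero_part_deletion_unique by blast

lemma symbol_map_eq:
  assumes "zero_part_deletion (finest_refinement p) (P (finest_refinement p)) Q"
    and "sum_list p = n" "n \<ge> 1"
  shows "symbol_map sA sB f p P = (\<lambda>p'. if p' = replicate n 1 then Q else 0)"
proof -
  have "nonzero_count (finest_refinement p) > 0"
    unfolding length_filter_finest using assms(2,3) by simp
  from delete_zero_parts_eqI[OF assms(1) this] show ?thesis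
    unfolding symbol_map_def assms(2) by (simp only:)
qed

lemma symbol_component:
  assumes P: "P \<in> D_space sA sB f p" and n: "sum_list p = n" "n \<ge> 1"
  shows "\<exists>Q. zero_part_deletion (finest_refinement p) (P (finest_refinement p)) Q \<and>
    symbol_map sA sB f p P = (\<lambda>p'. if p' = replicate n 1 then Q else 0)"
proof -
  let ?z = "finest_refinement p"
  have z: "?z \<in> refinements p" by (rule finest_refinement_in_refinements)
  have "\<forall>k\<in>set ?z. k \<le> 1" using finest_refinement_le by blast
  from zero_part_deletion_exists[OF D_spaceD(2)[OF P z] D_spaceD(4)[OF P z] this]
  obtain Q where Q: "zero_part_deletion ?z (P ?z) Q" by blast
  show ?thesis using Q symbol_map_eq[where P = P, OF Q n] by blast
qed

text \<open>
  Removing factors at zero parts commutes with multiplication at the other factors, so the Leibniz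
  rules of the finest component, which have no sum, pass to its symbol.
\<close>

lemma symbol_map_in_D_space:
  assumes P: "P \<in> D_space sA sB f p" and n: "sum_list p = n" "n \<ge> 1"
  shows "symbol_map sA sB f p P \<in> D_space sA sB f (replicate n 1)"
proof -
  let ?z = "finest_refinement p"
  obtain Q where Q: "zero_part_deletion ?z (P ?z) Q"
    and sym: "symbol_map sA sB f p P = (\<lambda>p'. if p' = replicate n 1 then Q else 0)"
    using symbol_component[OF assms] by blast
  have z: "?z \<in> refinements p" by (rule finest_refinement_in_refinements)
  have count: "nonzero_count ?z = n" using length_filter_finest n by simp
  have pos: "nonzero_count ?z > 0" using count n(2) by simp
  have Qhom: "Q \<in> tensor_hom sA sB n n" using Q unfolding zero_part_deletion_def count by blast
  let ?u = "fill_zero_parts ?z (replicate (length ?z) (1 :: 'a))"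
  have Q_eq: "Q (pure_tensor sA bs) = B.remove_zeros ?z (P ?z (pure_tensor sA (?u bs)))"
    if "length bs = n" for bs
    by (rule zero_part_deletion_eq[OF Q pos]) (simp only: that count)
  have val: "P ?z (pure_tensor sA as) \<in> tensor_power sB (length ?z)" if "length as = length ?z" for as
    by (rule tensor_hom_value[OF D_spaceD(2)[OF P z] tensor_power_pure[OF that]])
  have empty: "(\<Sum>k\<in>{1..<1::nat}. h k) = (0 :: ('k, 'b) tensor)" for h by simp
  have "leibniz (\<lambda>r as. (if r = replicate n 1 then Q else 0) (pure_tensor sA as)) (replicate n 1)"
    unfolding leibniz_def
  proof (intro allI impI)
    fix r1 r2 :: "nat list" and m and bs1 bs2 :: "'a list" and x y :: 'a
    assume r: "replicate n 1 = r1 @ m # r2" and len: "length bs1 = length r1" "length bs2 = length r2"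
    have m: "m = 1" using r by (metis in_set_conv_decomp in_set_replicate)
    have len_n: "Suc (length bs1 + length bs2) = n"
      using arg_cong[OF r, of length] len by simp
    then have "Suc (length bs1 + length bs2) = nonzero_count ?z" by (simp only: count)
    from fill_zero_parts_split[OF this, of "replicate (length ?z) 1"] obtain z1 k z2 u v where
      zz: "?z = z1 @ k # z2" "k \<noteq> 0" "nonzero_count z1 = length bs1"
      and uv: "length u = length z1" "length v = length z2"
      and eq: "\<And>x. ?u (bs1 @ x # bs2) = u @ x # v" by auto
    have k: "k > 0" "k = 1" using zz(2) finest_refinement_le[of k p] zz(1) by auto
    have len_uv: "length (u @ c # v) = length ?z" for c using uv zz(1) by simp
    have "P ?z (pure_tensor sA (u @ (x * y) # v)) =
        lmult sB (length ?z) (length z1) (f x) (P ?z (pure_tensor sA (u @ y # v))) +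
        rmult sB (length ?z) (length z1) (f y) (P ?z (pure_tensor sA (u @ x # v)))"
      using D_spaceD(3)[OF P z, unfolded leibniz_def, rule_format, OF zz(1) k(1) uv, of x y]
      by (simp only: k(2) empty add_0_right)
    then have "Q (pure_tensor sA (bs1 @ (x * y) # bs2)) =
        lmult sB n (length bs1) (f x) (Q (pure_tensor sA (bs1 @ y # bs2))) +
        rmult sB n (length bs1) (f y) (Q (pure_tensor sA (bs1 @ x # bs2)))"
      using len_n by (simp only: Q_eq length_append list.size add_Suc_right add_0_right eq
          linear_addD[OF B.tensor_linear_remove_zeros]
          B.remove_zeros_mult[OF val[OF len_uv] zz(1,2)] count zz(3))
    then show "(if replicate n 1 = replicate n 1 then Q else 0) (pure_tensor sA (bs1 @ (x * y) # bs2)) =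
        lmult sB (length (replicate n (1::nat))) (length r1) (f x)
          ((if replicate n 1 = replicate n 1 then Q else 0) (pure_tensor sA (bs1 @ y # bs2))) +
        rmult sB (length (replicate n (1::nat))) (length r1) (f y)
          ((if replicate n 1 = replicate n 1 then Q else 0) (pure_tensor sA (bs1 @ x # bs2))) +
        (\<Sum>k\<in>{1..<m}. merge sB (length (replicate n (1::nat))) (length r1)
          ((if r1 @ k # (m - k) # r2 = replicate n 1 then Q else 0) (pure_tensor sA (bs1 @ x # y # bs2))))"
      by (simp only: m empty add_0_right if_True refl length_replicate len(1)[symmetric])
  qed
  moreover have "inserts_at_zeros (replicate n 1) F" for F
    unfolding inserts_at_zeros_def
    by (metis in_set_conv_decomp in_set_replicate zero_neq_one)
  moreover have "r \<notin> refinements (replicate n 1) \<Longrightarrow> (if r = replicate n 1 then Q else 0) = 0" for r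
    by (simp add: refinements_ones[simplified])
  ultimately show ?thesis
    unfolding sym D_space_iff refinements_ones using Qhom by simp
qed

lemma zero_part_deletion_add:
  assumes "zero_part_deletion z T Q" "zero_part_deletion z T' Q'"
  shows "zero_part_deletion z (T + T') (Q + Q')"
  using assms unfolding zero_part_deletion_def
  by (simp only: add_in_tensor_hom plus_fun_apply[of T T'] plus_fun_apply[of Q Q']
      linear_addD[OF tensor_linear_tensor_map]) simp

lemma zero_part_deletion_scale:
  assumes "zero_part_deletion z T Q"
  shows "zero_part_deletion z (\<lambda>X. tscale c (T X)) (\<lambda>X. tscale c (Q X))"
  unfolding zero_part_deletion_def
proof (intro conjI allI impI)
  show "(\<lambda>X. tscale c (Q X)) \<in> tensor_hom sA sB (nonzero_count z) (nonzero_count z)"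
    using assms unfolding zero_part_deletion_def by (intro scale_in_tensor_hom) blast
  fix as :: "'a list" assume "length as = length z"
  then have "T (pure_tensor sA as) = B.fill_zeros z (map f as) (Q (pure_tensor sA (nonzero_args z as)))"
    using assms unfolding zero_part_deletion_def by blast
  then show "tscale c (T (pure_tensor sA as)) =
      B.fill_zeros z (map f as) (tscale c (Q (pure_tensor sA (nonzero_args z as))))"
    by (simp only: linear_scaleD[OF tensor_linear_tensor_map])
qed

lemma zero_part_deletion_zero: "zero_part_deletion z 0 0"
  unfolding zero_part_deletion_def
proof (intro conjI allI impI zero_in_tensor_hom)
  have zero: "(0 :: ('k, 'a) tensor \<Rightarrow> ('k, 'b) tensor) X = 0" for X by (rule zero_fun_apply)
  show "0 (pure_tensor sA as) = B.fill_zeros z (map f as) (0 (pure_tensor sA (nonzero_args z as)))" for as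
    unfolding zero by (rule linear_zeroD[OF tensor_linear_tensor_map, symmetric])
qed

lemma linear_on_symbol_map:
  assumes n: "sum_list p = n" "n \<ge> 1"
  shows "linear_on fscale fscale (D_space sA sB f p) (D_space sA sB f (replicate n 1))
    (symbol_map sA sB f p)"
  unfolding linear_on_def
proof (intro conjI ballI allI)
  let ?z = "finest_refinement p"
  fix P assume P: "P \<in> D_space sA sB f p"
  show "symbol_map sA sB f p P \<in> D_space sA sB f (replicate n 1)"
    by (rule symbol_map_in_D_space[OF P n])
  obtain Q where Q: "zero_part_deletion ?z (P ?z) Q" using symbol_component[OF P n] by blast
  show "symbol_map sA sB f p (P + P') = symbol_map sA sB f p P + symbol_map sA sB f p P'"
    if P': "P' \<in> D_space sA sB f p" for P'
  proof -
    obtain Q' where Q': "zero_part_deletion ?z (P' ?z) Q'" using symbol_component[OF P' n] by blast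
    have "(P + P') ?z = P ?z + P' ?z" by (rule plus_fun_apply)
    then have "zero_part_deletion ?z ((P + P') ?z) (Q + Q')"
      using zero_part_deletion_add[OF Q Q'] by simp
    from symbol_map_eq[where P = "P + P'", OF this n] symbol_map_eq[where P = P, OF Q n]
      symbol_map_eq[where P = P', OF Q' n]
    show ?thesis by (auto simp: fun_eq_iff)
  qed
  show "symbol_map sA sB f p (fscale c P) = fscale c (symbol_map sA sB f p P)" for c
  proof -
    have "zero_part_deletion ?z (fscale c P ?z) (\<lambda>X. tscale c (Q X))"
      unfolding fscale_def by (rule zero_part_deletion_scale[OF Q])
    from symbol_map_eq[where P = "fscale c P", OF this n] symbol_map_eq[where P = P, OF Q n]
    show ?thesis by (auto simp: fun_eq_iff fscale_def tscale_def)
  qed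
qed

text \<open>Zero parts carry no information: the finest component is recovered from the symbol by filling.\<close>

lemma symbol_map_eq_zero_iff:
  assumes P: "P \<in> D_space sA sB f p" and n: "sum_list p = n" "n \<ge> 1"
  shows "symbol_map sA sB f p P = 0 \<longleftrightarrow> P (finest_refinement p) = 0"
proof
  let ?z = "finest_refinement p"
  have z: "?z \<in> refinements p" by (rule finest_refinement_in_refinements)
  obtain Q where Q: "zero_part_deletion ?z (P ?z) Q"
    and sym: "symbol_map sA sB f p P = (\<lambda>p'. if p' = replicate n 1 then Q else 0)"
    using symbol_component[OF assms] by blast
  {
    assume "symbol_map sA sB f p P = 0"
    from fun_cong[OF this, of "replicate n 1"] have "Q = 0" by (simp add: sym)
    have zero: "(0 :: ('k, 'a) tensor \<Rightarrow> ('k, 'b) tensor) X = 0" for X by (rule zero_fun_apply)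
    have "P ?z (pure_tensor sA as) = 0 (pure_tensor sA as)" if "length as = length ?z" for as
    proof -
      have "P ?z (pure_tensor sA as) =
          B.fill_zeros ?z (map f as) (0 (pure_tensor sA (nonzero_args ?z as)))"
        using Q that unfolding zero_part_deletion_def \<open>Q = 0\<close> by blast
      then show ?thesis unfolding zero linear_zeroD[OF tensor_linear_tensor_map] .
    qed
    then show "P ?z = 0"
      by (rule tensor_hom_ext[OF D_spaceD(2)[OF P z] zero_in_tensor_hom])
  next
    assume "P ?z = 0"
    then have "zero_part_deletion ?z (P ?z) 0" using zero_part_deletion_zero by simp
    from symbol_map_eq[where P = P, OF this n] show "symbol_map sA sB f p P = 0"
      by (simp add: fun_eq_iff)
  }
qed

text \<open>
  Conversely, filling in zero parts turns a multiderivation into a possible finest component, from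
  which \<open>exists_with_top_component\<close> produces a family.
\<close>

lemma jet_component_fill:
  assumes R: "R \<in> D_space sA sB f (replicate n 1)" and z: "\<forall>k\<in>set z. k \<le> 1" "nonzero_count z = n"
  shows "jet_component (\<lambda>_ as. B.fill_zeros z (map f as)
    (R (replicate n 1) (pure_tensor sA (nonzero_args z as)))) z"
proof -
  let ?R = "\<lambda>bs. R (replicate n 1) (pure_tensor sA bs)"
  let ?G = "\<lambda>as. B.fill_zeros z (map f as) (?R (nonzero_args z as))"
  have ones: "replicate n 1 \<in> refinements (replicate n 1)" by (simp only: refinements_ones insertI1)
  have hom: "R (replicate n 1) \<in> tensor_hom sA sB n n"
    using D_spaceD(2)[OF R ones] by simp
  have ml: "multilinear sA tscale n ?R" and val: "\<And>bs. length bs = n \<Longrightarrow> ?R bs \<in> tensor_power sB n"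
    using tensor_multilinear_tensor_hom[OF hom] by (auto simp: tensor_multilinear_def)
  have val': "?R (nonzero_args z as) \<in> tensor_power sB (nonzero_count z)" if "length as = length z" for as
    using length_nonzero_args[OF that] val z(2) by simp
  have split: "map f (as1 @ x # as2) = map f as1 @ f x # map f as2" for as1 x as2 by simp
  have "multilinear sA tscale (length z) ?G"
  proof (rule multilinearI)
    fix as1 as2 :: "'a list" assume len: "Suc (length as1 + length as2) = length z"
    then obtain z1 k z2 where zz: "z = z1 @ k # z2" "length z1 = length as1"
      using split_at[of "length as1" z] by auto
    have lens: "length as1 = length z1" "length as2 = length z2"
      "length (map f as1) = length z1" "length (map f as2) = length z2" using zz len by auto
    have len_as: "length (as1 @ x # as2) = length z" for x using len by simp
    show "Vector_Spaces.linear sA tscale (\<lambda>x. ?G (as1 @ x # as2))"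
    proof (cases "k = 0")
      case True
      have na: "nonzero_args z (as1 @ x # as2) = nonzero_args z1 as1 @ nonzero_args z2 as2" for x
        using True lens by (simp add: zz(1) nonzero_args_append)
      have X: "?R (nonzero_args z1 as1 @ nonzero_args z2 as2) \<in> tensor_power sB (nonzero_count z)"
        using val'[OF len_as, of 1] by (simp only: na)
      have "?G (as1 @ x # as2) = B.replace_factor (length z) (length z1) (f x)
          (B.fill_zeros z (map f as1 @ 1 # map f as2) (?R (nonzero_args z1 as1 @ nonzero_args z2 as2)))" for x
        unfolding na split by (rule B.fill_zeros_at_zero[OF X zz(1)[unfolded True] lens(3,4)])
      moreover have "B.fill_zeros z (map f as1 @ 1 # map f as2)
          (?R (nonzero_args z1 as1 @ nonzero_args z2 as2)) \<in> tensor_power sB (length z)"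
        by (rule B.fill_zeros_in[OF X]) (use lens zz(1) in simp)
      moreover have "length z1 < length z" using zz(1) by simp
      ultimately show ?thesis
        using linear_compose_field[OF hom_linear B.linear_replace_factor_parameter] by (simp only:)
    next
      case False
      have na: "nonzero_args z (as1 @ x # as2) = nonzero_args z1 as1 @ x # nonzero_args z2 as2" for x
        using False lens by (simp add: zz(1) nonzero_args_append)
      have "?G (as1 @ x # as2) = B.fill_zeros z (map f as1 @ 1 # map f as2)
          (?R (nonzero_args z1 as1 @ x # nonzero_args z2 as2))" for x
        unfolding split using val'[OF len_as, of x] unfolding na
        by (rule B.fill_zeros_at_nonzero[OF _ zz(1) False lens(3,4)])
      moreover have "Vector_Spaces.linear sA tscale (\<lambda>x. ?R (nonzero_args z1 as1 @ x # nonzero_args z2 as2))"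
        by (rule multilinearD[OF ml])
          (use length_nonzero_args[OF len_as, of 1] na[of 1] z(2) in simp)
      ultimately show ?thesis
        using linear_compose_field[OF _ tensor_linear_tensor_map] by (simp only:)
    qed
  qed
  moreover have "?G as \<in> tensor_power sB (length z)" if "length as = length z" for as
    using that by (intro B.fill_zeros_in val') simp_all
  moreover have "leibniz (\<lambda>_. ?G) z"
    unfolding leibniz_def
  proof (intro allI impI)
    fix z1 k z2 and as1 as2 :: "'a list" and x y :: 'a
    assume zz: "z = z1 @ k # z2" and k: "k > 0" and len: "length as1 = length z1" "length as2 = length z2"
    have k1: "k = 1" "k \<noteq> 0" using k z(1) zz by auto
    have len_as: "length (as1 @ c # as2) = length z" for c using len zz by simp
    have lens: "length (map f as1) = length z1" "length (map f as2) = length z2" using len by simp_all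
    have na: "nonzero_args z (as1 @ c # as2) = nonzero_args z1 as1 @ c # nonzero_args z2 as2" for c
      using k len by (simp add: zz nonzero_args_append)
    let ?n1 = "nonzero_args z1 as1" and ?n2 = "nonzero_args z2 as2"
    have n1: "length ?n1 = nonzero_count z1" "length ?n2 = nonzero_count z2"
      using len by (simp_all add: length_nonzero_args)
    have n: "n = Suc (length ?n1 + length ?n2)" using z(2) k n1 by (simp add: zz)
    have empty: "(\<Sum>k\<in>{1..<1::nat}. h k) = (0 :: ('k, 'b) tensor)" for h by simp
    have rep: "replicate n 1 = replicate (length ?n1) 1 @ (1::nat) # replicate (length ?n2) 1"
      unfolding n by (simp add: replicate_add replicate_app_Cons_same)
    have R_leib: "?R (?n1 @ (x * y) # ?n2) = lmult sB n (nonzero_count z1) (f x) (?R (?n1 @ y # ?n2)) +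
        rmult sB n (nonzero_count z1) (f y) (?R (?n1 @ x # ?n2))"
      using D_spaceD(3)[OF R ones, unfolded leibniz_def, rule_format, OF rep zero_less_one
          length_replicate[symmetric] length_replicate[symmetric], of x y]
      by (simp only: empty add_0_right length_replicate n1(1))
    have valc: "?R (?n1 @ c # ?n2) \<in> tensor_power sB (nonzero_count z)" for c
      using val'[OF len_as] by (simp only: na)
    let ?fill = "\<lambda>c. B.fill_zeros z (map f as1 @ c # map f as2)"
    have indep: "?fill c (?R (?n1 @ d # ?n2)) = ?fill 1 (?R (?n1 @ d # ?n2))" for c d
      by (rule B.fill_zeros_at_nonzero[OF valc zz k1(2) lens])
    have lens1: "length (map f as1 @ 1 # map f as2) = length z" using len zz by simp
    have G: "?G (as1 @ c # as2) = ?fill 1 (?R (?n1 @ c # ?n2))" for c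
      unfolding split na by (rule indep)
    show "?G (as1 @ (x * y) # as2) =
        lmult sB (length z) (length z1) (f x) (?G (as1 @ y # as2)) +
        rmult sB (length z) (length z1) (f y) (?G (as1 @ x # as2)) +
        (\<Sum>c\<in>{1..<k}. merge sB (length z) (length z1) (?G (as1 @ x # y # as2)))"
      unfolding k1(1) empty add_0_right G
      by (simp only: R_leib linear_addD[OF tensor_linear_tensor_map]
          B.fill_zeros_mult[OF valc zz k1(2) lens1, unfolded z(2)])
  qed
  moreover have "inserts_at_zeros z ?G"
    unfolding inserts_at_zeros_def
  proof (intro allI impI)
    fix z1 z2 and as1 as2 :: "'a list" and a :: 'a
    assume zz: "z = z1 @ 0 # z2" and len: "length as1 = length z1" "length as2 = length z2"
    have na: "nonzero_args z (as1 @ c # as2) = nonzero_args z1 as1 @ nonzero_args z2 as2" for c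
      using len by (simp add: zz nonzero_args_append)
    have "length (as1 @ 1 # as2) = length z" using len zz by simp
    from val'[OF this] have X: "?R (nonzero_args z1 as1 @ nonzero_args z2 as2) \<in> tensor_power sB (nonzero_count z)"
      by (simp only: na)
    show "?G (as1 @ a # as2) = B.replace_factor (length z) (length z1) (f a) (?G (as1 @ 1 # as2))"
      unfolding na split hom_one
      by (rule B.fill_zeros_at_zero[OF X zz]) (use len in simp_all)
  qed
  ultimately show ?thesis unfolding jet_component_def tensor_multilinear_def by blast
qed

lemma symbol_map_surjective:
  assumes \<Theta>: "A.splitting_derivation \<Theta>" and n: "sum_list p = n" "n \<ge> 1"
    and R: "R \<in> D_space sA sB f (replicate n 1)"
  shows "\<exists>P\<in>D_space sA sB f p. symbol_map sA sB f p P = R"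
proof -
  let ?z = "finest_refinement p"
  have z: "\<forall>k\<in>set ?z. k \<le> 1" "nonzero_count ?z = n" "?z \<in> refinements p"
    using finest_refinement_le length_filter_finest n finest_refinement_in_refinements by auto
  have min: "map (min 1) ?z = ?z" using z(1) by (intro map_idI) (simp add: min.absorb2)
  have ones: "replicate n 1 \<in> refinements (replicate n 1)" by (simp only: refinements_ones insertI1)
  have hom: "R (replicate n 1) \<in> tensor_hom sA sB n n"
    using D_spaceD(2)[OF R ones] by simp
  obtain P where P: "P \<in> D_space sA sB f p" and P_z: "\<forall>as. length as = length ?z \<longrightarrow>
      P ?z (pure_tensor sA as) = B.fill_zeros ?z (map f as)
        (R (replicate n 1) (pure_tensor sA (nonzero_args ?z as)))"
    using exists_with_top_component[OF \<Theta> z(3), unfolded min, OF jet_component_fill[OF R z(1,2)]]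
    by blast
  then have "zero_part_deletion ?z (P ?z) (R (replicate n 1))"
    using hom unfolding zero_part_deletion_def z(2) by blast
  from symbol_map_eq[where P = P, OF this n]
  have "symbol_map sA sB f p P = (\<lambda>p'. if p' = replicate n 1 then R (replicate n 1) else 0)" .
  also have "\<dots> = R"
  proof
    fix p'
    show "(if p' = replicate n 1 then R (replicate n 1) else 0) = R p'"
      using D_spaceD(1)[OF R, of p'] unfolding refinements_ones by auto
  qed
  finally show ?thesis using P by blast
qed

end

theorem proposition2p4p6:
  fixes sA :: "'k::field \<Rightarrow> 'a::{ring,monoid_mult} \<Rightarrow> 'a"
    and sB :: "'k \<Rightarrow> 'b::{ring,monoid_mult} \<Rightarrow> 'b"
    and f :: "'a \<Rightarrow> 'b"
    and n q :: nat and p :: "nat list"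
  assumes "k_algebra_hom sA sB f"
    and "formally_smooth sA"
    and "n \<ge> 1"
    and "p \<in> ordered_partitions q n"
  shows "short_exact_sequence fscale fscale fscale
    (order_filtration sA sB f n p) (\<lambda>P. P) (D_space sA sB f p) (symbol_map sA sB f p)
    (D_space sA sB f (replicate n 1))"
proof -
  interpret k_algebra_hom sA sB f by fact
  interpret V: vector_space "fscale :: 'k \<Rightarrow> ('k, 'a, 'b) family \<Rightarrow> _"
    by (rule vector_space_fscale)
  let ?F = "order_filtration sA sB f n p" and ?D = "D_space sA sB f p"
  have n: "sum_list p = n" using assms(4) by (simp add: ordered_partitions_def)
  obtain \<Theta> where \<Theta>: "A.splitting_derivation \<Theta>"
    using A.formally_smooth_splitting_derivation[OF assms(2)] by blast
  have sub: "?F \<subseteq> ?D" by (rule order_filtration_subset)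
  have "?F = {P \<in> ?D. symbol_map sA sB f p P = 0}"
  proof (intro subset_antisym subsetI)
    fix P assume P: "P \<in> ?F"
    then show "P \<in> {P \<in> ?D. symbol_map sA sB f p P = 0}"
      using sub order_filtration_finest[OF P n assms(3)] symbol_map_eq_zero_iff[OF _ n assms(3)] by blast
  next
    fix P assume "P \<in> {P \<in> ?D. symbol_map sA sB f p P = 0}"
    then show "P \<in> ?F"
      using order_filtrationI[OF \<Theta> n assms(3)] symbol_map_eq_zero_iff[OF _ n assms(3)] by blast
  qed
  moreover have "symbol_map sA sB f p ` ?D = D_space sA sB f (replicate n 1)"
    using symbol_map_in_D_space[OF _ n assms(3)] symbol_map_surjective[OF \<Theta> n assms(3)] by blast
  moreover have "V.subspace ?F" unfolding order_filtration_def by (rule V.subspace_span)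
  moreover have "linear_on fscale fscale ?F ?D (\<lambda>P. P)" unfolding linear_on_def using sub by blast
  ultimately show ?thesis
    unfolding short_exact_sequence_def
    using subspace_D_space linear_on_symbol_map[OF n assms(3)] by (simp add: inj_on_def image_def)
qed

end
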